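(* For every $0<p<\infty$ with $p\neq2$, the isometry group $\operatorname{Iso}(H^p)$ of the Hardy space $H^p$ is topologically reflexive.
   Context: Let $U$ be the open unit disc in $\mathbb C$. For $0<p<\infty$, $H^p$ is the space of all holomorphic functions $f:U\to\mathbb C$ for which $\|f\|_p=\sup_{0\le r<1}\left(\frac1{2\pi}\int_0^{2\pi}|f(re^{i\theta})|^p\,d\theta\right)^{1/p}$ is finite. For $p\ge1$ this is a complete norm; for $0<p<1$ it is a $p$-norm ($\|f+g\|_p^p\le\|f\|_p^p+\|g\|_p^p$) and $H^p$ is a quasi-Banach space with the induced topology. For $X=H^p$, $\operatorname{Iso}(X)$ is the group of all surjective ($\mathbb C$-linear) isometries of $X$ (linear $T$ with $\|Tf\|_p=\|f\|_p$ for all $f$). $B(X)$ is the algebra of all continuous linear operators on $X$. For $\mathscr S\subset B(X)$ put $\operatorname{ref}_{to}\mathscr S=\{T\in B(X): Tx\in\overline{\{Lx:L\in\mathscr S\}}\text{ for all }x\in X\}$ (closure in $X$); $\mathscr S$ is topologically reflexive if $\operatorname{ref}_{to}\mathscr S=\mathscr S$. *)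

theory Defs
  imports "HOL-Analysis.Analysis"
begin

section \<open>Hardy spaces on the unit disc\<close>

definition circle_mean :: "real \<Rightarrow> (complex \<Rightarrow> complex) \<Rightarrow> real \<Rightarrow> real" where
  "circle_mean p f r = 1 / (2 * pi) * integral {0..2*pi} (\<lambda>\<theta>. cmod (f (of_real r * cis \<theta>)) powr p)"

text \<open>
  This is only meaningful for functions with bounded means, i.e. on \<open>hardy_space p\<close> below.
\<close>

definition hardy_norm :: "real \<Rightarrow> (complex \<Rightarrow> complex) \<Rightarrow> real" where
  "hardy_norm p f = (SUP r\<in>{0..<1}. circle_mean p f r powr (1 / p))"

text \<open>
  A function on the disc is represented by its extension by zero to the whole plane, so that
  equality of elements is equality of HOL functions and the vector space operations are pointwise.
\<close>

definition hardy_space :: "real \<Rightarrow> (complex \<Rightarrow> complex) set" where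
  "hardy_space p = {f. f holomorphic_on ball 0 1 \<and> (\<forall>z. z \<notin> ball 0 1 \<longrightarrow> f z = 0) \<and>
                       bdd_above ((\<lambda>r. circle_mean p f r powr (1 / p)) ` {0..<1})}"

text \<open>
  The metric is induced by the norm if \<open>p \<ge> 1\<close>, and by the \<open>p\<close>-norm (which requires the
  \<open>p\<close>-th power for the triangle inequality) if \<open>p < 1\<close>.
\<close>

definition hardy_dist :: "real \<Rightarrow> (complex \<Rightarrow> complex) \<Rightarrow> (complex \<Rightarrow> complex) \<Rightarrow> real" where
  "hardy_dist p f g = hardy_norm p (\<lambda>z. f z - g z) powr min 1 p"

definition hardy_topology :: "real \<Rightarrow> (complex \<Rightarrow> complex) topology" where
  "hardy_topology p = Metric_space.mtopology (hardy_space p) (hardy_dist p)"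


section \<open>Operators, isometries and topological reflexivity\<close>

type_synonym operator = "(complex \<Rightarrow> complex) \<Rightarrow> (complex \<Rightarrow> complex)"

text \<open>
  Operators are extensional, i.e. \<open>undefined\<close> outside \<open>hardy_space p\<close>, so that equality of
  operators is equality of HOL functions.
\<close>

definition linear_operators :: "real \<Rightarrow> operator set" where
  "linear_operators p = {T \<in> hardy_space p \<rightarrow>\<^sub>E hardy_space p.
     (\<forall>f\<in>hardy_space p. \<forall>g\<in>hardy_space p. T (\<lambda>z. f z + g z) = (\<lambda>z. T f z + T g z)) \<and>
     (\<forall>c. \<forall>f\<in>hardy_space p. T (\<lambda>z. c * f z) = (\<lambda>z. c * T f z))}"

definition continuous_operators :: "real \<Rightarrow> operator set" where
  "continuous_operators p =
     {T \<in> linear_operators p. continuous_map (hardy_topology p) (hardy_topology p) T}"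

definition isometry_group :: "real \<Rightarrow> operator set" where
  "isometry_group p = {T \<in> linear_operators p.
     T ` hardy_space p = hardy_space p \<and> (\<forall>f\<in>hardy_space p. hardy_norm p (T f) = hardy_norm p f)}"

definition ref_to :: "real \<Rightarrow> operator set \<Rightarrow> operator set" where
  "ref_to p S = {T \<in> continuous_operators p.
     \<forall>f\<in>hardy_space p. T f \<in> hardy_topology p closure_of {L f |L. L \<in> S}}"

definition topologically_reflexive :: "real \<Rightarrow> operator set \<Rightarrow> bool" where
  "topologically_reflexive p S \<longleftrightarrow> ref_to p S = S"


section \<open>The metric space axioms\<close>

text \<open>
  \<^const>\<open>Metric_space.mtopology\<close> only has its intended meaning if the metric space axioms hold,
  which is verified here.
\<close>

lemma continuous_on_circle_powr:
  assumes "f holomorphic_on ball 0 1" "0 \<le> r" "r < 1" "p > 0"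
  shows "continuous_on A (\<lambda>\<theta>. cmod (f (of_real r * cis \<theta>)) powr p)"
proof -
  have "continuous_on A (\<lambda>\<theta>. f (of_real r * cis \<theta>))"
  proof (rule continuous_on_compose2[OF holomorphic_on_imp_continuous_on[OF assms(1)]])
    show "continuous_on A (\<lambda>\<theta>. complex_of_real r * cis \<theta>)"
      by (intro continuous_intros)
    show "(\<lambda>\<theta>. complex_of_real r * cis \<theta>) ` A \<subseteq> ball 0 1"
      using assms by (auto simp: norm_mult)
  qed
  then show ?thesis
    using assms(4) by (intro continuous_on_powr' continuous_intros) auto
qed

lemma circle_mean_nonneg: "circle_mean p f r \<ge> 0"
proof -
  have "integral {0..2*pi} (\<lambda>\<theta>. cmod (f (of_real r * cis \<theta>)) powr p) \<ge> 0"
    by (cases "(\<lambda>\<theta>. cmod (f (of_real r * cis \<theta>)) powr p) integrable_on {0..2*pi}")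
       (auto intro: integral_nonneg simp: not_integrable_integral)
  then show ?thesis by (simp add: circle_mean_def)
qed

lemma circle_mean_add_le:
  assumes "f holomorphic_on ball 0 1" "g holomorphic_on ball 0 1" "0 \<le> r" "r < 1" "p > 0"
    and le: "\<And>x y. x \<ge> 0 \<Longrightarrow> y \<ge> 0 \<Longrightarrow> (x + y) powr p \<le> c * x powr p + d * y powr p"
  shows "circle_mean p (\<lambda>z. f z + g z) r \<le> c * circle_mean p f r + d * circle_mean p g r"
proof -
  let ?I = "\<lambda>f \<theta>. cmod (f (of_real r * cis \<theta>)) powr p"
  have int: "?I h integrable_on {0..2*pi}" if "h holomorphic_on ball 0 1" for h
    using that assms by (intro integrable_continuous_real continuous_on_circle_powr) auto
  have "integral {0..2*pi} (?I (\<lambda>z. f z + g z)) \<le> integral {0..2*pi} (\<lambda>\<theta>. c * ?I f \<theta> + d * ?I g \<theta>)"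
  proof (rule integral_le)
    show "?I (\<lambda>z. f z + g z) integrable_on {0..2*pi}"
      by (intro int holomorphic_intros assms)
    show "(\<lambda>\<theta>. c * ?I f \<theta> + d * ?I g \<theta>) integrable_on {0..2*pi}"
      by (intro integrable_add integrable_on_mult_right int assms)
  next
    fix \<theta>
    have "?I (\<lambda>z. f z + g z) \<theta> \<le> (cmod (f (of_real r * cis \<theta>)) + cmod (g (of_real r * cis \<theta>))) powr p"
      using assms by (intro powr_mono2 norm_triangle_ineq) auto
    also have "\<dots> \<le> c * ?I f \<theta> + d * ?I g \<theta>"
      by (intro le) auto
    finally show "?I (\<lambda>z. f z + g z) \<theta> \<le> c * ?I f \<theta> + d * ?I g \<theta>" .
  qed
  also have "\<dots> = c * integral {0..2*pi} (?I f) + d * integral {0..2*pi} (?I g)"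
    by (subst integral_add) (auto intro!: integrable_on_mult_right int assms)
  finally show ?thesis
    by (simp add: circle_mean_def divide_simps algebra_simps)
qed

lemma powr_convex_nonneg:
  fixes x y :: real
  assumes "p \<ge> 1" "x \<ge> 0" "y \<ge> 0" "u \<ge> 0" "v \<ge> 0" "u + v = 1"
  shows "(u * x + v * y) powr p \<le> u * x powr p + v * y powr p"
proof -
  have *: "(w * z) powr p \<le> w * z powr p" if "w \<ge> 0" "w \<le> 1" "z \<ge> 0" for w z :: real
  proof -
    have "w powr p \<le> w powr 1"
      using that assms by (intro powr_mono') auto
    then show ?thesis
      using that by (simp add: powr_mult mult_right_mono)
  qed
  consider "x = 0" | "y = 0" | "x > 0" "y > 0" using assms by linarith
  then show ?thesis
  proof cases
    case 1
    then show ?thesis using *[of v y] assms by simp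
  next
    case 2
    then show ?thesis using *[of u x] assms by simp
  next
    case 3
    have u: "u = 1 - v" using assms by simp
    show ?thesis
      using convex_onD[OF powr_convex[OF assms(1)], of v x y] 3 assms by (simp add: u)
  qed
qed

lemma powr_subadditive:
  fixes x y :: real
  assumes "0 < p" "p \<le> 1" "x \<ge> 0" "y \<ge> 0"
  shows "(x + y) powr p \<le> x powr p + y powr p"
proof (cases "x + y = 0")
  case False
  then have pos: "x + y > 0" using assms by linarith
  have *: "z / (x + y) \<le> (z / (x + y)) powr p" if "z \<ge> 0" "z \<le> x + y" for z
    using powr_mono'[of p 1 "z / (x + y)"] that assms pos by simp
  have "1 = x / (x + y) + y / (x + y)"
    using pos by (simp add: divide_simps)
  also have "\<dots> \<le> (x / (x + y)) powr p + (y / (x + y)) powr p"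
    by (intro add_mono *) (use assms in auto)
  also have "\<dots> = (x powr p + y powr p) / (x + y) powr p"
    using assms pos by (simp add: powr_divide add_divide_distrib)
  finally show ?thesis using pos by (simp add: divide_simps)
qed (use assms in auto)

lemma circle_mean_minkowski:
  assumes "f holomorphic_on ball 0 1" "g holomorphic_on ball 0 1" "0 \<le> r" "r < 1" "p \<ge> 1"
    and ab: "a > 0" "b > 0" and M: "circle_mean p f r \<le> a powr p" "circle_mean p g r \<le> b powr p"
  shows "circle_mean p (\<lambda>z. f z + g z) r \<le> (a + b) powr p"
proof -
  define s where "s = a + b"
  define c where "c = s powr p * (a / s)"
  define d where "d = s powr p * (b / s)"
  have s: "s > 0" and uv: "a / s + b / s = 1"
    using ab by (auto simp: s_def simp flip: add_divide_distrib)
  have "(x + y) powr p \<le> c / a powr p * x powr p + d / b powr p * y powr p"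
    if "x \<ge> 0" "y \<ge> 0" for x y
  proof -
    have "(x + y) powr p = (s * (a / s * (x / a) + b / s * (y / b))) powr p"
      using s ab by (simp add: divide_simps)
    also have "\<dots> = s powr p * (a / s * (x / a) + b / s * (y / b)) powr p"
      by (rule powr_mult)
    also have "\<dots> \<le> s powr p * (a / s * (x / a) powr p + b / s * (y / b) powr p)"
      using s ab that assms uv by (intro mult_left_mono powr_convex_nonneg) auto
    also have "\<dots> = c / a powr p * x powr p + d / b powr p * y powr p"
      using ab that by (simp add: c_def d_def powr_divide algebra_simps)
    finally show ?thesis .
  qed
  then have "circle_mean p (\<lambda>z. f z + g z) r
      \<le> c / a powr p * circle_mean p f r + d / b powr p * circle_mean p g r"
    using assms by (intro circle_mean_add_le) auto
  also have "\<dots> \<le> c / a powr p * a powr p + d / b powr p * b powr p"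
    using M ab s by (intro add_mono mult_left_mono) (auto simp: c_def d_def)
  also have "\<dots> = s powr p * (a / s + b / s)"
    using ab by (simp add: c_def d_def algebra_simps)
  finally show ?thesis using uv by (simp add: s_def)
qed

lemma hardy_norm_nonneg:
  assumes "f \<in> hardy_space p"
  shows "hardy_norm p f \<ge> 0"
proof -
  have "circle_mean p f 0 powr (1 / p) \<le> hardy_norm p f"
    using assms unfolding hardy_norm_def hardy_space_def by (intro cSUP_upper) auto
  then show ?thesis by (meson order_trans powr_ge_zero)
qed

lemma circle_mean_le_hardy_norm:
  assumes "f \<in> hardy_space p" "0 < p" "0 \<le> r" "r < 1"
  shows "circle_mean p f r \<le> hardy_norm p f powr p"
proof -
  have "circle_mean p f r powr (1 / p) \<le> hardy_norm p f"
    using assms unfolding hardy_norm_def hardy_space_def by (intro cSUP_upper) auto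
  then have "(circle_mean p f r powr (1 / p)) powr p \<le> hardy_norm p f powr p"
    using assms by (intro powr_mono2) auto
  then show ?thesis using assms circle_mean_nonneg[of p f r] by (simp add: powr_powr)
qed

lemma hardy_spaceI:
  assumes "f holomorphic_on ball 0 1" "\<And>z. z \<notin> ball 0 1 \<Longrightarrow> f z = 0" "0 < p" "0 \<le> c"
    and "\<And>r. 0 \<le> r \<Longrightarrow> r < 1 \<Longrightarrow> circle_mean p f r \<le> c powr p"
  shows "f \<in> hardy_space p" "hardy_norm p f \<le> c"
proof -
  have *: "circle_mean p f r powr (1 / p) \<le> c" if "r \<in> {0..<1}" for r
  proof -
    have "circle_mean p f r powr (1 / p) \<le> (c powr p) powr (1 / p)"
      using that assms circle_mean_nonneg by (intro powr_mono2) auto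
    then show ?thesis using assms by (simp add: powr_powr)
  qed
  show "f \<in> hardy_space p"
    using assms(1,2) * unfolding hardy_space_def by (auto intro!: bdd_aboveI2[of _ _ c])
  show "hardy_norm p f \<le> c"
    unfolding hardy_norm_def by (intro cSUP_least *) auto
qed

lemma hardy_add:
  assumes f: "f \<in> hardy_space p" and g: "g \<in> hardy_space p" and p: "0 < p"
  shows "(\<lambda>z. f z + g z) \<in> hardy_space p" (is "?h \<in> _")
    and "hardy_norm p (\<lambda>z. f z + g z) powr min 1 p
           \<le> hardy_norm p f powr min 1 p + hardy_norm p g powr min 1 p"
proof -
  have hol: "f holomorphic_on ball 0 1" "g holomorphic_on ball 0 1"
    and zero: "\<And>z. z \<notin> ball 0 1 \<Longrightarrow> ?h z = 0"
    using f g by (auto simp: hardy_space_def)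
  have holh: "?h holomorphic_on ball 0 1"
    by (intro holomorphic_intros hol)
  note nonneg = hardy_norm_nonneg[OF f] hardy_norm_nonneg[OF g]
  have "?h \<in> hardy_space p \<and> hardy_norm p ?h powr min 1 p
           \<le> hardy_norm p f powr min 1 p + hardy_norm p g powr min 1 p"
  proof (cases "p \<le> 1")
    case True
    define c where "c = (hardy_norm p f powr p + hardy_norm p g powr p) powr (1 / p)"
    have c: "c \<ge> 0" "c powr p = hardy_norm p f powr p + hardy_norm p g powr p"
      using p by (auto simp: c_def powr_powr)
    have "circle_mean p ?h r \<le> c powr p" if "0 \<le> r" "r < 1" for r
    proof -
      have "circle_mean p ?h r \<le> 1 * circle_mean p f r + 1 * circle_mean p g r"
        using powr_subadditive[OF p True] hol that p by (intro circle_mean_add_le) auto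
      also have "\<dots> \<le> c powr p"
        unfolding c using circle_mean_le_hardy_norm[OF f p that] circle_mean_le_hardy_norm[OF g p that]
        by simp
      finally show ?thesis .
    qed
    note h = hardy_spaceI[OF holh zero p c(1) this]
    then have "hardy_norm p ?h powr p \<le> c powr p"
      using p hardy_norm_nonneg by (intro powr_mono2) auto
    then show ?thesis using h True by (simp add: c min_def)
  next
    case False
    have "?h \<in> hardy_space p \<and> hardy_norm p ?h \<le> hardy_norm p f + hardy_norm p g + e" if e: "e > 0" for e
    proof -
      define a where "a = hardy_norm p f + e / 2"
      define b where "b = hardy_norm p g + e / 2"
      have ab: "a > 0" "b > 0" "0 \<le> a + b" using nonneg e by (auto simp: a_def b_def)
      have *: "circle_mean p k r \<le> (hardy_norm p k + e / 2) powr p"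
        if "k \<in> hardy_space p" "0 \<le> r" "r < 1" for k r
      proof -
        have "hardy_norm p k powr p \<le> (hardy_norm p k + e / 2) powr p"
          using e p hardy_norm_nonneg[OF that(1)] by (intro powr_mono2) auto
        then show ?thesis using circle_mean_le_hardy_norm[of k p r] that p by linarith
      qed
      have "circle_mean p ?h r \<le> (a + b) powr p" if "0 \<le> r" "r < 1" for r
        using *[OF f that] *[OF g that] False
        by (intro circle_mean_minkowski hol that ab) (auto simp: a_def b_def)
      from hardy_spaceI[OF holh zero p ab(3) this] show ?thesis
        by (simp add: a_def b_def algebra_simps)
    qed
    then have "?h \<in> hardy_space p" "hardy_norm p ?h \<le> hardy_norm p f + hardy_norm p g"
      by (auto intro: zero_less_one field_le_epsilon)
    then show ?thesis
      using False nonneg hardy_norm_nonneg by simp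
  qed
  then show "?h \<in> hardy_space p"
    "hardy_norm p ?h powr min 1 p \<le> hardy_norm p f powr min 1 p + hardy_norm p g powr min 1 p"
    by auto
qed

lemma hardy_uminus_iff: "(\<lambda>z. - f z) \<in> hardy_space p \<longleftrightarrow> f \<in> hardy_space p"
proof -
  have "(\<lambda>z. - f z) \<in> hardy_space p" if "f \<in> hardy_space p" for f
    using that by (auto simp: hardy_space_def circle_mean_def intro!: holomorphic_intros)
  from this[of f] this[of "\<lambda>z. - f z"] show ?thesis by auto
qed

lemma hardy_diff:
  assumes "f \<in> hardy_space p" "g \<in> hardy_space p" "0 < p"
  shows "(\<lambda>z. f z - g z) \<in> hardy_space p"
  using hardy_add(1)[of f p "\<lambda>z. - g z"] assms by (simp add: hardy_uminus_iff)

lemma hardy_norm_zero_iff: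
  assumes f: "f \<in> hardy_space p" and p: "0 < p"
  shows "hardy_norm p f = 0 \<longleftrightarrow> f = (\<lambda>_. 0)"
proof
  assume N: "hardy_norm p f = 0"
  show "f = (\<lambda>_. 0)"
  proof
    fix z
    show "f z = 0"
    proof (cases "z \<in> ball 0 1")
      case True
      define r where "r = cmod z"
      have r: "0 \<le> r" "r < 1" using True by (auto simp: r_def)
      have "circle_mean p f r = 0"
        using circle_mean_le_hardy_norm[OF f p r] circle_mean_nonneg[of p f r] N by simp
      then have "integral {0..2*pi} (\<lambda>\<theta>. cmod (f (of_real r * cis \<theta>)) powr p) = 0"
        by (simp add: circle_mean_def)
      then have *: "\<forall>\<theta>\<in>{0..2*pi}. cmod (f (of_real r * cis \<theta>)) powr p = 0"
        using f p r by (subst (asm) integral_eq_0_iff)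
                       (auto intro!: continuous_on_circle_powr simp: hardy_space_def)
      have "z = of_real r * cis (Arg2pi z)"
        using Arg2pi_eq[of z] by (simp add: r_def cis_conv_exp)
      moreover have "Arg2pi z \<in> {0..2*pi}"
        using Arg2pi_ge_0[of z] Arg2pi_lt_2pi[of z] by auto
      ultimately show ?thesis using * by (metis norm_eq_zero powr_eq_0_iff)
    qed (use f in \<open>auto simp: hardy_space_def\<close>)
  qed
qed (simp add: hardy_norm_def circle_mean_def)

lemma Metric_space_hardy:
  assumes p: "0 < p"
  shows "Metric_space (hardy_space p) (hardy_dist p)"
proof
  fix f g h
  show "0 \<le> hardy_dist p f g" by (simp add: hardy_dist_def)
  show "hardy_dist p f g = hardy_dist p g f"
    by (simp add: hardy_dist_def hardy_norm_def circle_mean_def norm_minus_commute)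
  assume f: "f \<in> hardy_space p" and g: "g \<in> hardy_space p"
  show "hardy_dist p f g = 0 \<longleftrightarrow> f = g"
    using hardy_norm_zero_iff[OF hardy_diff[OF f g p] p]
    by (auto simp: hardy_dist_def fun_eq_iff)
  assume h: "h \<in> hardy_space p"
  show "hardy_dist p f h \<le> hardy_dist p f g + hardy_dist p g h"
    using hardy_add(2)[OF hardy_diff[OF f g p] hardy_diff[OF g h p] p]
    by (simp add: hardy_dist_def)
qed

end

theory Submission
  imports Defs "HOL-Complex_Analysis.Complex_Analysis"
begin

text \<open>
  Surjective isometries are weighted compositions with automorphisms of the disc, isometries into the space
  are weighted compositions with holomorphic self-maps of the disc, and the orbits of the functions \<open>1\<close> and
  \<open>z\<close> under the surjective isometries are closed. Together these facts determine the limits.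

  Let \<open>T\<close> be a linear isometry of \<open>H\<^sup>p\<close> into itself, let \<open>f\<close> be in \<open>H\<^sup>p\<close> and put
  \<open>g\<^sub>k = T (z\<^sup>k f)\<close>. The key is the identity \<open>g\<^sub>0 g\<^sub>2 = g\<^sub>1\<^sup>2\<close> (\<open>isometry_multiplicative\<close>).
  On the boundary \<open>(f, z f, z\<^sup>2 f)\<close> is a geometric progression with a ratio of modulus 1, and
  \<open>T\<close> preserves the norms of all combinations \<open>a\<^sub>0 f + a\<^sub>1 s z f + a\<^sub>2 s\<^sup>2 z\<^sup>2 f\<close> with \<open>|s| = 1\<close>.
  Averaging the \<open>p\<close>-th powers of these norms over \<open>s\<close> gives the integral over the circle of the function
  \<open>phase_mean\<close> of the three values. For \<open>p \<noteq> 2\<close> strict concavity (\<open>p < 2\<close>) or convexity (\<open>p > 2\<close>)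
  of \<open>t \<mapsto> t\<^bsup>p/2\<^esup>\<close> shows that among all triples precisely the geometric progressions with
  unimodular ratio are extremal for these averages. Since \<open>(g\<^sub>0, g\<^sub>1, g\<^sub>2)\<close> has the same
  averages as the progression, \<open>|g\<^sub>0 g\<^sub>2 - g\<^sub>1\<^sup>2|\<^bsup>p/2\<^esup>\<close> has circle means tending to 0 at the
  boundary (\<open>phase_mean_coercive\<close>). Circle means increase with the radius
  (\<open>circle_mean_mono\<close>), so they vanish identically. All boundary behaviour is expressed by limits of
  circle means, so that radial limits never enter.

  The identity makes \<open>\<phi> = T z / T 1\<close> a holomorphic map of the disc into itself with
  \<open>T (z f) = \<phi> T f\<close> for all \<open>f\<close>. Evaluating \<open>f - f (\<phi> w) = (z - \<phi> w) k\<close> at \<open>w\<close> yields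
  \<open>T f = T 1 \<cdot> (f \<circ> \<phi>)\<close> (\<open>hardy_isometry_weighted_composition\<close>). If \<open>T\<close> is surjective, the same
  applied to its inverse shows that \<open>\<phi>\<close> is an automorphism, and \<open>T 1\<close> is a branch of
  \<open>\<phi>'\<^bsup>1/p\<^esup>\<close> up to a constant (\<open>isometry_group_wcomp\<close>).

  If every \<open>T f\<close> is a limit of images of \<open>f\<close> under surjective isometries, then \<open>T\<close> is an isometry, hence a weighted
  composition, and only \<open>T 1\<close> and \<open>T z\<close> have to be identified. By compactness of the parameters
  (\<open>orbit_closed\<close>) each is the image of the respective monomial under some surjective
  isometry, a priori with different automorphisms \<open>\<phi>\<^sub>1\<close>, \<open>\<phi>\<^sub>2\<close>. Since \<open>|\<phi>| \<le> 1\<close>, the weight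
  belonging to \<open>\<phi>\<^sub>2\<close> is dominated by the one belonging to \<open>\<phi>\<^sub>1\<close> on the circle. The maximum principle
  and the Schwarz-Pick identity show that both automorphisms have the same zero
  (\<open>kern_domination_imp_eq\<close>), so that \<open>T\<close> is a surjective isometry.
\<close>

section \<open>A maximum principle for sums of powers of moduli\<close>

lemma local_holomorphic_powr:
  fixes p :: real
  assumes f: "f holomorphic_on S" and S: "open S" "z0 \<in> S" and nz: "f z0 \<noteq> 0"
  obtains e h where "e > 0" "ball z0 e \<subseteq> S" "h holomorphic_on ball z0 e"
    "\<And>z. z \<in> ball z0 e \<Longrightarrow> cmod (h z) = cmod (f z) powr p"
    "h z0 = of_real (cmod (f z0) powr p)"
proof -
  have cont: "continuous_on S f" using f by (rule holomorphic_on_imp_continuous_on)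
  have "isCont f z0" using cont S by (simp add: continuous_on_eq_continuous_at)
  then obtain e1 where e1: "e1 > 0" "\<And>z. z \<in> ball z0 e1 \<Longrightarrow> f z \<noteq> 0"
    using nz continuous_at_avoid[of z0 f 0] by (metis mem_ball)
  obtain e2 where e2: "e2 > 0" "ball z0 e2 \<subseteq> S" using S openE by blast
  define e where "e = min e1 e2"
  have e: "e > 0" "ball z0 e \<subseteq> S" "\<And>z. z \<in> ball z0 e \<Longrightarrow> f z \<noteq> 0"
    using e1 e2 by (auto simp: e_def)
  have "f holomorphic_on ball z0 e" using f e(2) holomorphic_on_subset by blast
  then obtain g where g: "g holomorphic_on ball z0 e" "\<And>z. z \<in> ball z0 e \<Longrightarrow> f z = exp (g z)"
    using contractible_imp_holomorphic_log[of f "ball z0 e"] e(3) convex_imp_contractible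
    by (metis convex_ball)
  define h where "h = (\<lambda>z. exp (of_real p * (g z - \<i> * of_real (Im (g z0)))))"
  have n: "cmod (h z) = cmod (f z) powr p" if "z \<in> ball z0 e" for z
    using g(2)[OF that] by (simp add: h_def powr_def)
  have "h z0 = of_real (cmod (f z0) powr p)"
  proof -
    have *: "g z0 - \<i> * of_real (Im (g z0)) = of_real (Re (g z0))"
      by (simp add: complex_eq_iff)
    have "h z0 = of_real (exp (p * Re (g z0)))"
      unfolding h_def * by (simp flip: of_real_mult exp_of_real)
    then show ?thesis using g(2)[of z0] e(1) by (simp add: powr_def)
  qed
  moreover have "h holomorphic_on ball z0 e"
    unfolding h_def by (intro holomorphic_intros g)
  ultimately show ?thesis using that[of e h] e n by blast
qed

text \<open>
  At an interior maximum, take local holomorphic branches of the \<open>p\<close>-th powers, rotated to be positive at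
  that point. Their sum attains its maximum modulus there and is therefore constant, which forces
  every branch to be real. The summand with the exponential function cannot be, and thus rules out
  all degenerate cases (constant functions, common zeros) at once.
\<close>

lemma sum_powr_interior_max_False:
  fixes f :: "'k \<Rightarrow> complex \<Rightarrow> complex" and p d :: real
  assumes K: "finite K" and hol: "\<And>k. k \<in> K \<Longrightarrow> f k holomorphic_on S"
    and S: "open S" "z0 \<in> S" and d: "d > 0"
    and max: "\<And>z. z \<in> S \<Longrightarrow>
      (\<Sum>k\<in>K. cmod (f k z) powr p) + d * cmod (exp z) \<le> (\<Sum>k\<in>K. cmod (f k z0) powr p) + d * cmod (exp z0)"
  shows False
proof -
  define K' where "K' = {k\<in>K. f k z0 \<noteq> 0}"
  have K': "finite K'" "K' \<subseteq> K" using K by (auto simp: K'_def)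
  have "\<exists>e h. e > 0 \<and> ball z0 e \<subseteq> S \<and> h holomorphic_on ball z0 e \<and>
    (\<forall>z \<in> ball z0 e. cmod (h z) = cmod (f k z) powr p) \<and>
    h z0 = of_real (cmod (f k z0) powr p)" if "k \<in> K'" for k
    using local_holomorphic_powr[OF hol S, of k p] that unfolding K'_def by (smt (verit) mem_Collect_eq)
  then obtain e h where eh: "\<And>k. k \<in> K' \<Longrightarrow> e k > (0::real)" "\<And>k. k \<in> K' \<Longrightarrow> ball z0 (e k) \<subseteq> S"
    "\<And>k. k \<in> K' \<Longrightarrow> h k holomorphic_on ball z0 (e k)"
    "\<And>k z. k \<in> K' \<Longrightarrow> z \<in> ball z0 (e k) \<Longrightarrow> cmod (h k z) = cmod (f k z) powr p"
    "\<And>k. k \<in> K' \<Longrightarrow> h k z0 = of_real (cmod (f k z0) powr p)"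
    by metis
  obtain e0 where e0: "e0 > 0" "ball z0 e0 \<subseteq> S" using S openE by blast
  define r where "r = Min (insert (min e0 1) (e ` K'))"
  have r: "r > 0" "r \<le> e0" "r \<le> 1" "\<And>k. k \<in> K' \<Longrightarrow> r \<le> e k"
    using K' eh(1) e0 Min_le[of "insert (min e0 1) (e ` K')" "min e0 1"] by (auto simp: r_def)
  let ?B = "ball z0 r"
  define E where "E = (\<lambda>z. of_real d * exp (z - \<i> * of_real (Im z0)))"
  define H where "H = (\<lambda>z. (\<Sum>k\<in>K'. h k z) + E z)"
  define u where "u = (\<lambda>z. (\<Sum>k\<in>K. cmod (f k z) powr p) + d * cmod (exp z))"
  have hh: "h k holomorphic_on ?B" if "k \<in> K'" for k
    using holomorphic_on_subset[OF eh(3)[OF that]] r(4)[OF that] by (simp add: subset_ball)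
  have holH: "H holomorphic_on ?B"
    unfolding H_def E_def by (intro holomorphic_intros hh)
  have nE: "cmod (E z) = d * cmod (exp z)" for z
    using d by (simp add: E_def norm_mult)
  have split: "(\<Sum>k\<in>K. cmod (f k z) powr p) = (\<Sum>k\<in>K'. cmod (f k z) powr p) + (\<Sum>k\<in>K-K'. cmod (f k z) powr p)" for z
    using K K' by (metis add.commute sum.subset_diff)
  have le: "(\<Sum>k\<in>K'. cmod (h k z)) + cmod (E z) \<le> u z" if "z \<in> ?B" for z
  proof -
    have "(\<Sum>k\<in>K'. cmod (h k z)) = (\<Sum>k\<in>K'. cmod (f k z) powr p)"
      using eh(4) that r(4) by (intro sum.cong refl eh(4)) fastforce+
    moreover have "0 \<le> (\<Sum>k\<in>K-K'. cmod (f k z) powr p)" by (intro sum_nonneg) auto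
    ultimately show ?thesis using nE[of z] by (simp add: u_def split[of z])
  qed
  have H0: "H z0 = of_real (u z0)"
  proof -
    have "(\<Sum>k\<in>K-K'. cmod (f k z0) powr p) = 0" by (intro sum.neutral) (auto simp: K'_def)
    moreover have "E z0 = of_real (d * cmod (exp z0))"
    proof -
      have *: "z0 - \<i> * of_real (Im z0) = of_real (Re z0)" by (simp add: complex_eq_iff)
      show ?thesis unfolding E_def * by (simp add: exp_of_real)
    qed
    ultimately show ?thesis using eh(5) by (simp add: H_def u_def split[of z0])
  qed
  have u0: "u z0 \<ge> 0" unfolding u_def using d by (intro add_nonneg_nonneg sum_nonneg) auto
  have uz: "u z \<le> u z0" if "z \<in> ?B" for z
    using max[of z] subsetD[OF e0(2), of z] that r(2) by (simp add: u_def)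
  have Hle: "cmod (H z) \<le> cmod (H z0)" if "z \<in> ?B" for z
  proof -
    have "cmod (H z) \<le> (\<Sum>k\<in>K'. cmod (h k z)) + cmod (E z)"
      unfolding H_def by (intro order_trans[OF norm_triangle_ineq] add_right_mono norm_sum)
    also have "\<dots> \<le> cmod (H z0)" using le[OF that] uz[OF that] H0 u0 by simp
    finally show ?thesis .
  qed
  have "H constant_on ?B"
    by (rule maximum_modulus_principle[OF holH, of ?B z0]) (use Hle r in auto)
  then have Hc: "H z = of_real (u z0)" if "z \<in> ?B" for z
    using that r(1) H0 unfolding constant_on_def by (metis centre_in_ball)
  \<comment> \<open>Hence every summand is real and nonnegative near \<open>z0\<close>, but \<open>E\<close> takes non-real values there.\<close>
  have "Re (E z) = cmod (E z)" if "z \<in> ?B" for z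
  proof -
    have "u z0 = (\<Sum>k\<in>K'. Re (h k z)) + Re (E z)"
      using arg_cong[OF Hc[OF that], of Re] by (simp add: H_def)
    moreover have "(\<Sum>k\<in>K'. Re (h k z)) \<le> (\<Sum>k\<in>K'. cmod (h k z))"
      by (intro sum_mono complex_Re_le_cmod)
    moreover have "Re (E z) \<le> cmod (E z)" by (rule complex_Re_le_cmod)
    ultimately show ?thesis using le[OF that] uz[OF that] by linarith
  qed
  from this[of "z0 + \<i> * of_real (r/2)"] r
  have "Re (E (z0 + \<i> * of_real (r/2))) = cmod (E (z0 + \<i> * of_real (r/2)))"
    by (simp add: dist_norm norm_mult)
  then have "cos (r/2) = 1"
    using d by (simp add: E_def Re_exp norm_mult)
  moreover have "cos (r/2) < 1"
    using cos_monotone_0_pi[of 0 "r/2"] r pi_gt3 by simp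
  ultimately show False by simp
qed

text \<open>The perturbation \<open>d |exp z|\<close> is removed by letting \<open>d\<close> tend to 0.\<close>

lemma sum_powr_le_on_cball:
  fixes f :: "'k \<Rightarrow> complex \<Rightarrow> complex" and p :: real
  assumes K: "finite K" and hol: "\<And>k. k \<in> K \<Longrightarrow> f k holomorphic_on S" and S: "cball 0 R \<subseteq> S"
    and p: "p > 0" and C: "\<And>z. cmod z = R \<Longrightarrow> (\<Sum>k\<in>K. cmod (f k z) powr p) \<le> C"
    and z: "cmod z \<le> R"
  shows "(\<Sum>k\<in>K. cmod (f k z) powr p) \<le> C"
proof -
  define u where "u = (\<lambda>d z. (\<Sum>k\<in>K. cmod (f k z) powr p) + d * cmod (exp z))"
  have *: "(\<Sum>k\<in>K. cmod (f k z) powr p) \<le> C + d * exp R" if d: "d > 0" for d :: real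
  proof -
    have cont: "continuous_on (cball 0 R) (u d)"
      unfolding u_def
      by (intro continuous_intros continuous_on_powr' holomorphic_on_imp_continuous_on
          holomorphic_on_subset[OF hol S]) (use p in auto)
    have "\<exists>z0\<in>cball 0 R. \<forall>y\<in>cball 0 R. u d y \<le> u d z0"
      using z norm_ge_zero[of z] by (intro continuous_attains_sup cont) (auto simp del: norm_ge_zero)
    then obtain z0 where z0: "z0 \<in> cball 0 R" "\<And>y. y \<in> cball 0 R \<Longrightarrow> u d y \<le> u d z0" by blast
    have "cmod z0 = R"
    proof (rule ccontr)
      assume "cmod z0 \<noteq> R"
      then have b: "z0 \<in> ball 0 R" using z0(1) by auto
      show False
        by (rule sum_powr_interior_max_False[where f = f and p = p and d = d and K = K, OF K _ open_ball b d])
           (use z0(2) S in \<open>auto simp: u_def intro!: holomorphic_on_subset[OF hol]\<close>)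
    qed
    have "(\<Sum>k\<in>K. cmod (f k z) powr p) \<le> u d z" using d by (simp add: u_def)
    also have "\<dots> \<le> u d z0" using z by (intro z0(2)) auto
    also have "\<dots> \<le> C + d * exp R"
      unfolding u_def using C[OF \<open>cmod z0 = R\<close>] d complex_Re_le_cmod[of z0] \<open>cmod z0 = R\<close>
      by (intro add_mono mult_left_mono) auto
    finally show ?thesis .
  qed
  show ?thesis
  proof (rule field_le_epsilon)
    fix e :: real assume "e > 0"
    then show "(\<Sum>k\<in>K. cmod (f k z) powr p) \<le> C + e"
      using *[of "e / exp R"] by simp
  qed
qed

section \<open>Averages over the unit circle\<close>

definition circ_avg :: "(complex \<Rightarrow> real) \<Rightarrow> real" where
  "circ_avg G = 1 / (2 * pi) * integral {0..2*pi} (\<lambda>t. G (cis t))"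

lemma circle_mean_eq_circ_avg: "circle_mean p f r = circ_avg (\<lambda>z. cmod (f (of_real r * z)) powr p)"
  by (simp add: circle_mean_def circ_avg_def)

lemma continuous_on_circ_cis:
  assumes "continuous_on (sphere 0 1) G"
  shows "continuous_on A (\<lambda>t. G (cis t))"
  by (rule continuous_on_compose2[OF assms]) (auto intro!: continuous_intros)

lemma circ_avg_integrable:
  fixes G :: "complex \<Rightarrow> real"
  assumes "continuous_on (sphere 0 1) G"
  shows "(\<lambda>t. G (cis t)) integrable_on {0..2*pi}"
  by (intro integrable_continuous_real continuous_on_circ_cis assms)

lemma circ_avg_cong:
  assumes "\<And>z. cmod z = 1 \<Longrightarrow> G z = H z"
  shows "circ_avg G = circ_avg H"
  by (simp add: circ_avg_def assms)

lemma circ_avg_add: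
  assumes "continuous_on (sphere 0 1) G" "continuous_on (sphere 0 1) H"
  shows "circ_avg (\<lambda>z. G z + H z) = circ_avg G + circ_avg H"
  using integral_add[OF circ_avg_integrable[OF assms(1)] circ_avg_integrable[OF assms(2)]]
  by (simp add: circ_avg_def distrib_left add_divide_distrib)

lemma circ_avg_cmult: "circ_avg (\<lambda>z. c * G z) = c * circ_avg G"
  by (simp add: circ_avg_def)

lemma circ_avg_diff:
  assumes "continuous_on (sphere 0 1) G" "continuous_on (sphere 0 1) H"
  shows "circ_avg (\<lambda>z. G z - H z) = circ_avg G - circ_avg H"
  using circ_avg_add[of G "\<lambda>z. (-1) * H z"] assms
  by (simp add: continuous_on_minus circ_avg_cmult[of "-1" H, simplified])

lemma circ_avg_sum:
  assumes "\<And>k. k \<in> K \<Longrightarrow> continuous_on (sphere 0 1) (G k)"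
  shows "circ_avg (\<lambda>z. \<Sum>k\<in>K. G k z) = (\<Sum>k\<in>K. circ_avg (G k))"
  using assms
proof (induction K rule: infinite_finite_induct)
  case (insert k K)
  then show ?case by (simp add: circ_avg_add continuous_on_sum)
qed (simp_all add: circ_avg_def)

lemma circ_avg_const [simp]: "circ_avg (\<lambda>z. c) = c"
  by (simp add: circ_avg_def)

lemma circ_avg_mono:
  assumes "continuous_on (sphere 0 1) G" "continuous_on (sphere 0 1) H"
    and "\<And>z. cmod z = 1 \<Longrightarrow> G z \<le> H z"
  shows "circ_avg G \<le> circ_avg H"
  unfolding circ_avg_def
  by (intro mult_left_mono integral_le circ_avg_integrable assms) auto

lemma circ_avg_eq_0_imp:
  assumes "continuous_on (sphere 0 1) G" "\<And>z. cmod z = 1 \<Longrightarrow> G z \<ge> 0"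
    and "circ_avg G = 0" and z: "cmod z = 1"
  shows "G z = 0"
proof -
  have "\<forall>t\<in>{0..2*pi}. G (cis t) = 0"
    using assms(3) by (subst (asm) circ_avg_def)
       (simp add: integral_eq_0_iff continuous_on_circ_cis assms)
  moreover have "z = cis (Arg2pi z)" using Arg2pi_eq[of z] z by (simp add: cis_conv_exp)
  moreover have "Arg2pi z \<in> {0..2*pi}" using Arg2pi_ge_0[of z] Arg2pi_lt_2pi[of z] by auto
  ultimately show ?thesis by metis
qed

lemma circ_avg_less:
  assumes "continuous_on (sphere 0 1) G" "continuous_on (sphere 0 1) H"
    and "\<And>z. cmod z = 1 \<Longrightarrow> G z \<le> H z" and "cmod z0 = 1" "G z0 < H z0"
  shows "circ_avg G < circ_avg H"
proof (rule ccontr)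
  assume "\<not> circ_avg G < circ_avg H"
  then have "circ_avg (\<lambda>z. H z - G z) = 0"
    using circ_avg_mono[OF assms(1-3)] by (simp add: circ_avg_diff assms)
  then show False
    using circ_avg_eq_0_imp[of "\<lambda>z. H z - G z" z0] assms by (auto intro: continuous_on_diff)
qed

lemma circ_avg_period:
  fixes G :: "complex \<Rightarrow> real"
  assumes G: "continuous_on (sphere 0 1) G"
  shows "integral {c..c + 2*pi} (\<lambda>t. G (cis t)) = integral {0..2*pi} (\<lambda>t. G (cis t))"
proof -
  let ?h = "\<lambda>t. G (cis t)"
  define n where "n = \<lfloor>c / (2*pi)\<rfloor>"
  define b where "b = c - 2 * pi * n"
  have "of_int n \<le> c / (2*pi)" "c / (2*pi) < of_int n + 1" unfolding n_def by linarith+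
  then have b: "0 \<le> b" "b \<le> 2*pi"
    unfolding b_def by (simp_all add: field_simps)
  have int: "?h integrable_on {x..y}" for x y
    by (intro integrable_continuous_real continuous_on_circ_cis G)
  have per: "?h (t + 2 * pi * of_int m) = ?h t" for t and m :: int
    by (simp add: cis_mult[symmetric] cis_multiple_2pi)
  have "integral {c..c + 2*pi} ?h = integral {b..b + 2*pi} (\<lambda>t. ?h (t + 2 * pi * n))"
    using integral_shift_real_ivl[of c "2 * pi * n" "c+2*pi" ?h] by (simp add: b_def algebra_simps)
  also have "\<dots> = integral {b..b + 2*pi} ?h" by (simp only: per)
  also have "\<dots> = integral {b..2*pi} ?h + integral {2*pi..b + 2*pi} ?h"
    using b by (intro Henstock_Kurzweil_Integration.integral_combine[symmetric] int) auto
  also have "integral {2*pi..b + 2*pi} ?h = integral {0..b} (\<lambda>t. ?h (t + 2*pi))"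
    using integral_shift_real_ivl[of "2*pi" "2 * pi" "b+2*pi" ?h] by simp
  also have "\<dots> = integral {0..b} ?h" using per[of _ 1] by simp
  also have "integral {b..2*pi} ?h + integral {0..b} ?h = integral {0..2*pi} ?h"
    using b by (subst add.commute, intro Henstock_Kurzweil_Integration.integral_combine int) auto
  finally show ?thesis .
qed

lemma circ_avg_rotate:
  assumes G: "continuous_on (sphere 0 1) G" and u: "cmod u = 1"
  shows "circ_avg (\<lambda>z. G (u * z)) = circ_avg G"
proof -
  define a where "a = Arg2pi u"
  have ua: "u = cis a" using Arg2pi_eq[of u] u by (simp add: cis_conv_exp a_def)
  have "integral {0..2*pi} (\<lambda>t. G (u * cis t)) = integral {0..2*pi} (\<lambda>t. G (cis (t + a)))"
    by (simp add: ua cis_mult add.commute)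
  also have "\<dots> = integral {a..a + 2*pi} (\<lambda>t. G (cis t))"
    using integral_shift_real_ivl[of a a "a+2*pi" "\<lambda>t. G (cis t)"] by simp
  also have "\<dots> = integral {0..2*pi} (\<lambda>t. G (cis t))" by (rule circ_avg_period[OF G])
  finally show ?thesis by (simp add: circ_avg_def)
qed

lemma circ_avg_continuous_param:
  fixes G :: "'a::topological_space \<Rightarrow> complex \<Rightarrow> real"
  assumes "continuous_on (U \<times> sphere 0 1) (\<lambda>(x, z). G x z)"
  shows "continuous_on U (\<lambda>x. circ_avg (G x))"
proof -
  have "continuous_on (U \<times> cbox 0 (2*pi)) (\<lambda>(x, t). G x (cis t))"
    unfolding split_def
    by (rule continuous_on_compose2[OF assms[unfolded split_def],
          of _ "\<lambda>y. (fst y, cis (snd y))", simplified])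
       (auto intro!: continuous_intros)
  from integral_continuous_on_param[OF this] show ?thesis
    unfolding circ_avg_def by (intro continuous_intros) auto
qed

lemma circ_avg_swap:
  assumes "continuous_on (sphere 0 1 \<times> sphere 0 1) (\<lambda>(z, w). G z w)"
  shows "circ_avg (\<lambda>z. circ_avg (\<lambda>w. G z w)) = circ_avg (\<lambda>w. circ_avg (\<lambda>z. G z w))"
proof -
  have "continuous_on (cbox (0, 0) (2*pi, 2*pi)) (\<lambda>(s, t). G (cis s) (cis t))"
    unfolding split_def
    by (rule continuous_on_compose2[OF assms[unfolded split_def],
          of _ "\<lambda>y. (cis (fst y), cis (snd y))", simplified])
       (auto intro!: continuous_intros)
  from integral_swap_continuous[OF this] show ?thesis
    by (simp add: circ_avg_def)
qed

lemma circ_avg_dominated_convergence_0: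
  assumes G: "\<And>n. continuous_on (sphere 0 1) (G n)"
    and C: "\<And>n z. cmod z = 1 \<Longrightarrow> \<bar>G n z\<bar> \<le> C"
    and lim: "\<And>z. cmod z = 1 \<Longrightarrow> (\<lambda>n. G n z) \<longlonglongrightarrow> 0"
  shows "(\<lambda>n. circ_avg (G n)) \<longlonglongrightarrow> 0"
proof -
  have "(\<lambda>n. integral {0..2*pi} (\<lambda>t. G n (cis t))) \<longlonglongrightarrow> integral {0..2*pi} (\<lambda>t::real. 0)"
    by (rule dominated_convergence(2)[where h = "\<lambda>_. C"])
       (auto intro!: circ_avg_integrable G C lim)
  then show ?thesis
    unfolding circ_avg_def by (intro tendsto_mult_right_zero) simp
qed

text \<open>This is the invariance of harmonic measure: the weight is the modulus of the derivative of the
  Moebius map on the circle. On angles, \<open>t \<mapsto> t - 2 Im Ln (1 - cnj w e\<^sup>i\<^sup>t)\<close> lifts the Moebius map, as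
  \<open>1 - cnj w z\<close> stays in the right half plane.\<close>

lemma circ_avg_moebius:
  assumes G: "continuous_on (sphere 0 1) G" and w: "cmod w < 1"
  shows "circ_avg (\<lambda>z. (1 - (cmod w)\<^sup>2) / (cmod (1 - cnj w * z))\<^sup>2 * G ((z - w) / (1 - cnj w * z))) = circ_avg G"
proof -
  define \<psi> where "\<psi> = (\<lambda>t. t - 2 * Im (Ln (1 - cnj w * cis t)))"
  define \<psi>' where "\<psi>' = (\<lambda>t. (1 - (cmod w)\<^sup>2) / (cmod (1 - cnj w * cis t))\<^sup>2)"
  have a: "cmod (cnj w * cis t) < 1" for t using w by (simp add: norm_mult)
  have re: "Re (1 - cnj w * cis t) > 0" for t
    using a[of t] complex_Re_le_cmod[of "cnj w * cis t"] by simp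
  have nz: "1 - cnj w * cis t \<noteq> 0" for t using re[of t] by (metis less_irrefl zero_complex.simps(1))
  have nn: "1 - cnj w * cis t \<notin> \<real>\<^sub>\<le>\<^sub>0" for t
    using re[of t] by (auto simp: complex_nonpos_Reals_iff)
  have arg: "\<bar>Im (Ln (1 - cnj w * cis t))\<bar> \<le> pi" for t
    using mpi_less_Im_Ln[OF nz, of t] Im_Ln_le_pi[OF nz, of t] by linarith
  have d: "(\<psi> has_field_derivative \<psi>' t) (at t within A)" for t A
  proof -
    have dc: "(cis has_vector_derivative \<i> * cis t) (at t within A)"
      unfolding has_vector_derivative_def by (auto intro!: derivative_eq_intros)
    have "((\<lambda>t. Ln (1 - cnj w * cis t)) has_vector_derivative
          (- (cnj w * (\<i> * cis t))) * inverse (1 - cnj w * cis t)) (at t within A)"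
      by (rule field_vector_diff_chain_within[unfolded o_def, where g = Ln])
         (auto intro!: derivative_eq_intros dc has_field_derivative_at_within[OF has_field_derivative_Ln] nn)
    then have "((\<lambda>t. Im (Ln (1 - cnj w * cis t))) has_vector_derivative
          Im ((- (cnj w * (\<i> * cis t))) * inverse (1 - cnj w * cis t))) (at t within A)"
      by (rule bounded_linear.has_vector_derivative[OF bounded_linear_Im])
    then have "(\<psi> has_vector_derivative
          (1 - 2 * Im ((- (cnj w * (\<i> * cis t))) * inverse (1 - cnj w * cis t)))) (at t within A)"
      unfolding \<psi>_def by (auto intro!: derivative_eq_intros)
    moreover have "1 - 2 * Im ((- (cnj w * (\<i> * cis t))) * inverse (1 - cnj w * cis t)) = \<psi>' t"
    proof -
      define b where "b = cnj w * cis t"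
      have b: "cmod b = cmod w" by (simp add: b_def norm_mult)
      have nb: "1 - b \<noteq> 0" using nz by (simp add: b_def)
      have e: "(- (cnj w * (\<i> * cis t))) * inverse (1 - cnj w * cis t) = - (\<i> * (b / (1 - b)))"
        by (simp add: b_def field_simps)
      have "Re (b / (1 - b)) * (cmod (1 - b))\<^sup>2 = Re (b * cnj (1 - b))"
        using nb by (simp add: Re_divide cmod_power2)
      also have "\<dots> = Re b - (cmod b)\<^sup>2"
        unfolding cmod_power2 by (simp add: algebra_simps power2_eq_square)
      finally have R: "Re (b / (1 - b)) * (cmod (1 - b))\<^sup>2 = Re b - (cmod b)\<^sup>2" .
      have n: "(cmod (1 - b))\<^sup>2 = 1 - 2 * Re b + (cmod b)\<^sup>2"
        unfolding cmod_power2 by (simp add: algebra_simps power2_eq_square)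
      have "1 + 2 * Re (b / (1 - b)) =
          ((cmod (1 - b))\<^sup>2 + 2 * (Re (b / (1 - b)) * (cmod (1 - b))\<^sup>2)) / (cmod (1 - b))\<^sup>2"
        using nb by (simp add: add_divide_distrib)
      also have "(cmod (1 - b))\<^sup>2 + 2 * (Re (b / (1 - b)) * (cmod (1 - b))\<^sup>2) = 1 - (cmod b)\<^sup>2"
        unfolding R unfolding n by simp
      finally have "1 + 2 * Re (b / (1 - b)) = (1 - (cmod b)\<^sup>2) / (cmod (1 - b))\<^sup>2" .
      then show ?thesis
        unfolding e \<psi>'_def by (simp only: uminus_complex.sel Im_i_times b b_def[symmetric])
    qed
    ultimately show ?thesis by (simp add: has_real_derivative_iff_has_vector_derivative)
  qed
  have cis: "cis (\<psi> t) = (cis t - w) / (1 - cnj w * cis t)" for t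
  proof -
    define v where "v = 1 - cnj w * cis t"
    have v: "v \<noteq> 0" using nz by (simp add: v_def)
    have "cis (Im (Ln v)) = v / of_real (cmod v)"
      using v by (metis Re_Ln cis_conv_exp exp_Ln exp_eq_polar nonzero_mult_div_cancel_left norm_exp_eq_Re norm_zero of_real_eq_0_iff norm_eq_zero)
    then have "cis (- 2 * Im (Ln v)) = (cnj v / of_real (cmod v))\<^sup>2"
      by (metis (no_types, lifting) cis_cnj complex_cnj_divide complex_cnj_complex_of_real mult_minus_left mult_minus_right power2_eq_square cis_mult mult_2)
    also have "\<dots> = cnj v / v"
      using v complex_norm_square[of v] by (simp add: power2_eq_square field_simps)
    finally have "cis (\<psi> t) = cis t * (cnj v / v)"
      unfolding \<psi>_def v_def[symmetric] using cis_mult[of t "- 2 * Im (Ln v)"] by simp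
    also have "\<dots> = (cis t * cnj v) / v" by simp
    also have "cis t * cnj v = cis t - w * (cis t * cnj (cis t))"
      by (simp add: v_def algebra_simps)
    also have "cis t * cnj (cis t) = 1" by (simp add: cis_cnj cis_mult)
    finally show ?thesis by (simp add: v_def)
  qed
  have "((\<lambda>t. \<psi>' t *\<^sub>R G (cis (\<psi> t))) has_integral (integral {\<psi> 0..\<psi> (2*pi)} (\<lambda>t. G (cis t)))) {0..2*pi}"
  proof (rule has_integral_substitution[where c = "-(2*pi)" and d = "4*pi"])
    show "\<psi> ` {0..2 * pi} \<subseteq> {- (2 * pi)..4 * pi}"
      unfolding \<psi>_def using arg by (auto simp: abs_le_iff) (smt (verit) arg)+
    show "\<psi> 0 \<le> \<psi> (2 * pi)" by (simp add: \<psi>_def)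
  qed (auto intro!: d continuous_on_circ_cis G)
  moreover have "\<psi> (2*pi) = \<psi> 0 + 2*pi" by (simp add: \<psi>_def)
  ultimately have "integral {0..2*pi} (\<lambda>t. \<psi>' t *\<^sub>R G (cis (\<psi> t))) = integral {0..2*pi} (\<lambda>t. G (cis t))"
    using circ_avg_period[OF G, of "\<psi> 0"] by (simp add: integral_unique)
  then show ?thesis by (simp add: circ_avg_def cis \<psi>'_def)
qed

section \<open>Circle means increase with the radius\<close>

text \<open>A sum over the \<open>N\<close>-th roots of unity has period \<open>2\<pi>/N\<close>, so that uniform continuity
  makes it almost constant on the circle.\<close>

lemma root_of_unity_sums_almost_constant:
  fixes G :: "complex \<Rightarrow> real" and e :: real
  assumes G: "continuous_on (sphere 0 1) G" and e: "e > 0"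
  obtains N :: nat where "N > 0"
    "\<And>z z'. cmod z = 1 \<Longrightarrow> cmod z' = 1 \<Longrightarrow>
       (\<Sum>j<N. G (z * cis (2 * pi * j / N))) \<le> (\<Sum>j<N. G (z' * cis (2 * pi * j / N))) + N * e"
proof -
  define g where "g = (\<lambda>t. G (cis t))"
  have "uniformly_continuous_on {0..8*pi} g"
    unfolding g_def by (intro compact_uniformly_continuous continuous_on_circ_cis G) auto
  then obtain d where d: "d > 0"
    "\<And>s t. s \<in> {0..8*pi} \<Longrightarrow> t \<in> {0..8*pi} \<Longrightarrow> dist s t < d \<Longrightarrow> dist (g s) (g t) < e"
    using e unfolding uniformly_continuous_on_def by metis
  obtain N :: nat where N: "2 * pi / d < N" using reals_Archimedean2 by blast
  have N0: "real N > 0" using N d(1) by (metis divide_nonneg_pos less_le_trans not_le of_nat_0_le_iff order_less_irrefl pi_ge_zero zero_le_mult_iff zero_le_numeral less_eq_real_def)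
  then have Nd: "2 * pi / N < d" using N d(1) by (simp add: field_simps)
  have per: "g (t + 2 * pi) = g t" for t
    using cis_mult[of t "2*pi"] by (simp add: g_def)
  define S where "S = (\<lambda>t. \<Sum>j<N. g (t + 2 * pi * j / N))"
  have Sper: "S (t + 2 * pi / N) = S t" for t
  proof -
    define h where "h = (\<lambda>j. g (t + 2 * pi * real j / N))"
    have "S (t + 2 * pi / N) = (\<Sum>j<N. h (Suc j))"
      unfolding S_def h_def by (intro sum.cong refl arg_cong[of _ _ g]) (use N0 in \<open>simp add: field_simps\<close>)
    also have "\<dots> + h 0 = (\<Sum>j<N. h j) + h N"
      using sum.lessThan_Suc_shift[of h N] sum.lessThan_Suc[of h N] by simp
    moreover have "h N = h 0" using per[of t] N0 by (simp add: h_def)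
    ultimately show ?thesis by (simp add: S_def h_def)
  qed
  have Sper': "S (t + 2 * pi / N * real k) = S t" for t k
  proof (induction k)
    case (Suc k)
    have "t + 2 * pi / N * real (Suc k) = (t + 2 * pi / N * real k) + 2 * pi / N"
      by (simp add: algebra_simps add_divide_distrib)
    then show ?case using Sper Suc by metis
  qed simp
  have "(\<Sum>j<N. G (z * cis (2 * pi * j / N))) \<le> (\<Sum>j<N. G (z' * cis (2 * pi * j / N))) + N * e"
    if z: "cmod z = 1" "cmod z' = 1" for z z'
  proof -
    \<comment> \<open>The shift by \<open>2\<pi>\<close> puts \<open>a\<close> above \<open>b\<close>, so that a nonnegative number \<open>k\<close> of periods suffices.\<close>
    define a where "a = Arg2pi z + 2 * pi"
    define b where "b = Arg2pi z'"
    have a: "2 * pi \<le> a" "a < 4 * pi" and b: "0 \<le> b" "b < 2 * pi"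
      using Arg2pi_ge_0[of z] Arg2pi_lt_2pi[of z] Arg2pi_ge_0[of z'] Arg2pi_lt_2pi[of z']
      by (auto simp: a_def b_def)
    have "z = cis (Arg2pi z)" using Arg2pi_eq[of z] z by (simp add: cis_conv_exp)
    then have za: "z = cis a" using cis_mult[of "Arg2pi z" "2*pi"] by (simp add: a_def)
    have zb: "z' = cis b" using Arg2pi_eq[of z'] z by (simp add: cis_conv_exp b_def)
    define k where "k = nat \<lfloor>(a - b) / (2 * pi / N)\<rfloor>"
    define b' where "b' = b + 2 * pi / N * real k"
    have q: "(a - b) / (2 * pi / N) \<ge> 0" using a b N0 by auto
    then have "real k \<le> (a - b) / (2 * pi / N)" "(a - b) / (2 * pi / N) < real k + 1"
      unfolding k_def by linarith+
    then have b': "b' \<le> a" "a - b' < d" "b' \<ge> 0"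
      using Nd N0 b unfolding b'_def by (auto simp: field_simps)
    have "(\<Sum>j<N. G (z * cis (2 * pi * j / N))) = S a"
      by (simp add: S_def g_def za cis_mult)
    also have "\<dots> \<le> (\<Sum>j<N. g (b' + 2 * pi * j / N) + e)"
      unfolding S_def
    proof (rule sum_mono)
      fix j assume j: "j \<in> {..<N}"
      define x where "x = 2 * pi * j / N"
      have x: "0 \<le> x" "x \<le> 2 * pi" using j N0 by (auto simp: x_def field_simps)
      have "dist (g (a + x)) (g (b' + x)) < e"
        by (rule d(2)) (use x b' a in \<open>auto simp: dist_real_def\<close>)
      then show "g (a + 2 * pi * j / N) \<le> g (b' + 2 * pi * j / N) + e"
        by (simp add: x_def dist_real_def)
    qed
    also have "\<dots> = S b' + N * e" by (simp add: S_def sum.distrib)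
    also have "S b' = S b" unfolding b'_def by (rule Sper')
    also have "S b = (\<Sum>j<N. G (z' * cis (2 * pi * j / N)))"
      by (simp add: S_def g_def zb cis_mult)
    finally show ?thesis .
  qed
  then show ?thesis using that[of N] N0 by simp
qed

text \<open>The circle mean is the limit of means over \<open>N\<close>-th roots of unity, to which the maximum principle
  applies: for fixed \<open>N\<close> the sum \<open>\<Sum>j. |f (\<zeta> \<omega>\<^sup>j)|\<^sup>p\<close> at \<open>|\<zeta>| = r\<close> is bounded by its maximum
  on \<open>|\<zeta>| = R\<close>, and there it is almost constant for large \<open>N\<close>, hence close to its average.
  A direct subharmonicity argument would have to control the zeros of \<open>f\<close> uniformly along the circle.\<close>

lemma circle_mean_mono:
  assumes hol: "f holomorphic_on cball 0 R" and r: "0 \<le> r" "r \<le> R" and p: "0 < p"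
  shows "circle_mean p f r \<le> circle_mean p f R"
proof (rule field_le_epsilon)
  fix e :: real assume e: "e > 0"
  define G where "G = (\<lambda>s z. cmod (f (of_real s * z)) powr p)"
  have G: "continuous_on (sphere 0 1) (G s)" if "0 \<le> s" "s \<le> R" for s
    unfolding G_def
    by (rule continuous_on_powr' continuous_intros continuous_on_compose2[OF holomorphic_on_imp_continuous_on[OF hol]])+
       (use that p in \<open>auto simp: norm_mult\<close>)
  obtain N :: nat where N: "N > 0" "\<And>z z'. cmod z = 1 \<Longrightarrow> cmod z' = 1 \<Longrightarrow>
       (\<Sum>j<N. G R (z * cis (2 * pi * j / N))) \<le> (\<Sum>j<N. G R (z' * cis (2 * pi * j / N))) + N * e"
    using root_of_unity_sums_almost_constant[OF G[of R] e] r by auto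
  define c where "c = (\<lambda>j. cis (2 * pi * real j / N))"
  have c: "cmod (c j) = 1" for j by (simp add: c_def)
  have G': "continuous_on (sphere 0 1) (\<lambda>z. G s (z * c j))" if "0 \<le> s" "s \<le> R" for s j
    by (rule continuous_on_compose2[OF G[OF that]]) (auto intro!: continuous_intros simp: norm_mult c)
  have avg: "circ_avg (\<lambda>z. \<Sum>j<N. G s (z * c j)) = N * circle_mean p f s" if "0 \<le> s" "s \<le> R" for s
  proof -
    have "circ_avg (\<lambda>z. G s (z * c j)) = circle_mean p f s" for j
      using circ_avg_rotate[OF G[OF that] c, of j]
      by (simp add: circle_mean_eq_circ_avg G_def mult.commute)
    then show ?thesis using G'[OF that] by (simp add: circ_avg_sum)
  qed
  have R: "(\<Sum>j<N. G R (z * c j)) \<le> N * (circle_mean p f R + e)" if "cmod z = 1" for z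
  proof -
    have "circ_avg (\<lambda>z'. \<Sum>j<N. G R (z * c j)) \<le> circ_avg (\<lambda>z'. (\<Sum>j<N. G R (z' * c j)) + N * e)"
      using N(2) that r by (intro circ_avg_mono continuous_intros G') (auto simp: c_def)
    also have "\<dots> = N * (circle_mean p f R + e)"
      using r by (subst circ_avg_add) (auto intro!: continuous_intros G' simp: avg algebra_simps)
    finally show ?thesis by simp
  qed
  have *: "(\<Sum>j<N. G r (z * c j)) \<le> N * (circle_mean p f R + e)" if z: "cmod z = 1" for z
  proof -
    have "(\<Sum>j<N. cmod (f (of_real r * z * c j)) powr p) \<le> N * (circle_mean p f R + e)"
    proof (rule sum_powr_le_on_cball[where f = "\<lambda>j \<zeta>. f (\<zeta> * c j)" and S = "cball 0 R" and R = R])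
      show "(\<lambda>\<zeta>. f (\<zeta> * c j)) holomorphic_on cball 0 R" for j
        by (rule holomorphic_on_compose_gen[OF _ hol, unfolded o_def])
           (auto intro!: holomorphic_intros simp: norm_mult c)
      fix \<zeta> :: complex assume \<zeta>: "cmod \<zeta> = R"
      define z' where "z' = (if R = 0 then 1 else \<zeta> / of_real R)"
      have z': "cmod z' = 1" "\<zeta> = of_real R * z'"
        using \<zeta> r by (auto simp: z'_def norm_divide)
      show "(\<Sum>j<N. cmod (f (\<zeta> * c j)) powr p) \<le> N * (circle_mean p f R + e)"
        using R[OF z'(1)] by (simp add: G_def z'(2) mult.assoc)
    qed (use p r z in \<open>auto simp: norm_mult\<close>)
    then show ?thesis by (simp add: G_def mult.assoc)
  qed
  have "N * circle_mean p f r \<le> circ_avg (\<lambda>z. N * (circle_mean p f R + e))"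
    unfolding avg[OF r, symmetric]
    using r by (intro circ_avg_mono continuous_intros G' *) auto
  then show "circle_mean p f r \<le> circle_mean p f R + e" using N(1) by simp
qed

lemma circle_mean_mono_disc:
  assumes "f holomorphic_on ball 0 1" "0 \<le> r" "r \<le> R" "R < 1" "0 < p"
  shows "circle_mean p f r \<le> circle_mean p f R"
  by (rule circle_mean_mono) (use assms in \<open>auto intro: holomorphic_on_subset\<close>)

lemma continuous_on_sphere_powr:
  assumes "f holomorphic_on ball 0 1" "0 \<le> r" "r < 1" "0 < p"
  shows "continuous_on (sphere 0 1) (\<lambda>z. cmod (f (of_real r * z)) powr p)"
  by (rule continuous_on_powr' continuous_intros
      continuous_on_compose2[OF holomorphic_on_imp_continuous_on[OF assms(1)]])+
     (use assms in \<open>auto simp: norm_mult\<close>)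

abbreviation hardy_pow :: "real \<Rightarrow> (complex \<Rightarrow> complex) \<Rightarrow> real" where
  "hardy_pow p f \<equiv> hardy_norm p f powr p"

text \<open>A limit, unlike a supremum, is compatible with sums of circle means.\<close>

lemma circle_mean_tendsto_hardy_pow:
  fixes r :: "nat \<Rightarrow> real"
  assumes f: "f \<in> hardy_space p" and p: "0 < p"
    and r: "\<And>n. 0 \<le> r n" "\<And>n. r n < 1" "r \<longlonglongrightarrow> 1"
  shows "(\<lambda>n. circle_mean p f (r n)) \<longlonglongrightarrow> hardy_pow p f"
proof (rule order_tendstoI)
  fix a assume a: "hardy_pow p f < a"
  then show "\<forall>\<^sub>F n in sequentially. circle_mean p f (r n) < a"
    using circle_mean_le_hardy_norm[OF f p r(1,2)] by (intro always_eventually) (auto intro: le_less_trans)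
next
  fix a assume a: "a < hardy_pow p f"
  have "\<exists>s\<in>{0..<1}. a < circle_mean p f s"
  proof (rule ccontr)
    assume neg: "\<not> ?thesis"
    then have le: "circle_mean p f s \<le> max a 0" if "s \<in> {0..<1}" for s using that by force
    have "hardy_norm p f \<le> (max a 0) powr (1/p)"
      unfolding hardy_norm_def
      by (rule cSUP_least) (use le p circle_mean_nonneg in \<open>auto intro!: powr_mono2\<close>)
    then have "hardy_pow p f \<le> ((max a 0) powr (1/p)) powr p"
      using p hardy_norm_nonneg[OF f] by (intro powr_mono2) auto
    then have "hardy_pow p f \<le> max a 0" using p by (simp add: powr_powr)
    moreover have "a < 0 \<Longrightarrow> hardy_pow p f \<le> 0 \<Longrightarrow> False"
      using le[of 0] circle_mean_nonneg[of p f 0] neg by force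
    ultimately show False using a by linarith
  qed
  then obtain s where s: "0 \<le> s" "s < 1" "a < circle_mean p f s" by auto
  have "\<forall>\<^sub>F n in sequentially. s < r n" using order_tendstoD(1)[OF r(3) s(2)] .
  then show "\<forall>\<^sub>F n in sequentially. a < circle_mean p f (r n)"
  proof eventually_elim
    case (elim n)
    have "circle_mean p f s \<le> circle_mean p f (r n)"
      using f by (intro circle_mean_mono_disc) (use s elim r p in \<open>auto simp: hardy_space_def\<close>)
    then show ?case using s by simp
  qed
qed

text \<open>By monotonicity only the radii near 1 matter.\<close>

lemma hardy_spaceI_pow:
  assumes hol: "f holomorphic_on ball 0 1" and z: "\<And>z. z \<notin> ball 0 1 \<Longrightarrow> f z = 0" and p: "0 < p"
    and r0: "0 \<le> r0" "r0 < 1" and c: "\<And>r. r0 \<le> r \<Longrightarrow> r < 1 \<Longrightarrow> circle_mean p f r \<le> c"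
  shows "f \<in> hardy_space p" "hardy_pow p f \<le> c"
proof -
  have c0: "c \<ge> 0" using c[of r0] r0 circle_mean_nonneg[of p f r0] by simp
  have *: "circle_mean p f r \<le> (c powr (1/p)) powr p" if "0 \<le> r" "r < 1" for r
  proof -
    have "circle_mean p f r \<le> circle_mean p f (max r r0)"
      using that r0 by (intro circle_mean_mono_disc hol p) auto
    also have "\<dots> \<le> c" using that r0 by (intro c) auto
    finally show ?thesis using p c0 by (simp add: powr_powr)
  qed
  note h = hardy_spaceI[OF hol z p _ *]
  show "f \<in> hardy_space p" using h(1) by simp
  have "hardy_pow p f \<le> (c powr (1/p)) powr p"
    using h hardy_norm_nonneg p by (intro powr_mono2) auto
  then show "hardy_pow p f \<le> c" using p c0 by (simp add: powr_powr)
qed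

lemma powr_base_inj:
  fixes x y p :: real
  assumes "x powr p = y powr p" "0 \<le> x" "0 \<le> y" "0 < p"
  shows "x = y"
  using arg_cong[OF assms(1), of "\<lambda>t. t powr (1 / p)"] assms(2-4) by (simp add: powr_powr)

lemma hardy_norm_eq_iff_pow:
  assumes "f \<in> hardy_space p" "g \<in> hardy_space p" "0 < p"
  shows "hardy_norm p f = hardy_norm p g \<longleftrightarrow> hardy_pow p f = hardy_pow p g"
  using powr_base_inj[of "hardy_norm p f" p "hardy_norm p g"] assms hardy_norm_nonneg by auto

section \<open>Weighted compositions with disc automorphisms\<close>

definition mob :: "complex \<Rightarrow> complex \<Rightarrow> complex \<Rightarrow> complex" where
  "mob u w z = u * (z - w) / (1 - cnj w * z)"

text \<open>A holomorphic branch of the \<open>p\<close>-th root of the derivative of \<open>mob 1 w\<close>. Its value is 0 for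
  \<open>|w| = 1\<close>, so that degenerating automorphisms have the weight 0.\<close>

definition kern :: "real \<Rightarrow> complex \<Rightarrow> complex \<Rightarrow> complex" where
  "kern p w z = of_real ((1 - (cmod w)\<^sup>2) powr (1/p)) * (1 - cnj w * z) powr of_real (- 2 / p)"

text \<open>The extension by 0 outside the disc is part of membership in \<open>hardy_space\<close>.\<close>

definition wcomp :: "real \<Rightarrow> complex \<Rightarrow> complex \<Rightarrow> complex \<Rightarrow> (complex \<Rightarrow> complex) \<Rightarrow> complex \<Rightarrow> complex" where
  "wcomp p c u w f z = (if z \<in> ball 0 1 then c * kern p w z * f (mob u w z) else 0)"

lemma Re_one_minus_cnj_mult_pos:
  assumes "cmod w < 1" "cmod z \<le> 1 \<or> cmod w = 0"
  shows "Re (1 - cnj w * z) > 0"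
proof -
  have "cmod (cnj w * z) < 1"
    using assms mult_strict_right_mono[of "cmod w" 1 "cmod z"] mult_left_le[of "cmod z" "cmod w"]
    by (auto simp: norm_mult)
  then show ?thesis using complex_Re_le_cmod[of "cnj w * z"] by simp
qed

lemma one_minus_cnj_mult_nz:
  assumes "cmod w < 1" "cmod z \<le> 1"
  shows "1 - cnj w * z \<noteq> 0"
  using Re_one_minus_cnj_mult_pos[of w z] assms by (metis less_irrefl zero_complex.simps(1))

lemma moebius_norm_identity:
  "(cmod (1 - cnj w * z))\<^sup>2 = (1 - (cmod w)\<^sup>2) * (1 - (cmod z)\<^sup>2) + (cmod (z - w))\<^sup>2"
  unfolding cmod_power2 by (simp add: algebra_simps power2_eq_square)

lemma norm_mob_less:
  assumes "cmod w < 1" "cmod z < 1" "cmod u = 1"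
  shows "cmod (mob u w z) < 1"
proof -
  have "(cmod (z - w))\<^sup>2 < (cmod (1 - cnj w * z))\<^sup>2"
    unfolding moebius_norm_identity using assms by (simp add: abs_square_less_1)
  then have "cmod (z - w) < cmod (1 - cnj w * z)" by (rule power2_less_imp_less) simp
  then show ?thesis using assms by (simp add: mob_def norm_divide norm_mult divide_less_eq)
qed

lemma norm_mob_eq_1:
  assumes "cmod w < 1" "cmod z = 1" "cmod u = 1"
  shows "cmod (mob u w z) = 1"
proof -
  have "cmod (z - w) = cmod (1 - cnj w * z)"
    using moebius_norm_identity[of w z] assms by (simp add: power2_eq_iff_nonneg)
  then show ?thesis using assms one_minus_cnj_mult_nz[of w z] by (simp add: mob_def norm_divide norm_mult)
qed

lemma norm_mob_le:
  assumes "cmod w < 1" "cmod z \<le> 1" "cmod u = 1"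
  shows "cmod (mob u w z) \<le> 1"
  using norm_mob_less[of w z u] norm_mob_eq_1[of w z u] assms by (cases "cmod z = 1") auto

lemma mob_inverse:
  assumes w: "cmod w < 1" "cmod z < 1" "cmod u = 1"
  shows "mob (cnj u) (- (u * w)) (mob u w z) = z"
proof -
  define v where "v = 1 - cnj w * z"
  have v: "v \<noteq> 0" using one_minus_cnj_mult_nz[of w z] w by (simp add: v_def)
  have mv: "mob u w z = u * (z - w) / v" by (simp add: mob_def v_def)
  have uu: "cnj u * u = 1" using w complex_norm_square[of u] by (simp add: mult.commute)
  have ww: "1 - cnj w * w \<noteq> 0" using one_minus_cnj_mult_nz[of w w] w by simp
  have "mob u w z + u * w = u * ((z - w) + w * v) / v"
    unfolding mv using v by (simp add: field_simps)
  also have "(z - w) + w * v = z * (1 - cnj w * w)" by (simp add: v_def algebra_simps)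
  finally have n: "mob u w z + u * w = u * (z * (1 - cnj w * w)) / v" .
  have "1 + cnj (u * w) * mob u w z = (v + (cnj u * u) * (cnj w * (z - w))) / v"
    unfolding mv using v by (simp add: field_simps)
  also have "v + (cnj u * u) * (cnj w * (z - w)) = 1 - cnj w * w"
    unfolding uu by (simp add: v_def algebra_simps)
  finally have d: "1 + cnj (u * w) * mob u w z = (1 - cnj w * w) / v" .
  have "mob (cnj u) (- (u * w)) (mob u w z) = cnj u * (mob u w z + u * w) / (1 + cnj (u * w) * mob u w z)"
    by (simp add: mob_def)
  also have "\<dots> = (cnj u * u) * z" unfolding n d using v ww by simp
  finally show ?thesis by (simp add: uu)
qed

lemma mob_inverse':
  assumes w: "cmod w < 1" "cmod z < 1" "cmod u = 1"
  shows "mob u w (mob (cnj u) (- (u * w)) z) = z"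
proof -
  have uu: "cnj u * u = 1" using w complex_norm_square[of u] by (simp add: mult.commute)
  have e: "- (cnj u * - (u * w)) = w" by (simp add: mult.assoc[symmetric] uu)
  have "mob (cnj (cnj u)) (- (cnj u * - (u * w))) (mob (cnj u) (- (u * w)) z) = z"
    by (rule mob_inverse) (use w in \<open>auto simp: norm_mult\<close>)
  then show ?thesis by (simp only: e complex_cnj_cnj)
qed

lemma mob_holomorphic:
  assumes "cmod w < 1"
  shows "mob u w holomorphic_on cball 0 1"
  unfolding mob_def using one_minus_cnj_mult_nz[OF assms] by (intro holomorphic_intros) auto

lemma kern_holomorphic:
  assumes "cmod w < 1"
  shows "kern p w holomorphic_on cball 0 1"
  unfolding kern_def
  using Re_one_minus_cnj_mult_pos[OF assms]
  by (intro holomorphic_intros) (force simp: complex_nonpos_Reals_iff)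

lemma norm_kern:
  assumes "cmod w \<le> 1" "0 < p"
  shows "cmod (kern p w z) powr p = (1 - (cmod w)\<^sup>2) / (cmod (1 - cnj w * z))\<^sup>2"
proof -
  have "1 - (cmod w)\<^sup>2 \<ge> 0" using assms by (simp add: power_le_one)
  moreover have "cmod (1 - cnj w * z) powr - 2 = 1 / (cmod (1 - cnj w * z))\<^sup>2"
    by (cases "1 - cnj w * z = 0") (auto simp: powr_minus divide_inverse)
  moreover have "cmod ((1 - cnj w * z) powr of_real (- 2 / p)) = cmod (1 - cnj w * z) powr (-2/p)"
    by (cases "1 - cnj w * z = 0") (auto simp: powr_def)
  ultimately show ?thesis using assms
    by (simp add: kern_def norm_mult powr_mult powr_powr)
qed

lemma kern_nz:
  assumes "cmod w < 1" "cmod z \<le> 1"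
  shows "kern p w z \<noteq> 0"
proof -
  have "1 - (cmod w)\<^sup>2 > 0" using assms by (simp add: abs_square_less_1)
  then show ?thesis using one_minus_cnj_mult_nz[OF assms] by (simp add: kern_def)
qed

text \<open>The Moebius map does not preserve circles around 0. For the dilation \<open>f (s \<cdot>)\<close>, which is holomorphic
  across the unit circle, the circle mean of the image at any radius is bounded by the one at
  radius 1. There the change of variables turns it into the circle mean of \<open>f\<close> at \<open>s\<close>. Then \<open>s\<close> tends to 1.\<close>

lemma wcomp_bounded:
  assumes f: "f \<in> hardy_space p" and p: "0 < p" and c: "cmod c = 1" and u: "cmod u = 1" and w: "cmod w < 1"
  shows "wcomp p c u w f \<in> hardy_space p" "hardy_pow p (wcomp p c u w f) \<le> hardy_pow p f"
proof -
  have holf: "f holomorphic_on ball 0 1" using f by (simp add: hardy_space_def)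
  have contf: "continuous_on (ball 0 1) f" using holf by (rule holomorphic_on_imp_continuous_on)
  define g where "g = (\<lambda>s z. c * kern p w z * f (of_real s * mob u w z))"
  have holg: "g s holomorphic_on cball 0 1" if s: "0 \<le> s" "s < 1" for s
  proof -
    have "(\<lambda>z. f (of_real s * mob u w z)) holomorphic_on cball 0 1"
    proof (rule holomorphic_on_compose_gen[OF _ holf, unfolded o_def])
      show "(\<lambda>z. of_real s * mob u w z) ` cball 0 1 \<subseteq> ball 0 1"
      proof safe
        fix z :: complex assume "z \<in> cball 0 1"
        then have "cmod (mob u w z) \<le> 1" using norm_mob_le[of w z u] w u by simp
        then show "of_real s * mob u w z \<in> ball 0 1"
          using s mult_left_le[of "cmod (mob u w z)" s] by (simp add: norm_mult)
      qed
    qed (intro holomorphic_intros mob_holomorphic w)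
    then show ?thesis unfolding g_def by (intro holomorphic_intros kern_holomorphic w)
  qed
  have le: "circle_mean p (g s) r \<le> hardy_pow p f" if s: "0 \<le> s" "s < 1" and r: "0 \<le> r" "r < 1" for s r
  proof -
    define G where "G = (\<lambda>z. cmod (f (of_real s * z)) powr p)"
    have G: "continuous_on (sphere 0 1) G"
      unfolding G_def by (rule continuous_on_sphere_powr[OF holf s p])
    have Gu: "continuous_on (sphere 0 1) (\<lambda>z. G (u * z))"
      by (rule continuous_on_compose2[OF G]) (use u in \<open>auto intro!: continuous_intros simp: norm_mult\<close>)
    have "circle_mean p (g s) r \<le> circle_mean p (g s) 1"
      using r p by (intro circle_mean_mono holg s) auto
    also have "\<dots> = circ_avg (\<lambda>z. (1 - (cmod w)\<^sup>2) / (cmod (1 - cnj w * z))\<^sup>2 * G (u * ((z - w) / (1 - cnj w * z))))"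
      unfolding circle_mean_eq_circ_avg
      by (rule circ_avg_cong)
         (use w p c in \<open>simp add: g_def norm_mult powr_mult norm_kern G_def mob_def\<close>)
    also have "\<dots> = circ_avg (\<lambda>z. G (u * z))" by (rule circ_avg_moebius[OF Gu w])
    also have "\<dots> = circ_avg G" by (rule circ_avg_rotate[OF G u])
    also have "\<dots> = circle_mean p f s" by (simp add: circle_mean_eq_circ_avg G_def)
    also have "\<dots> \<le> hardy_pow p f" by (rule circle_mean_le_hardy_norm[OF f p s])
    finally show ?thesis .
  qed
  have le1: "circle_mean p (wcomp p c u w f) r \<le> hardy_pow p f" if r: "0 \<le> r" "r < 1" for r
  proof -
    have "circle_mean p (wcomp p c u w f) r = circle_mean p (g 1) r"
      unfolding circle_mean_eq_circ_avg
      by (rule circ_avg_cong) (use r in \<open>simp add: g_def wcomp_def norm_mult\<close>)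
    moreover have "continuous_on {0..1} (\<lambda>s. circle_mean p (g s) r)"
    proof -
      have m: "cmod (mob u w (of_real r * z)) < 1" if "cmod z = 1" for z
        using norm_mob_less[of w "of_real r * z" u] w u r that by (simp add: norm_mult)
      have m': "cmod (of_real s * mob u w (of_real r * z)) < 1" if "0 \<le> s" "s \<le> 1" "cmod z = 1" for s z
        using m[OF that(3)] mult_right_mono[of s 1 "cmod (mob u w (of_real r * z))"] that by (simp add: norm_mult)
      have ck: "continuous_on ({0..1} \<times> sphere 0 1) (\<lambda>y::real\<times>complex. kern p w (of_real r * snd y))"
        by (rule continuous_on_compose2[OF holomorphic_on_imp_continuous_on[OF kern_holomorphic[OF w]]])
           (use r in \<open>auto intro!: continuous_intros simp: norm_mult\<close>)
      have cm: "continuous_on ({0..1} \<times> sphere 0 1) (\<lambda>y::real\<times>complex. mob u w (of_real r * snd y))"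
        by (rule continuous_on_compose2[OF holomorphic_on_imp_continuous_on[OF mob_holomorphic[OF w]]])
           (use r in \<open>auto intro!: continuous_intros simp: norm_mult\<close>)
      have cf: "continuous_on ({0..1} \<times> sphere 0 1) (\<lambda>y::real\<times>complex. f (of_real (fst y) * mob u w (of_real r * snd y)))"
        by (rule continuous_on_compose2[OF contf])
           (use m' in \<open>auto intro!: continuous_intros cm\<close>)
      have "continuous_on ({0..1} \<times> sphere 0 1) (\<lambda>(s, z). cmod (g s (of_real r * z)) powr p)"
        unfolding split_def g_def
        by (intro continuous_on_powr' continuous_intros ck cf) (use p in auto)
      then show ?thesis
        unfolding circle_mean_eq_circ_avg by (rule circ_avg_continuous_param)
    qed
    moreover have "(\<lambda>n. 1 - 1 / real (Suc n)) \<longlonglongrightarrow> 1"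
      using tendsto_diff[OF tendsto_const LIMSEQ_inverse_real_of_nat, of "1::real"] by (simp add: inverse_eq_divide)
    ultimately have "(\<lambda>n. circle_mean p (g (1 - 1 / real (Suc n))) r) \<longlonglongrightarrow> circle_mean p (wcomp p c u w f) r"
      by (auto intro!: continuous_on_tendsto_compose[where f = "\<lambda>s. circle_mean p (g s) r" and s = "{0..1}"] simp: field_simps)
    then show ?thesis
      by (rule LIMSEQ_le_const2) (use r in \<open>auto intro!: exI[of _ 0] le simp: field_simps\<close>)
  qed
  have hol: "wcomp p c u w f holomorphic_on ball 0 1"
  proof -
    have "(\<lambda>z. c * kern p w z * f (mob u w z)) holomorphic_on ball 0 1"
      by (intro holomorphic_intros holomorphic_on_compose_gen[OF _ holf, unfolded o_def]
          holomorphic_on_subset[OF kern_holomorphic[OF w]] holomorphic_on_subset[OF mob_holomorphic[OF w]])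
         (use norm_mob_less w u in auto)
    then show ?thesis by (rule holomorphic_transform) (simp add: wcomp_def)
  qed
  have z: "wcomp p c u w f z = 0" if "z \<notin> ball 0 1" for z using that by (simp add: wcomp_def)
  show "wcomp p c u w f \<in> hardy_space p" "hardy_pow p (wcomp p c u w f) \<le> hardy_pow p f"
    using hardy_spaceI_pow[OF hol z p, of 0 "hardy_pow p f"] le1 by auto
qed

lemma holomorphic_unimodular_constant:
  assumes f: "f holomorphic_on ball 0 1" and n: "\<And>z. z \<in> ball 0 1 \<Longrightarrow> cmod (f z) = 1"
  obtains c where "cmod c = 1" "\<And>z. z \<in> ball 0 1 \<Longrightarrow> f z = c"
proof -
  have "f constant_on ball 0 1"
    by (rule maximum_modulus_principle[OF f, of "ball 0 1" 0]) (use n in auto)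
  then obtain c where c: "\<And>z. z \<in> ball 0 1 \<Longrightarrow> f z = c" by (auto simp: constant_on_def)
  moreover have "cmod c = 1" using c[of 0] n[of 0] by simp
  ultimately show ?thesis using that by blast
qed

text \<open>By the chain rule the product of the weights of an automorphism and of its inverse has modulus 1.
  Being holomorphic, it is constant; the constant depends on the branches.\<close>

lemma kern_inverse:
  assumes p: "0 < p" and u: "cmod u = 1" and w: "cmod w < 1"
  obtains c where "cmod c = 1" "\<And>z. z \<in> ball 0 1 \<Longrightarrow> kern p w z * kern p (- (u * w)) (mob u w z) = c"
proof -
  have w': "cmod (- (u * w)) < 1" using w u by (simp add: norm_mult)
  have "(\<lambda>z. kern p w z * kern p (- (u * w)) (mob u w z)) holomorphic_on ball 0 1"
    by (intro holomorphic_intros holomorphic_on_compose_gen[OF _ kern_holomorphic[OF w'], unfolded o_def]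
          holomorphic_on_subset[OF kern_holomorphic[OF w]] holomorphic_on_subset[OF mob_holomorphic[OF w]])
       (use norm_mob_le w u in auto)
  moreover have "cmod (kern p w z * kern p (- (u * w)) (mob u w z)) = 1" if z: "z \<in> ball 0 1" for z
  proof -
    define v where "v = 1 - cnj w * z"
    have v: "v \<noteq> 0" using one_minus_cnj_mult_nz[of w z] w z by (simp add: v_def)
    have mv: "mob u w z = u * (z - w) / v" by (simp add: mob_def v_def)
    have uu: "cnj u * u = 1" using u complex_norm_square[of u] by (simp add: mult.commute)
    have "1 + cnj (u * w) * mob u w z = (v + (cnj u * u) * (cnj w * (z - w))) / v"
      unfolding mv using v by (simp add: field_simps)
    also have "v + (cnj u * u) * (cnj w * (z - w)) = 1 - cnj w * w"
      unfolding uu by (simp add: v_def algebra_simps)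
    also have "1 - cnj w * w = of_real (1 - (cmod w)\<^sup>2)"
      using complex_norm_square[of w] by (simp add: mult.commute)
    finally have d: "1 + cnj (u * w) * mob u w z = of_real (1 - (cmod w)\<^sup>2) / v" .
    have pos: "1 - (cmod w)\<^sup>2 > 0" using w by (simp add: abs_square_less_1)
    have "cmod (kern p w z * kern p (- (u * w)) (mob u w z)) powr p
        = (1 - (cmod w)\<^sup>2) / (cmod v)\<^sup>2 * ((1 - (cmod w)\<^sup>2) / (cmod (1 + cnj (u * w) * mob u w z))\<^sup>2)"
      using norm_kern[of w p z] norm_kern[of "- (u * w)" p "mob u w z"] w w' u p
      by (simp add: norm_mult powr_mult v_def)
    also have "\<dots> = 1"
    proof -
      have "a / n\<^sup>2 * (a / (a / n)\<^sup>2) = 1" if "a > 0" "n \<noteq> 0" for a n :: real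
        using that by (simp add: power2_eq_square)
      from this[OF pos, of "cmod v"] show ?thesis unfolding d norm_divide norm_of_real using v pos by simp
    qed
    finally show ?thesis using p by (metis norm_ge_zero powr_eq_one_iff_gen powr_one_eq_one powr_powr powr_one divide_self_if less_irrefl times_divide_eq_right mult.right_neutral)
  qed
  ultimately show ?thesis using that by (rule holomorphic_unimodular_constant)
qed

lemma wcomp_right_inverse:
  assumes p: "0 < p" and c: "cmod c = 1" and u: "cmod u = 1" and w: "cmod w < 1"
  obtains c' where "cmod c' = 1"
    "\<And>h. h \<in> hardy_space p \<Longrightarrow> wcomp p c u w (wcomp p c' (cnj u) (- (u * w)) h) = h"
proof -
  obtain a where a: "cmod a = 1" "\<And>z. z \<in> ball 0 1 \<Longrightarrow> kern p w z * kern p (- (u * w)) (mob u w z) = a"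
    using kern_inverse[OF p u w] by blast
  have nz: "a \<noteq> 0" "c \<noteq> 0" using a c by auto
  have "wcomp p c u w (wcomp p (1 / (c * a)) (cnj u) (- (u * w)) h) z = h z" if h: "h \<in> hardy_space p" for h z
  proof (cases "z \<in> ball 0 1")
    case True
    then show ?thesis
      using a(2)[OF True] norm_mob_less[of w z u] mob_inverse[of w z u] u w nz
      by (simp add: wcomp_def) (simp add: field_simps)
  qed (use h in \<open>auto simp: wcomp_def hardy_space_def\<close>)
  then show ?thesis using that[of "1 / (c * a)"] a c by (auto simp: norm_divide norm_mult)
qed

lemma wcomp_inj:
  assumes p: "0 < p" and c: "cmod c = 1" and u: "cmod u = 1" and w: "cmod w < 1"
    and fg: "f \<in> hardy_space p" "g \<in> hardy_space p" "wcomp p c u w f = wcomp p c u w g"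
  shows "f = g"
proof
  fix y show "f y = g y"
  proof (cases "y \<in> ball 0 1")
    case True
    define z where "z = mob (cnj u) (- (u * w)) y"
    have z: "cmod z < 1" unfolding z_def by (rule norm_mob_less) (use True u w in \<open>auto simp: norm_mult\<close>)
    have "mob u w z = y" unfolding z_def using True u w by (intro mob_inverse') auto
    then show ?thesis
      using fun_cong[OF fg(3), of z] z kern_nz[OF w, of z p] c by (auto simp: wcomp_def)
  qed (use fg in \<open>auto simp: hardy_space_def\<close>)
qed

text \<open>Both the operator and its inverse are contractions.\<close>

lemma wcomp_isometry:
  assumes f: "f \<in> hardy_space p" and p: "0 < p" and c: "cmod c = 1" and u: "cmod u = 1" and w: "cmod w < 1"
  shows "hardy_norm p (wcomp p c u w f) = hardy_norm p f"
proof -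
  obtain c' where c': "cmod c' = 1"
    "\<And>h. h \<in> hardy_space p \<Longrightarrow> wcomp p c u w (wcomp p c' (cnj u) (- (u * w)) h) = h"
    using wcomp_right_inverse[OF p c u w] by blast
  note b = wcomp_bounded[OF f p c u w]
  have u': "cmod (cnj u) = 1" "cmod (- (u * w)) < 1" using u w by (auto simp: norm_mult)
  note b' = wcomp_bounded[OF b(1) p c'(1) u']
  have "wcomp p c' (cnj u) (- (u * w)) (wcomp p c u w f) = f"
    by (rule wcomp_inj[OF p c u w b'(1) f c'(2)[OF b(1)]])
  then have "hardy_pow p f \<le> hardy_pow p (wcomp p c u w f)" using b'(2) by simp
  then show ?thesis using b by (simp add: hardy_norm_eq_iff_pow[OF b(1) f p])
qed

text \<open>The automorphism that moves \<open>w\<close> to 0 reduces this to the circle mean at radius 0.\<close>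

lemma hardy_point_bound:
  assumes f: "f \<in> hardy_space p" and p: "0 < p" and w: "cmod w < 1"
  shows "cmod (f w) powr p * (1 - (cmod w)\<^sup>2) \<le> hardy_pow p f"
proof -
  have w': "cmod (- w) < 1" "cmod (- w) \<le> 1" and one: "cmod 1 = 1" using w by auto
  define g where "g = wcomp p 1 1 (- w) f"
  note b = wcomp_bounded[OF f p one one w'(1)]
  have "circle_mean p g 0 \<le> hardy_pow p f"
    using circle_mean_le_hardy_norm[OF b(1) p, of 0] b(2) by (simp add: g_def)
  moreover have "circle_mean p g 0 = cmod (g 0) powr p" by (simp add: circle_mean_eq_circ_avg)
  moreover have "cmod (g 0) powr p = cmod (f w) powr p * (1 - (cmod w)\<^sup>2)"
    using norm_kern[OF w'(2) p, of 0] by (simp add: g_def wcomp_def mob_def norm_mult powr_mult)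
  ultimately show ?thesis by simp
qed

section \<open>Extremal triples for phase averages\<close>

text \<open>The only place where \<open>p \<noteq> 2\<close> matters: for \<open>q = p/2\<close> the power is strictly concave or strictly convex.
  The sign \<open>sgn (1 - q)\<close> treats both cases at once.\<close>

lemma powr_pair_less:
  fixes q A t t' :: real
  assumes q: "0 < q" "q \<noteq> 1" and t: "0 \<le> t" "t < t'" "t' \<le> A"
  shows "sgn (1 - q) * ((A + t') powr q + (A - t') powr q) < sgn (1 - q) * ((A + t) powr q + (A - t) powr q)"
proof -
  define h where "h = (\<lambda>t. (A + t) powr q + (A - t) powr q)"
  have cont: "continuous_on {t..t'} h"
    unfolding h_def by (intro continuous_intros continuous_on_powr') (use q t in auto)
  have d: "(h has_real_derivative q * ((A + x) powr (q - 1) - (A - x) powr (q - 1))) (at x)" if "t < x" "x < t'" for x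
    unfolding h_def using that t by (auto intro!: derivative_eq_intros simp: algebra_simps)
  show ?thesis
  proof (cases "q < 1")
    case True
    have "h t' < h t"
    proof (rule DERIV_neg_imp_decreasing_open[OF t(2) _ cont])
      fix x assume x: "t < x" "x < t'"
      have "(A + x) powr (q - 1) < (A - x) powr (q - 1)"
        using x t True by (intro powr_less_mono2_neg) auto
      then show "\<exists>y. DERIV h x :> y \<and> y < 0" using d[OF x] q by (auto simp: mult_less_0_iff)
    qed
    then show ?thesis using True by (simp add: h_def)
  next
    case False
    have "h t < h t'"
    proof (rule DERIV_pos_imp_increasing_open[OF t(2) _ cont])
      fix x assume x: "t < x" "x < t'"
      have "(A - x) powr (q - 1) < (A + x) powr (q - 1)"
        using x t False q by (intro powr_less_mono2) auto
      then show "\<exists>y. DERIV h x :> y \<and> 0 < y" using d[OF x] q by (auto intro!: exI)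
    qed
    then show ?thesis using False q by (simp add: h_def)
  qed
qed

lemma powr_pair_abs_le:
  fixes q A t t' :: real
  assumes q: "0 < q" "q \<noteq> 1" and t: "\<bar>t\<bar> \<le> \<bar>t'\<bar>" "\<bar>t'\<bar> \<le> A"
  shows "sgn (1 - q) * ((A + t') powr q + (A - t') powr q) \<le> sgn (1 - q) * ((A + t) powr q + (A - t) powr q)"
proof -
  have s: "(A + x) powr q + (A - x) powr q = (A + \<bar>x\<bar>) powr q + (A - \<bar>x\<bar>) powr q" for x
    by (cases "x \<ge> 0") auto
  show ?thesis
  proof (cases "\<bar>t\<bar> = \<bar>t'\<bar>")
    case True
    then show ?thesis using s[of t] s[of t'] by simp
  next
    case False
    then show ?thesis using powr_pair_less[OF q, of "\<bar>t\<bar>" "\<bar>t'\<bar>" A] t s[of t] s[of t'] by simp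
  qed
qed

lemma circ_avg_symmetrize:
  assumes "continuous_on (sphere 0 1) G"
  shows "2 * circ_avg G = circ_avg (\<lambda>s. G s + G (- s))"
proof -
  have "continuous_on (sphere 0 1) (\<lambda>s. G (- s))"
    by (rule continuous_on_compose2[OF assms]) (auto intro!: continuous_intros)
  then show ?thesis
    using circ_avg_rotate[OF assms, of "-1"] by (simp add: circ_avg_add assms)
qed

lemma norm_powr_eq_square_powr: "cmod z powr p = ((cmod z)\<^sup>2) powr (p / 2)"
  by (cases "z = 0") (auto simp: powr_powr simp flip: powr_numeral)

text \<open>The linear forms with coefficients \<open>(a\<^sub>0, a\<^sub>1 s, a\<^sub>2 s\<^sup>2)\<close> are averaged, so that the value does not
  change when \<open>(v\<^sub>0, v\<^sub>1, v\<^sub>2)\<close> is replaced by \<open>(v\<^sub>0, z v\<^sub>1, z\<^sup>2 v\<^sub>2)\<close> with \<open>|z| = 1\<close>. Only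
  the coefficients 0 and 1 are used: \<open>(1, 1, 0)\<close> and \<open>(0, 1, 1)\<close> compare moduli, \<open>(1, 1, 1)\<close> compares phases.\<close>

definition phase_mean :: "real \<Rightarrow> complex \<Rightarrow> complex \<Rightarrow> complex \<Rightarrow> complex \<Rightarrow> complex \<Rightarrow> complex \<Rightarrow> real" where
  "phase_mean p a0 a1 a2 v0 v1 v2 = circ_avg (\<lambda>s. cmod (a0 * v0 + a1 * s * v1 + a2 * s\<^sup>2 * v2) powr p)"

lemma phase_mean_continuous:
  assumes "p > 0" "continuous_on A k0" "continuous_on A k1" "continuous_on A k2"
  shows "continuous_on A (\<lambda>x. phase_mean p a0 a1 a2 (k0 x) (k1 x) (k2 x))"
proof -
  have k: "continuous_on (A \<times> S) (\<lambda>y. k (fst y))" if "continuous_on A k" for k :: "'a \<Rightarrow> complex" and S :: "complex set"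
    by (rule continuous_on_compose2[OF that]) (auto intro!: continuous_intros)
  show ?thesis unfolding phase_mean_def
    by (rule circ_avg_continuous_param, unfold split_def)
       (use assms in \<open>auto intro!: continuous_intros continuous_on_powr' k\<close>)
qed

lemma phase_mean_scale:
  assumes "x \<ge> 0"
  shows "phase_mean p a0 a1 a2 (of_real x * v0) (of_real x * v1) (of_real x * v2) = x powr p * phase_mean p a0 a1 a2 v0 v1 v2"
proof -
  have "cmod (a0 * (of_real x * v0) + a1 * s * (of_real x * v1) + a2 * s\<^sup>2 * (of_real x * v2)) powr p
      = x powr p * cmod (a0 * v0 + a1 * s * v1 + a2 * s\<^sup>2 * v2) powr p" for s
  proof -
    have "a0 * (of_real x * v0) + a1 * s * (of_real x * v1) + a2 * s\<^sup>2 * (of_real x * v2)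
       = of_real x * (a0 * v0 + a1 * s * v1 + a2 * s\<^sup>2 * v2)" by (simp add: algebra_simps)
    then show ?thesis using assms by (simp add: norm_mult powr_mult)
  qed
  then show ?thesis unfolding phase_mean_def by (simp add: circ_avg_cmult)
qed

lemma phase_mean_shift: "phase_mean p 0 1 1 v0 v1 v2 = phase_mean p 1 1 0 v1 v2 v0"
  unfolding phase_mean_def
proof (rule circ_avg_cong)
  fix s :: complex assume s: "cmod s = 1"
  have "s * v1 + s\<^sup>2 * v2 = s * (v1 + s * v2)" by (simp add: algebra_simps power2_eq_square)
  then have "cmod (s * v1 + s\<^sup>2 * v2) = cmod (v1 + s * v2)" using s by (simp add: norm_mult)
  then show "cmod (0 * v0 + 1 * s * v1 + 1 * s\<^sup>2 * v2) powr p = cmod (1 * v1 + 1 * s * v2 + 0 * s\<^sup>2 * v0) powr p"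
    by simp
qed

lemma phase_mean_two_moduli:
  assumes p: "p > 0"
  shows "phase_mean p 1 1 0 v0 v1 v2
    = circ_avg (\<lambda>s. (((cmod v0)\<^sup>2 + (cmod v1)\<^sup>2) + 2 * cmod v0 * cmod v1 * Re s) powr (p/2))"
proof -
  define al where "al = (\<lambda>v. if v = 0 then 1 else v / of_real (cmod v))"
  have al: "cmod (al v) = 1" "v = of_real (cmod v) * al v" for v
    by (auto simp: al_def norm_divide)
  define u where "u = al v1 * cnj (al v0)"
  have u: "cmod u = 1" by (simp add: u_def norm_mult al)
  define G where "G = (\<lambda>s. cmod (of_real (cmod v0) + s * of_real (cmod v1)) powr p)"
  have G: "continuous_on (sphere 0 1) G"
    unfolding G_def by (intro continuous_on_powr' continuous_intros) (use p in auto)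
  have "cmod (v0 + s * v1) = cmod (of_real (cmod v0) + (u * s) * of_real (cmod v1))" for s
  proof -
    have "al v0 * cnj (al v0) = 1" using complex_norm_square[of "al v0"] al by simp
    then have "v0 + s * v1 = al v0 * (of_real (cmod v0) + (u * s) * of_real (cmod v1))"
      using al(2)[of v0] al(2)[of v1] unfolding u_def
      by (metis (no_types, opaque_lifting) distrib_left mult.assoc mult.commute mult.left_commute mult_1)
    then show ?thesis by (simp add: norm_mult al)
  qed
  then have "phase_mean p 1 1 0 v0 v1 v2 = circ_avg (\<lambda>s. G (u * s))"
    by (simp add: phase_mean_def G_def)
  also have "\<dots> = circ_avg G" by (rule circ_avg_rotate[OF G u])
  also have "\<dots> = circ_avg (\<lambda>s. (((cmod v0)\<^sup>2 + (cmod v1)\<^sup>2) + 2 * cmod v0 * cmod v1 * Re s) powr (p/2))"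
  proof (rule circ_avg_cong)
    fix s :: complex assume s: "cmod s = 1"
    have "(Re s)\<^sup>2 + (Im s)\<^sup>2 = 1" using s cmod_power2[of s] by simp
    moreover have "(cmod (of_real x + s * of_real y))\<^sup>2 = x\<^sup>2 + 2 * x * y * Re s + y\<^sup>2 * ((Re s)\<^sup>2 + (Im s)\<^sup>2)" for x y
      unfolding cmod_power2 by (simp add: algebra_simps power2_eq_square)
    ultimately show "G s = (((cmod v0)\<^sup>2 + (cmod v1)\<^sup>2) + 2 * cmod v0 * cmod v1 * Re s) powr (p/2)"
      unfolding G_def norm_powr_eq_square_powr[of _ p] by (simp add: algebra_simps)
  qed
  finally show ?thesis .
qed

lemma phase_mean_two_pos:
  assumes p: "p > 0"
  shows "phase_mean p 1 1 0 1 1 1 > 0"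
proof -
  have "circ_avg (\<lambda>s. 0) < circ_avg (\<lambda>s. cmod (1 * 1 + 1 * s * 1 + 0 * s\<^sup>2 * 1) powr p)"
  proof (rule circ_avg_less[where ?z0.0 = 1])
    show "continuous_on (sphere 0 1) (\<lambda>s. cmod (1 * 1 + 1 * s * 1 + 0 * s\<^sup>2 * 1) powr p)"
      by (intro continuous_on_powr' continuous_intros) (use p in auto)
  qed (use p in auto)
  then show ?thesis by (simp add: phase_mean_def)
qed

text \<open>Write \<open>S = |v\<^sub>0|\<^sup>2 + |v\<^sub>1|\<^sup>2\<close>. Pairing the angle \<open>s\<close> with \<open>-s\<close>, the mean is extremal, for given \<open>S\<close>, if the
  mixed term \<open>2 |v\<^sub>0| |v\<^sub>1|\<close> has its largest value \<open>S\<close>. The extremal value \<open>c (S/2)\<^bsup>p/2\<^esup>\<close> is then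
  compared with the power mean \<open>c (|v\<^sub>0|\<^sup>p + |v\<^sub>1|\<^sup>p) / 2\<close>, with equality only for equal moduli.\<close>

lemma phase_mean_two_ge:
  assumes p: "0 < p" "p \<noteq> 2"
  defines "\<sigma> \<equiv> sgn (2 - p)" and "c \<equiv> phase_mean p 1 1 0 1 1 1"
  shows "\<sigma> * (c / 2 * (cmod v0 powr p + cmod v1 powr p)) \<le> \<sigma> * phase_mean p 1 1 0 v0 v1 v2"
    and "\<sigma> * phase_mean p 1 1 0 v0 v1 v2 = \<sigma> * (c / 2 * (cmod v0 powr p + cmod v1 powr p)) \<Longrightarrow> cmod v0 = cmod v1"
proof -
  define q where "q = p / 2"
  have q: "0 < q" "q \<noteq> 1" and \<sigma>: "\<sigma> = sgn (1 - q)"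
    using p by (auto simp: q_def \<sigma>_def sgn_if)
  define x where "x = cmod v0"
  define y where "y = cmod v1"
  define S where "S = x\<^sup>2 + y\<^sup>2"
  have xy: "x \<ge> 0" "y \<ge> 0" "S \<ge> 0" "2 * x * y \<le> S"
    using sum_squares_bound[of x y] by (auto simp: x_def y_def S_def)
  define F where "F = (\<lambda>B s. (S + B * Re s) powr q)"
  have re: "\<bar>Re s\<bar> \<le> 1" if "cmod s = 1" for s using abs_Re_le_cmod[of s] that by simp
  have bd: "\<bar>B * Re s\<bar> \<le> S" if "cmod s = 1" "0 \<le> B" "B \<le> S" for B s
    using re[OF that(1)] mult_left_mono[of "\<bar>Re s\<bar>" 1 B] that by (simp add: abs_mult)
  have F: "continuous_on (sphere 0 1) (F B)" if "0 \<le> B" "B \<le> S" for B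
    unfolding F_def using bd[OF _ that] q
    by (intro continuous_on_powr' continuous_intros) (force simp: abs_le_iff)+
  have F': "continuous_on (sphere 0 1) (\<lambda>s. F B (- s))" if "0 \<le> B" "B \<le> S" for B
    by (rule continuous_on_compose2[OF F[OF that]]) (auto intro!: continuous_intros)
  have "circ_avg (\<lambda>s. \<sigma> * (F S s + F S (- s))) \<le> circ_avg (\<lambda>s. \<sigma> * (F (2*x*y) s + F (2*x*y) (- s)))"
  proof (intro circ_avg_mono continuous_intros F F')
    fix s :: complex assume s: "cmod s = 1"
    have "sgn (1 - q) * ((S + S * Re s) powr q + (S - S * Re s) powr q)
       \<le> sgn (1 - q) * ((S + 2*x*y * Re s) powr q + (S - 2*x*y * Re s) powr q)"
      using xy bd[OF s, of S] by (intro powr_pair_abs_le q) (auto simp: abs_mult intro!: mult_right_mono)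
    then show "\<sigma> * (F S s + F S (- s)) \<le> \<sigma> * (F (2*x*y) s + F (2*x*y) (- s))"
      by (simp add: F_def \<sigma>)
  qed (use xy in auto)
  then have 1: "\<sigma> * circ_avg (F S) \<le> \<sigma> * circ_avg (F (2*x*y))"
    using circ_avg_symmetrize[OF F, of S, symmetric] circ_avg_symmetrize[OF F, of "2*x*y", symmetric] xy
    by (simp add: circ_avg_cmult mult.left_commute[of \<sigma> 2])
  have 2: "circ_avg (F (2*x*y)) = phase_mean p 1 1 0 v0 v1 v2"
    unfolding phase_mean_two_moduli[OF p(1)] by (simp add: F_def S_def x_def y_def q_def)
  have 3: "circ_avg (F S) = (S / 2) powr q * c"
  proof -
    have "c = circ_avg (\<lambda>s. (2 + 2 * Re s) powr q)"
      unfolding c_def phase_mean_two_moduli[OF p(1)] by (simp add: q_def)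
    moreover have "circ_avg (F S) = circ_avg (\<lambda>s. (S / 2) powr q * (2 + 2 * Re s) powr q)"
      by (simp add: F_def powr_mult[symmetric] algebra_simps)
    ultimately show ?thesis by (simp add: circ_avg_cmult)
  qed
  have c: "c > 0" unfolding c_def by (rule phase_mean_two_pos[OF p(1)])
  have ex: "(S/2 + (x\<^sup>2 - y\<^sup>2) / 2) powr q = x powr p" "(S/2 - (x\<^sup>2 - y\<^sup>2) / 2) powr q = y powr p"
    using norm_powr_eq_square_powr[of v0 p] norm_powr_eq_square_powr[of v1 p]
    by (simp_all add: S_def x_def y_def q_def field_simps)
  have bds: "\<bar>(x\<^sup>2 - y\<^sup>2) / 2\<bar> \<le> S / 2" by (auto simp: S_def abs_le_iff)
  have 4: "\<sigma> * ((x powr p + y powr p) / 2) \<le> \<sigma> * (S / 2) powr q"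
    using powr_pair_abs_le[OF q, of 0 "(x\<^sup>2 - y\<^sup>2) / 2" "S / 2"] bds ex by (simp add: \<sigma>)
  have 5: "\<sigma> * ((x powr p + y powr p) / 2) < \<sigma> * (S / 2) powr q" if "x \<noteq> y"
  proof -
    have "\<bar>(x\<^sup>2 - y\<^sup>2) / 2\<bar> > 0" using that xy by (simp add: power2_eq_iff_nonneg)
    moreover have "(S/2 + \<bar>(x\<^sup>2 - y\<^sup>2) / 2\<bar>) powr q + (S/2 - \<bar>(x\<^sup>2 - y\<^sup>2) / 2\<bar>) powr q = x powr p + y powr p"
    proof -
      have "(A + \<bar>t\<bar>) powr q + (A - \<bar>t\<bar>) powr q = (A + t) powr q + (A - t) powr q" for A t :: real
        by (cases "t \<ge> 0") auto
      from this[of "S / 2" "(x\<^sup>2 - y\<^sup>2) / 2"] show ?thesis unfolding ex .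
    qed
    ultimately show ?thesis
      using powr_pair_less[OF q, of 0 "\<bar>(x\<^sup>2 - y\<^sup>2) / 2\<bar>" "S / 2"] bds by (simp add: \<sigma>)
  qed
  have 6: "\<sigma> * ((S / 2) powr q * c) \<le> \<sigma> * phase_mean p 1 1 0 v0 v1 v2"
    using 1 2 3 by simp
  show "\<sigma> * (c / 2 * (cmod v0 powr p + cmod v1 powr p)) \<le> \<sigma> * phase_mean p 1 1 0 v0 v1 v2"
    using mult_right_mono[OF 4, of c] c 6 by (simp add: x_def y_def algebra_simps)
  show "cmod v0 = cmod v1"
    if "\<sigma> * phase_mean p 1 1 0 v0 v1 v2 = \<sigma> * (c / 2 * (cmod v0 powr p + cmod v1 powr p))"
  proof (rule ccontr)
    assume "cmod v0 \<noteq> cmod v1"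
    then have "x \<noteq> y" by (simp add: x_def y_def)
    then have "\<sigma> * ((x powr p + y powr p) / 2) * c < \<sigma> * (S / 2) powr q * c"
      by (intro mult_strict_right_mono 5 c)
    then show False using 6 that by (simp add: x_def y_def algebra_simps)
  qed
qed

text \<open>Factoring out a unimodular number turns \<open>v\<^sub>0 + s v\<^sub>1 + s\<^sup>2 v\<^sub>2\<close> into \<open>2 Re s + \<eta>\<close>, where \<open>\<eta>\<^sup>2\<close>
  measures the deviation from a geometric progression.\<close>

lemma phase_mean_three_unimodular:
  assumes p: "0 < p" and v: "cmod v0 = 1" "cmod v1 = 1" "cmod v2 = 1"
  obtains \<eta> where "cmod \<eta> = 1" "\<eta>\<^sup>2 * (v0 * v2) = v1\<^sup>2"
    "phase_mean p 1 1 1 v0 v1 v2 = circ_avg (\<lambda>s. ((4 * (Re s)\<^sup>2 + 1) + 4 * Re s * Re \<eta>) powr (p/2))"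
proof -
  define g where "g = csqrt (v2 / v0)"
  have g2: "g\<^sup>2 = v2 / v0" by (simp add: g_def)
  have "(cmod g)\<^sup>2 = 1" using arg_cong[OF g2, of cmod] v by (simp add: norm_power norm_divide)
  then have g: "cmod g = 1" using norm_ge_zero[of g] by (auto simp: power2_eq_1_iff simp del: norm_ge_zero)
  define \<eta> where "\<eta> = v1 / (v0 * g)"
  have nz: "v0 \<noteq> 0" "g \<noteq> 0" using v g by auto
  have \<eta>: "cmod \<eta> = 1" using v g by (simp add: \<eta>_def norm_divide norm_mult)
  have \<eta>2: "\<eta>\<^sup>2 * (v0 * v2) = v1\<^sup>2"
  proof -
    have "v2 = v0 * g\<^sup>2" using g2 nz by simp
    then show ?thesis using nz by (simp add: \<eta>_def field_simps power2_eq_square)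
  qed
  define G where "G = (\<lambda>s. cmod (1 + s * \<eta> + s\<^sup>2) powr p)"
  have G: "continuous_on (sphere 0 1) G"
    unfolding G_def by (intro continuous_on_powr' continuous_intros) (use p in auto)
  have "cmod (v0 + s * v1 + s\<^sup>2 * v2) = cmod (1 + (g * s) * \<eta> + (g * s)\<^sup>2)" for s
  proof -
    have "v0 + s * v1 + s\<^sup>2 * v2 = v0 * (1 + (g * s) * \<eta> + (g * s)\<^sup>2)"
      using nz by (simp add: \<eta>_def power_mult_distrib g2 field_simps)
    then show ?thesis using v by (simp add: norm_mult)
  qed
  then have "phase_mean p 1 1 1 v0 v1 v2 = circ_avg (\<lambda>s. G (g * s))"
    by (simp add: phase_mean_def G_def)
  also have "\<dots> = circ_avg G" by (rule circ_avg_rotate[OF G g])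
  also have "\<dots> = circ_avg (\<lambda>s. ((4 * (Re s)\<^sup>2 + 1) + 4 * Re s * Re \<eta>) powr (p/2))"
  proof (rule circ_avg_cong)
    fix s :: complex assume s: "cmod s = 1"
    have ss: "s * cnj s = 1" using complex_norm_square[of s] s by simp
    have "1 + s * \<eta> + s\<^sup>2 = s * cnj s + s * \<eta> + s\<^sup>2" by (simp add: ss)
    also have "\<dots> = s * ((s + cnj s) + \<eta>)" by (simp add: algebra_simps power2_eq_square)
    also have "s + cnj s = of_real (2 * Re s)" by (rule complex_add_cnj)
    finally have "cmod (1 + s * \<eta> + s\<^sup>2) = cmod (of_real (2 * Re s) + \<eta>)" using s by (simp add: norm_mult)
    moreover have "(Re \<eta>)\<^sup>2 + (Im \<eta>)\<^sup>2 = 1" using \<eta> cmod_power2[of \<eta>] by simp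
    moreover have "(cmod (of_real (2 * Re s) + \<eta>))\<^sup>2
        = (2 * Re s)\<^sup>2 + 2 * (2 * Re s) * Re \<eta> + ((Re \<eta>)\<^sup>2 + (Im \<eta>)\<^sup>2)"
      unfolding cmod_power2 by (simp add: algebra_simps power2_eq_square)
    ultimately have "(cmod (1 + s * \<eta> + s\<^sup>2))\<^sup>2 = (4 * (Re s)\<^sup>2 + 1) + 4 * Re s * Re \<eta>"
      by (simp add: power_mult_distrib)
    then show "G s = ((4 * (Re s)\<^sup>2 + 1) + 4 * Re s * Re \<eta>) powr (p/2)"
      unfolding G_def norm_powr_eq_square_powr[of _ p] by (rule arg_cong)
  qed
  finally show ?thesis using that \<eta> \<eta>2 by blast
qed

text \<open>The terms for \<open>s\<close> and \<open>-s\<close> form a pair around \<open>4 (Re s)\<^sup>2 + 1\<close> with the deviation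
  \<open>4 |Re s Re \<eta>|\<close>, so that the extremal case is \<open>\<eta> = \<plusminus>1\<close>.\<close>

lemma phase_mean_three_unimodular_ge:
  assumes p: "0 < p" "p \<noteq> 2" and v: "cmod v0 = 1" "cmod v1 = 1" "cmod v2 = 1"
  defines "\<sigma> \<equiv> sgn (2 - p)" and "c \<equiv> phase_mean p 1 1 1 1 1 1"
  shows "\<sigma> * c \<le> \<sigma> * phase_mean p 1 1 1 v0 v1 v2"
    and "\<sigma> * phase_mean p 1 1 1 v0 v1 v2 = \<sigma> * c \<Longrightarrow> v0 * v2 = v1\<^sup>2"
proof -
  define q where "q = p / 2"
  have q: "0 < q" "q \<noteq> 1" and \<sigma>: "\<sigma> = sgn (1 - q)"
    using p by (auto simp: q_def \<sigma>_def sgn_if)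
  define F where "F = (\<lambda>x s. ((4 * (Re s)\<^sup>2 + 1) + 4 * Re s * x) powr q)"
  have bd0: "4 * \<bar>t\<bar> \<le> 4 * t\<^sup>2 + 1" for t :: real
    using zero_le_power2[of "2 * \<bar>t\<bar> - 1"] by (simp add: power2_eq_square algebra_simps flip: abs_mult)
  have bd: "\<bar>4 * Re s * x\<bar> \<le> 4 * (Re s)\<^sup>2 + 1" if "\<bar>x\<bar> \<le> 1" for x s
    using bd0[of "Re s"] mult_left_mono[OF that, of "4 * \<bar>Re s\<bar>"] by (simp add: abs_mult)
  have F: "continuous_on (sphere 0 1) (F x)" if "\<bar>x\<bar> \<le> 1" for x
  proof -
    have "0 \<le> 4 * (Re s)\<^sup>2 + 1 + 4 * Re s * x" for s using bd[OF that, of s] by linarith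
    then show ?thesis
      unfolding F_def by (intro continuous_on_powr' continuous_intros) (use q in auto)
  qed
  have F': "continuous_on (sphere 0 1) (\<lambda>s. F x (- s))" if "\<bar>x\<bar> \<le> 1" for x
    by (rule continuous_on_compose2[OF F[OF that]]) (auto intro!: continuous_intros)
  have sym: "2 * (\<sigma> * circ_avg (F x)) = circ_avg (\<lambda>s. \<sigma> * (F x s + F x (- s)))" if "\<bar>x\<bar> \<le> 1" for x
    using circ_avg_symmetrize[OF F[OF that]] by (simp add: circ_avg_cmult)
  obtain \<eta> where \<eta>': "cmod \<eta> = 1" "\<eta>\<^sup>2 * (v0 * v2) = v1\<^sup>2"
      "phase_mean p 1 1 1 v0 v1 v2 = circ_avg (\<lambda>s. ((4 * (Re s)\<^sup>2 + 1) + 4 * Re s * Re \<eta>) powr (p/2))"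
    by (rule phase_mean_three_unimodular[OF p(1) v])
  have \<eta>: "cmod \<eta> = 1" "\<eta>\<^sup>2 * (v0 * v2) = v1\<^sup>2" "phase_mean p 1 1 1 v0 v1 v2 = circ_avg (F (Re \<eta>))"
    using \<eta>' unfolding F_def q_def by auto
  have c: "c = circ_avg (F 1)"
  proof -
    obtain \<theta> where \<theta>: "cmod \<theta> = 1" "\<theta>\<^sup>2 * (1 * 1) = 1\<^sup>2"
        "phase_mean p 1 1 1 1 1 1 = circ_avg (\<lambda>s. ((4 * (Re s)\<^sup>2 + 1) + 4 * Re s * Re \<theta>) powr (p/2))"
      by (rule phase_mean_three_unimodular[OF p(1) norm_one norm_one norm_one])
    have \<theta>': "c = circ_avg (F (Re \<theta>))" unfolding c_def \<theta>(3) F_def q_def ..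
    have "\<theta> = 1 \<or> \<theta> = -1" using \<theta>(2) by (simp add: power2_eq_1_iff)
    moreover have "circ_avg (F (-1)) = circ_avg (F 1)"
      using circ_avg_rotate[OF F, of 1 "-1"] by (simp add: F_def)
    ultimately show ?thesis using \<theta>' by auto
  qed
  have x: "\<bar>Re \<eta>\<bar> \<le> 1" using abs_Re_le_cmod[of \<eta>] \<eta> by simp
  have le: "\<sigma> * (F 1 s + F 1 (- s)) \<le> \<sigma> * (F (Re \<eta>) s + F (Re \<eta>) (- s))" for s
  proof -
    have "sgn (1 - q) * ((4 * (Re s)\<^sup>2 + 1 + 4 * Re s * 1) powr q + (4 * (Re s)\<^sup>2 + 1 - 4 * Re s * 1) powr q)
       \<le> sgn (1 - q) * ((4 * (Re s)\<^sup>2 + 1 + 4 * Re s * Re \<eta>) powr q + (4 * (Re s)\<^sup>2 + 1 - 4 * Re s * Re \<eta>) powr q)"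
      using x bd[of 1 s] by (intro powr_pair_abs_le q) (auto simp: abs_mult mult_left_le)
    then show ?thesis by (simp add: F_def \<sigma>)
  qed
  have "2 * (\<sigma> * c) \<le> 2 * (\<sigma> * phase_mean p 1 1 1 v0 v1 v2)"
    unfolding c \<eta>(3) sym[OF x] sym[of 1, simplified]
    using x by (intro circ_avg_mono continuous_intros F F' le) auto
  then show "\<sigma> * c \<le> \<sigma> * phase_mean p 1 1 1 v0 v1 v2" by simp
  show "v0 * v2 = v1\<^sup>2" if eq: "\<sigma> * phase_mean p 1 1 1 v0 v1 v2 = \<sigma> * c"
  proof -
    have "\<bar>Re \<eta>\<bar> = 1"
    proof (rule ccontr)
      assume "\<bar>Re \<eta>\<bar> \<noteq> 1"
      then have x': "\<bar>Re \<eta>\<bar> < 1" using x by simp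
      have "sgn (1 - q) * ((5 + 4) powr q + (5 - 4) powr q)
         < sgn (1 - q) * ((5 + 4 * \<bar>Re \<eta>\<bar>) powr q + (5 - 4 * \<bar>Re \<eta>\<bar>) powr q)"
        by (rule powr_pair_less[OF q]) (use x' in auto)
      then have "\<sigma> * (F 1 1 + F 1 (- 1)) < \<sigma> * (F (Re \<eta>) 1 + F (Re \<eta>) (- 1))"
        by (cases "Re \<eta> \<ge> 0") (auto simp: F_def \<sigma> add.commute)
      then have "2 * (\<sigma> * c) < 2 * (\<sigma> * phase_mean p 1 1 1 v0 v1 v2)"
        unfolding c \<eta>(3) sym[OF x] sym[of 1, simplified]
        using x by (intro circ_avg_less[where ?z0.0 = 1] continuous_intros F F' le) auto
      then show False using eq by simp
    qed
    then have "(Re \<eta>)\<^sup>2 = 1" by (metis power2_abs one_power2)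
    moreover have "(Re \<eta>)\<^sup>2 + (Im \<eta>)\<^sup>2 = 1" using \<eta>(1) cmod_power2[of \<eta>] by simp
    ultimately have "\<eta>\<^sup>2 = 1" by (simp add: complex_eq_iff power2_eq_square)
    then show ?thesis using \<eta>(2) by simp
  qed
qed

text \<open>A function that is positive on the zero set of \<open>k\<close> becomes positive everywhere after adding a large
  multiple of \<open>k\<close>.\<close>

lemma compact_penalty:
  fixes h k :: "'a::topological_space \<Rightarrow> real"
  assumes S: "compact S" and h: "continuous_on S h" and k: "continuous_on S k"
    and k0: "\<And>x. x \<in> S \<Longrightarrow> k x \<ge> 0" and pos: "\<And>x. x \<in> S \<Longrightarrow> k x = 0 \<Longrightarrow> h x > 0"
  obtains N where "N \<ge> 0" "\<And>x. x \<in> S \<Longrightarrow> h x + N * k x > 0"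
proof (cases "\<exists>x\<in>S. h x \<le> 0")
  case False
  then show ?thesis using that[of 0] by force
next
  case True
  define C where "C = S \<inter> h -` {..0}"
  have "closedin (top_of_set S) C"
    unfolding C_def by (rule continuous_closedin_preimage[OF h]) simp
  then have C: "compact C" "C \<noteq> {}" "C \<subseteq> S"
    using S True by (auto simp: C_def intro: closedin_compact)
  obtain x1 where x1: "x1 \<in> C" "\<And>x. x \<in> C \<Longrightarrow> k x1 \<le> k x"
    using continuous_attains_inf[OF C(1,2) continuous_on_subset[OF k C(3)]] by blast
  obtain x2 where x2: "x2 \<in> C" "\<And>x. x \<in> C \<Longrightarrow> h x2 \<le> h x"
    using continuous_attains_inf[OF C(1,2) continuous_on_subset[OF h C(3)]] by blast
  have k1: "k x1 > 0" using x1(1) k0[of x1] pos[of x1] by (force simp: C_def)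
  have h2: "h x2 \<le> 0" using x2(1) by (simp add: C_def)
  define N where "N = (1 - h x2) / k x1"
  have N: "N \<ge> 0" using k1 h2 by (simp add: N_def)
  have "h x + N * k x > 0" if "x \<in> S" for x
  proof (cases "x \<in> C")
    case True
    have "1 - h x2 = N * k x1" using k1 by (simp add: N_def)
    also have "\<dots> \<le> N * k x" using x1(2)[OF True] N by (rule mult_left_mono)
    finally show ?thesis using x2(2)[OF True] by simp
  next
    case False
    then have "h x > 0" using that by (simp add: C_def)
    moreover have "N * k x \<ge> 0" using N k0[OF that] by simp
    ultimately show ?thesis by simp
  qed
  then show ?thesis using that N by blast
qed

section \<open>The three-term identity for isometries\<close>

text \<open>A quantitative form of the equality cases. By homogeneity and compactness, the deviation from
  \<open>v\<^sub>0 v\<^sub>2 = v\<^sub>1\<^sup>2\<close> is controlled by quantities whose circle means are determined by norms, up to a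
  small multiple of the \<open>p\<close>-th powers. The penalty argument is used twice: the inequality for phases only
  holds on triples of equal moduli, so the terms that compare moduli have to be added with a much larger
  factor. The sign \<open>sgn (2 - p)\<close> is absorbed in \<open>A\<close> and \<open>B\<close>.\<close>

lemma phase_mean_coercive:
  fixes p \<epsilon> :: real
  assumes p: "0 < p" "p \<noteq> 2" and \<epsilon>: "\<epsilon> > 0"
  defines "\<sigma> \<equiv> sgn (2 - p)" and "c2 \<equiv> phase_mean p 1 1 0 1 1 1" and "c3 \<equiv> phase_mean p 1 1 1 1 1 1"
  obtains A B where "\<And>v0 v1 v2. cmod (v0 * v2 - v1\<^sup>2) powr (p/2)
     \<le> \<epsilon> * (cmod v0 powr p + cmod v1 powr p + cmod v2 powr p)
       + A * (phase_mean p 1 1 1 v0 v1 v2 - c3 * cmod v0 powr p)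
       + B * (phase_mean p 1 1 0 v0 v1 v2 - c2 / 2 * (cmod v0 powr p + cmod v1 powr p))
       + B * (phase_mean p 0 1 1 v0 v1 v2 - c2 / 2 * (cmod v1 powr p + cmod v2 powr p))"
proof -
  define n where "n = (\<lambda>v :: complex \<times> complex \<times> complex. cmod (fst v) powr p + cmod (fst (snd v)) powr p + cmod (snd (snd v)) powr p)"
  define d where "d = (\<lambda>v :: complex \<times> complex \<times> complex. cmod (fst v * snd (snd v) - (fst (snd v))\<^sup>2) powr (p/2))"
  define k2 where "k2 = (\<lambda>v0 v1. \<sigma> * (phase_mean p 1 1 0 v0 v1 0 - c2 / 2 * (cmod v0 powr p + cmod v1 powr p)))"
  define K where "K = (\<lambda>v. k2 (fst v) (fst (snd v)) + k2 (fst (snd v)) (snd (snd v)))"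
  define k3 where "k3 = (\<lambda>v. \<sigma> * (phase_mean p 1 1 1 (fst v) (fst (snd v)) (snd (snd v)) - c3 * cmod (fst v) powr p))"
  define S where "S = {v. n v = 1}"
  have cn: "continuous_on A n" for A
    unfolding n_def by (intro continuous_intros continuous_on_powr') (use p in auto)
  have cd: "continuous_on A d" for A
    unfolding d_def by (intro continuous_intros continuous_on_powr') (use p in auto)
  have cK: "continuous_on A K" for A
    unfolding K_def k2_def by (intro continuous_intros continuous_on_powr' phase_mean_continuous) (use p in auto)
  have ck3: "continuous_on A k3" for A
    unfolding k3_def by (intro continuous_intros continuous_on_powr' phase_mean_continuous) (use p in auto)
  have k20: "k2 v0 v1 \<ge> 0" "k2 v0 v1 = 0 \<Longrightarrow> cmod v0 = cmod v1" for v0 v1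
    using phase_mean_two_ge[OF p, where ?v0.0 = v0 and ?v1.0 = v1 and ?v2.0 = 0]
    by (auto simp: k2_def \<sigma>_def c2_def right_diff_distrib)
  have K0: "K v \<ge> 0" for v using k20 by (simp add: K_def)
  have Kz: "cmod (fst (snd v)) = cmod (fst v)" "cmod (snd (snd v)) = cmod (fst v)" if "K v = 0" for v
  proof -
    have "k2 (fst v) (fst (snd v)) = 0" "k2 (fst (snd v)) (snd (snd v)) = 0"
      using that k20(1)[of "fst v" "fst (snd v)"] k20(1)[of "fst (snd v)" "snd (snd v)"] by (simp_all add: K_def)
    from this[THEN k20(2)] show "cmod (fst (snd v)) = cmod (fst v)" "cmod (snd (snd v)) = cmod (fst v)" by simp_all
  qed
  have isn: "isCont n v" and isK: "isCont K v" for v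
    using cn[of UNIV] cK[of UNIV] by (simp_all add: continuous_on_eq_continuous_at del: split_paired_All)
  have compS: "compact S"
  proof (rule compact_eq_bounded_closed[THEN iffD2], intro conjI)
    have "S = n -` {1}" by (auto simp: S_def)
    then show "closed S"
      using isn by (simp add: continuous_closed_vimage)
    have "norm v \<le> 3" if "v \<in> S" for v
    proof -
      have "cmod x \<le> 1" if "cmod x powr p \<le> 1" for x
      proof (rule ccontr)
        assume "\<not> cmod x \<le> 1"
        then have "1 < cmod x powr p" using p by (intro gr_one_powr) auto
        then show False using that by simp
      qed
      moreover have "cmod (fst v) powr p \<le> 1" "cmod (fst (snd v)) powr p \<le> 1" "cmod (snd (snd v)) powr p \<le> 1"
        using that powr_ge_zero[of "cmod (fst v)" p] powr_ge_zero[of "cmod (fst (snd v))" p]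
          powr_ge_zero[of "cmod (snd (snd v))" p] unfolding S_def n_def mem_Collect_eq by linarith+
      ultimately have "cmod (fst v) \<le> 1" "cmod (fst (snd v)) \<le> 1" "cmod (snd (snd v)) \<le> 1" by auto
      moreover have "norm v \<le> cmod (fst v) + (cmod (fst (snd v)) + cmod (snd (snd v)))"
        using norm_Pair_le[of "fst v" "snd v"] norm_Pair_le[of "fst (snd v)" "snd (snd v)"] by simp
      ultimately show ?thesis by linarith
    qed
    then show "bounded S" unfolding bounded_iff by blast
  qed
  have k3: "k3 v \<ge> 0" "k3 v = 0 \<Longrightarrow> d v = 0" if v: "v \<in> S" "K v = 0" for v
  proof -
    define x where "x = cmod (fst v)"
    have "x > 0"
    proof (rule ccontr)
      assume "\<not> x > 0"
      then have "n v = 0" using Kz[OF v(2)] by (simp add: n_def x_def)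
      then show False using v by (simp add: S_def)
    qed
    define w0 where "w0 = fst v / of_real x"
    define w1 where "w1 = fst (snd v) / of_real x"
    define w2 where "w2 = snd (snd v) / of_real x"
    have w: "cmod w0 = 1" "cmod w1 = 1" "cmod w2 = 1"
      using Kz[OF v(2)] \<open>x > 0\<close> by (simp_all add: w0_def w1_def w2_def norm_divide x_def)
    have vw: "fst v = of_real x * w0" "fst (snd v) = of_real x * w1" "snd (snd v) = of_real x * w2"
      using \<open>x > 0\<close> by (simp_all add: w0_def w1_def w2_def)
    have k3x: "k3 v = x powr p * (\<sigma> * phase_mean p 1 1 1 w0 w1 w2 - \<sigma> * c3)"
    proof -
      have "phase_mean p 1 1 1 (of_real x * w0) (of_real x * w1) (of_real x * w2) = x powr p * phase_mean p 1 1 1 w0 w1 w2"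
        using \<open>x > 0\<close> by (intro phase_mean_scale) simp
      then show ?thesis unfolding k3_def vw using \<open>x > 0\<close> by (simp add: norm_mult w right_diff_distrib)
    qed
    note ge = phase_mean_three_unimodular_ge[OF p w, folded \<sigma>_def c3_def]
    show "k3 v \<ge> 0" using ge(1) by (simp add: k3x)
    show "d v = 0" if "k3 v = 0"
    proof -
      have "w0 * w2 = w1\<^sup>2" using that \<open>x > 0\<close> by (intro ge(2)) (simp add: k3x)
      then have "fst v * snd (snd v) = (fst (snd v))\<^sup>2"
        unfolding vw by (simp add: power2_eq_square algebra_simps)
      then show ?thesis by (simp add: d_def)
    qed
  qed
  define Z where "Z = S \<inter> K -` {0}"
  have compZ: "compact Z"
    unfolding Z_def
    by (intro compact_Int_closed compS continuous_closed_vimage isK) simp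
  obtain A where A: "A \<ge> 0" "\<And>v. v \<in> Z \<Longrightarrow> \<epsilon> - d v + A * k3 v > 0"
    by (rule compact_penalty[OF compZ, of "\<lambda>v. \<epsilon> - d v" k3])
       (use k3 \<epsilon> in \<open>auto simp: Z_def intro!: continuous_intros cd ck3\<close>)
  obtain B where B: "B \<ge> 0" "\<And>v. v \<in> S \<Longrightarrow> \<epsilon> - d v + A * k3 v + B * K v > 0"
    by (rule compact_penalty[OF compS, of "\<lambda>v. \<epsilon> - d v + A * k3 v" K])
       (use K0 A in \<open>auto simp: Z_def intro!: continuous_intros cd ck3 cK\<close>)
  have main: "d v \<le> \<epsilon> * n v + A * k3 v + B * K v" for v
  proof (cases "n v = 0")
    case True
    then have "cmod (fst v) powr p = 0" "cmod (fst (snd v)) powr p = 0" "cmod (snd (snd v)) powr p = 0"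
      using powr_ge_zero[of "cmod (fst v)" p] powr_ge_zero[of "cmod (fst (snd v))" p]
        powr_ge_zero[of "cmod (snd (snd v))" p] unfolding n_def by linarith+
    then have "fst v = 0" "fst (snd v) = 0" "snd (snd v) = 0" by auto
    then show ?thesis using phase_mean_scale[of 0 p] True
      by (simp add: d_def k3_def K_def k2_def)
  next
    case False
    have "n v \<ge> 0" by (simp add: n_def)
    then have nv: "n v > 0" using False by simp
    define x where "x = n v powr (1/p)"
    have x: "x > 0" "x powr p = n v" using nv p by (simp_all add: x_def powr_powr)
    define w where "w = (fst v / of_real x, fst (snd v) / of_real x, snd (snd v) / of_real x)"
    have vw: "fst v = of_real x * fst w" "fst (snd v) = of_real x * fst (snd w)" "snd (snd v) = of_real x * snd (snd w)"
      using x by (simp_all add: w_def)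
    have "n v = x powr p * n w" using x by (simp add: n_def vw norm_mult powr_mult algebra_simps)
    then have wS: "w \<in> S" using x nv by (simp add: S_def)
    have "d v = x powr p * d w"
    proof -
      have "fst v * snd (snd v) - (fst (snd v))\<^sup>2 = of_real (x\<^sup>2) * (fst w * snd (snd w) - (fst (snd w))\<^sup>2)"
        unfolding vw by (simp add: power2_eq_square algebra_simps)
      moreover have "(x\<^sup>2) powr (p/2) = x powr p" using x by (simp add: powr_powr flip: powr_numeral)
      ultimately show ?thesis using x by (simp add: d_def norm_mult powr_mult norm_power)
    qed
    moreover have "k3 v = x powr p * k3 w"
    proof -
      have "phase_mean p 1 1 1 (of_real x * fst w) (of_real x * fst (snd w)) (of_real x * snd (snd w))
          = x powr p * phase_mean p 1 1 1 (fst w) (fst (snd w)) (snd (snd w))"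
        using x by (intro phase_mean_scale) simp
      then show ?thesis unfolding k3_def vw using x by (simp add: norm_mult powr_mult right_diff_distrib)
    qed
    moreover have "k2 (of_real x * a) (of_real x * b) = x powr p * k2 a b" for a b
      using x phase_mean_scale[of x p 1 1 0 a b 0] by (simp add: k2_def norm_mult powr_mult algebra_simps)
    then have "K v = x powr p * K w" by (simp only: K_def vw distrib_left)
    moreover have "x powr p * d w \<le> x powr p * (\<epsilon> + A * k3 w + B * K w)"
      using B(2)[OF wS] by (intro mult_left_mono) auto
    ultimately show ?thesis using x by (simp add: algebra_simps)
  qed
  show ?thesis
  proof (rule that[of "A * \<sigma>" "B * \<sigma>"])
    fix v0 v1 v2
    have "phase_mean p 1 1 0 v0 v1 v2 = phase_mean p 1 1 0 v0 v1 0" by (simp add: phase_mean_def)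
    moreover have "phase_mean p 0 1 1 v0 v1 v2 = phase_mean p 1 1 0 v1 v2 0"
      unfolding phase_mean_shift by (simp add: phase_mean_def)
    ultimately show "cmod (v0 * v2 - v1\<^sup>2) powr (p/2)
     \<le> \<epsilon> * (cmod v0 powr p + cmod v1 powr p + cmod v2 powr p)
       + (A * \<sigma>) * (phase_mean p 1 1 1 v0 v1 v2 - c3 * cmod v0 powr p)
       + (B * \<sigma>) * (phase_mean p 1 1 0 v0 v1 v2 - c2 / 2 * (cmod v0 powr p + cmod v1 powr p))
       + (B * \<sigma>) * (phase_mean p 0 1 1 v0 v1 v2 - c2 / 2 * (cmod v1 powr p + cmod v2 powr p))"
      using main[of "(v0, v1, v2)"] by (simp add: d_def n_def k3_def K_def k2_def algebra_simps)
  qed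
qed

text \<open>These map into the space: for limits of surjective isometries, surjectivity is what has to be shown.\<close>

definition hardy_isometries :: "real \<Rightarrow> operator set" where
  "hardy_isometries p = {T \<in> linear_operators p. \<forall>f\<in>hardy_space p. hardy_norm p (T f) = hardy_norm p f}"

lemma hardy_isometriesD:
  assumes "T \<in> hardy_isometries p" "f \<in> hardy_space p"
  shows "T f \<in> hardy_space p" "T (\<lambda>z. c * f z) = (\<lambda>z. c * T f z)" "hardy_norm p (T f) = hardy_norm p f"
    and "g \<in> hardy_space p \<Longrightarrow> T (\<lambda>z. f z + g z) = (\<lambda>z. T f z + T g z)"
  using assms by (auto simp: hardy_isometries_def linear_operators_def)

lemma hardy_mult_bounded:
  assumes f: "f \<in> hardy_space p" and p: "0 < p" and m: "m holomorphic_on ball 0 1"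
    and C: "\<And>z. cmod z < 1 \<Longrightarrow> cmod (m z) \<le> C"
  shows "(\<lambda>z. m z * f z) \<in> hardy_space p" "hardy_pow p (\<lambda>z. m z * f z) \<le> C powr p * hardy_pow p f"
proof -
  have hol: "f holomorphic_on ball 0 1" and z: "\<And>z. z \<notin> ball 0 1 \<Longrightarrow> f z = 0"
    using f by (auto simp: hardy_space_def)
  have C0: "C \<ge> 0" using C[of 0] order_trans[OF norm_ge_zero] by auto
  have "circle_mean p (\<lambda>z. m z * f z) r \<le> C powr p * hardy_pow p f" if r: "0 \<le> r" "r < 1" for r
  proof -
    note cont = continuous_on_sphere_powr[OF _ r p]
    have "circle_mean p (\<lambda>z. m z * f z) r \<le> circ_avg (\<lambda>z. C powr p * cmod (f (of_real r * z)) powr p)"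
      unfolding circle_mean_eq_circ_avg
    proof (intro circ_avg_mono cont continuous_intros holomorphic_intros m hol)
      fix z :: complex assume "cmod z = 1"
      then have "cmod (m (of_real r * z)) powr p \<le> C powr p"
        using r p by (intro powr_mono2 C) (auto simp: norm_mult)
      then show "cmod (m (of_real r * z) * f (of_real r * z)) powr p \<le> C powr p * cmod (f (of_real r * z)) powr p"
        by (simp add: norm_mult powr_mult mult_right_mono)
    qed
    also have "\<dots> = C powr p * circle_mean p f r" by (simp add: circ_avg_cmult circle_mean_eq_circ_avg)
    also have "\<dots> \<le> C powr p * hardy_pow p f"
      using circle_mean_le_hardy_norm[OF f p r] by (intro mult_left_mono) auto
    finally show ?thesis .
  qed
  from hardy_spaceI_pow[OF _ _ p order_refl zero_less_one this]
  show "(\<lambda>z. m z * f z) \<in> hardy_space p" "hardy_pow p (\<lambda>z. m z * f z) \<le> C powr p * hardy_pow p f"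
    using z by (auto intro!: holomorphic_intros m hol)
qed

lemma hardy_cmult:
  assumes "f \<in> hardy_space p" "0 < p"
  shows "(\<lambda>z. c * f z) \<in> hardy_space p"
  using hardy_mult_bounded(1)[OF assms, of "\<lambda>_. c" "cmod c"] by (simp add: holomorphic_on_const)

lemma hardy_isometry_diff:
  assumes T: "T \<in> hardy_isometries p" and p: "0 < p" and f: "f \<in> hardy_space p" and g: "g \<in> hardy_space p"
  shows "T (\<lambda>z. f z - g z) = (\<lambda>z. T f z - T g z)"
  using hardy_isometriesD(4)[OF T f hardy_cmult[OF g p, of "-1"]] hardy_isometriesD(2)[OF T g, of "-1"]
  by simp

lemma hardy_power_mult:
  assumes "f \<in> hardy_space p" "0 < p"
  shows "(\<lambda>z. z ^ k * f z) \<in> hardy_space p"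
proof (rule hardy_mult_bounded(1)[OF assms, of "\<lambda>z. z ^ k" 1])
  show "cmod (z ^ k) \<le> 1" if "cmod z < 1" for z
    using that by (simp add: norm_power power_le_one)
qed (intro holomorphic_intros)

lemma circle_mean_power_mult:
  assumes "0 \<le> r"
  shows "circle_mean p (\<lambda>z. z ^ k * f z) r = (r ^ k) powr p * circle_mean p f r"
proof -
  have "circle_mean p (\<lambda>z. z ^ k * f z) r = circ_avg (\<lambda>z. (r ^ k) powr p * cmod (f (of_real r * z)) powr p)"
    unfolding circle_mean_eq_circ_avg
    by (rule circ_avg_cong) (use assms in \<open>simp add: norm_mult norm_power powr_mult\<close>)
  then show ?thesis by (simp add: circ_avg_cmult circle_mean_eq_circ_avg)
qed

lemma radii_exist:
  obtains r :: "nat \<Rightarrow> real" where "\<And>n. 0 \<le> r n" "\<And>n. r n < 1" "r \<longlonglongrightarrow> 1"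
proof (rule that[of "\<lambda>n. 1 - 1 / real (Suc n)"])
  show "(\<lambda>n. 1 - 1 / real (Suc n)) \<longlonglongrightarrow> 1"
    using tendsto_diff[OF tendsto_const LIMSEQ_inverse_real_of_nat, of "1::real"] by (simp add: inverse_eq_divide)
qed (auto simp: field_simps)

lemma hardy_pow_power_mult:
  assumes f: "f \<in> hardy_space p" and p: "0 < p"
  shows "hardy_pow p (\<lambda>z. z ^ k * f z) = hardy_pow p f"
proof -
  obtain r :: "nat \<Rightarrow> real" where r: "\<And>n. 0 \<le> r n" "\<And>n. r n < 1" "r \<longlonglongrightarrow> 1"
    using radii_exist by blast
  have "(\<lambda>n. (r n ^ k) powr p * circle_mean p f (r n)) \<longlonglongrightarrow> (1 ^ k) powr p * hardy_pow p f"
    by (intro tendsto_intros r circle_mean_tendsto_hardy_pow f p) auto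
  then have "(\<lambda>n. circle_mean p (\<lambda>z. z ^ k * f z) (r n)) \<longlonglongrightarrow> hardy_pow p f"
    by (simp add: circle_mean_power_mult r(1))
  then show ?thesis
    using circle_mean_tendsto_hardy_pow[OF hardy_power_mult[OF f p] p r] LIMSEQ_unique by blast
qed

lemma circle_mean_phase:
  assumes hol: "k0 holomorphic_on ball 0 1" "k1 holomorphic_on ball 0 1" "k2 holomorphic_on ball 0 1"
    and r: "0 \<le> r" "r < 1" and p: "0 < p"
  shows "continuous_on (sphere 0 1) (\<lambda>s. circle_mean p (\<lambda>z. a0 * k0 z + a1 * s * k1 z + a2 * s\<^sup>2 * k2 z) r)"
    and "circ_avg (\<lambda>s. circle_mean p (\<lambda>z. a0 * k0 z + a1 * s * k1 z + a2 * s\<^sup>2 * k2 z) r)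
       = circ_avg (\<lambda>z. phase_mean p a0 a1 a2 (k0 (of_real r * z)) (k1 (of_real r * z)) (k2 (of_real r * z)))"
proof -
  have k: "continuous_on (sphere 0 1 \<times> sphere 0 1) (\<lambda>y::complex \<times> complex. k (of_real r * snd y))"
    if "k holomorphic_on ball 0 1" for k
    by (rule continuous_on_compose2[OF holomorphic_on_imp_continuous_on[OF that]])
       (use r in \<open>auto intro!: continuous_intros simp: norm_mult\<close>)
  have c: "continuous_on (sphere 0 1 \<times> sphere 0 1) (\<lambda>(s, z). cmod (a0 * k0 (of_real r * z) +
        a1 * s * k1 (of_real r * z) + a2 * s\<^sup>2 * k2 (of_real r * z)) powr p)"
    unfolding split_def by (intro continuous_on_powr' continuous_intros k hol) (use p in auto)
  show "continuous_on (sphere 0 1) (\<lambda>s. circle_mean p (\<lambda>z. a0 * k0 z + a1 * s * k1 z + a2 * s\<^sup>2 * k2 z) r)"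
    unfolding circle_mean_eq_circ_avg by (rule circ_avg_continuous_param[OF c])
  show "circ_avg (\<lambda>s. circle_mean p (\<lambda>z. a0 * k0 z + a1 * s * k1 z + a2 * s\<^sup>2 * k2 z) r)
       = circ_avg (\<lambda>z. phase_mean p a0 a1 a2 (k0 (of_real r * z)) (k1 (of_real r * z)) (k2 (of_real r * z)))"
    unfolding circle_mean_eq_circ_avg phase_mean_def by (rule circ_avg_swap[OF c])
qed

text \<open>Let \<open>h\<^sub>s = a\<^sub>0 f + a\<^sub>1 s z f + a\<^sub>2 s\<^sup>2 z\<^sup>2 f\<close>. By Fubini the integral of the phase average is the average
  over \<open>s\<close> of the circle means of \<open>T h\<^sub>s\<close>, and likewise with \<open>h\<^sub>s\<close> for the triple \<open>(f, z f, z\<^sup>2 f)\<close>. For every \<open>s\<close> these have the same limit since \<open>T\<close> is isometric,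
  and dominated convergence applies. For \<open>h\<^sub>s\<close> the phase average at radius \<open>r\<close> is constant along the circle, apart
  from the factor \<open>|f|\<^sup>p\<close>.\<close>

lemma isometry_phase_mean_tendsto:
  fixes r :: "nat \<Rightarrow> real"
  assumes T: "T \<in> hardy_isometries p" and f: "f \<in> hardy_space p" and p: "0 < p"
    and r: "\<And>n. 0 \<le> r n" "\<And>n. r n < 1" "r \<longlonglongrightarrow> 1"
  defines "g \<equiv> \<lambda>k. T (\<lambda>z. z ^ k * f z)"
  shows "(\<lambda>n. circ_avg (\<lambda>z. phase_mean p a0 a1 a2 (g 0 (of_real (r n) * z)) (g 1 (of_real (r n) * z)) (g 2 (of_real (r n) * z))))
     \<longlonglongrightarrow> phase_mean p a0 a1 a2 1 1 1 * hardy_pow p f"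
proof -
  note lin = hardy_isometriesD(1-3)[OF T] and add = hardy_isometriesD(4)[OF T]
  define F where "F = (\<lambda>k z. z ^ k * f z)"
  have F: "F k \<in> hardy_space p" for k unfolding F_def by (rule hardy_power_mult[OF f p])
  have G: "g k \<in> hardy_space p" for k unfolding g_def by (rule lin(1)[OF F[unfolded F_def]])
  have holF: "F k holomorphic_on ball 0 1" and holG: "g k holomorphic_on ball 0 1" for k
    using F G by (auto simp: hardy_space_def)
  define H :: "(nat \<Rightarrow> complex \<Rightarrow> complex) \<Rightarrow> complex \<Rightarrow> complex \<Rightarrow> complex"
    where "H = (\<lambda>k s z. a0 * k 0 z + a1 * s * k 1 z + a2 * s\<^sup>2 * k 2 z)"
  have HF: "H F s \<in> hardy_space p" for s
    unfolding H_def by (intro hardy_add hardy_cmult F p)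
  have HT: "T (H F s) = H g s" for s
    unfolding H_def g_def
    by (subst add, (intro hardy_add hardy_cmult F p)+, subst add, (intro hardy_add hardy_cmult F p)+)
       (simp only: lin(2)[OF F], simp only: F_def)
  have HG: "H g s \<in> hardy_space p" for s using lin(1)[OF HF, of s] by (simp add: HT)
  have pow: "hardy_pow p (H g s) = hardy_pow p (H F s)" for s
    using lin(3)[OF HF, of s] by (simp add: HT)
  define C where "C = (cmod a0 + cmod a1 + cmod a2) powr p * hardy_pow p f"
  have bd: "hardy_pow p (H F s) \<le> C" if s: "cmod s = 1" for s
  proof -
    have "H F s = (\<lambda>z. (a0 + a1 * s * z + a2 * s\<^sup>2 * z\<^sup>2) * f z)"
      by (rule ext) (simp add: H_def F_def algebra_simps)
    moreover have "hardy_pow p (\<lambda>z. (a0 + a1 * s * z + a2 * s\<^sup>2 * z\<^sup>2) * f z) \<le> C"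
      unfolding C_def
    proof (rule hardy_mult_bounded(2)[OF f p])
      fix z :: complex assume z: "cmod z < 1"
      have "cmod (a0 + a1 * s * z + a2 * s\<^sup>2 * z\<^sup>2) \<le> cmod a0 + cmod (a1 * s * z) + cmod (a2 * s\<^sup>2 * z\<^sup>2)"
        by (metis (no_types, lifting) add_mono_thms_linordered_semiring(3) norm_triangle_le norm_triangle_ineq)
      also have "\<dots> \<le> cmod a0 + cmod a1 + cmod a2"
        using s z by (intro add_mono) (auto simp: norm_mult norm_power intro!: mult_left_le power_le_one)
      finally show "cmod (a0 + a1 * s * z + a2 * s\<^sup>2 * z\<^sup>2) \<le> cmod a0 + cmod a1 + cmod a2" .
    qed (intro holomorphic_intros)
    ultimately show ?thesis by simp
  qed
  define D where "D = (\<lambda>n s. circle_mean p (H g s) (r n) - circle_mean p (H F s) (r n))"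
  note contG = circle_mean_phase(1)[OF holG[of 0] holG[of 1] holG[of 2] r(1,2) p, of a0 a1 a2]
  note contF = circle_mean_phase(1)[OF holF[of 0] holF[of 1] holF[of 2] r(1,2) p, of a0 a1 a2]
  have "(\<lambda>n. circ_avg (D n)) \<longlonglongrightarrow> 0"
  proof (rule circ_avg_dominated_convergence_0[where C = C])
    show "continuous_on (sphere 0 1) (D n)" for n
      unfolding D_def H_def by (intro continuous_intros contG contF)
    fix s :: complex assume s: "cmod s = 1"
    show "\<bar>D n s\<bar> \<le> C" for n
      using circle_mean_le_hardy_norm[OF HG[of s] p r(1,2), of n] circle_mean_le_hardy_norm[OF HF[of s] p r(1,2), of n]
        circle_mean_nonneg[of p "H g s" "r n"] circle_mean_nonneg[of p "H F s" "r n"] bd[OF s] pow[of s]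
      unfolding D_def by linarith
    show "(\<lambda>n. D n s) \<longlonglongrightarrow> 0"
      using tendsto_diff[OF circle_mean_tendsto_hardy_pow[OF HG[of s] p r] circle_mean_tendsto_hardy_pow[OF HF[of s] p r]]
      by (simp add: D_def pow)
  qed
  moreover have "circ_avg (D n) = circ_avg (\<lambda>z. phase_mean p a0 a1 a2 (g 0 (of_real (r n) * z)) (g 1 (of_real (r n) * z)) (g 2 (of_real (r n) * z)))
      - phase_mean p a0 a1 a2 1 (of_real (r n)) (of_real ((r n)\<^sup>2)) * circle_mean p f (r n)" for n
  proof -
    have "phase_mean p a0 a1 a2 (F 0 (of_real (r n) * z)) (F 1 (of_real (r n) * z)) (F 2 (of_real (r n) * z))
        = phase_mean p a0 a1 a2 1 (of_real (r n)) (of_real ((r n)\<^sup>2)) * cmod (f (of_real (r n) * z)) powr p"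
      if z: "cmod z = 1" for z
    proof -
      define x where "x = f (of_real (r n) * z)"
      define Q where "Q = (\<lambda>s. cmod (a0 * 1 + a1 * s * of_real (r n) + a2 * s\<^sup>2 * of_real ((r n)\<^sup>2)) powr p)"
      have Q: "continuous_on (sphere 0 1) Q"
        unfolding Q_def by (intro continuous_on_powr' continuous_intros) (use p in auto)
      have "phase_mean p a0 a1 a2 (F 0 (of_real (r n) * z)) (F 1 (of_real (r n) * z)) (F 2 (of_real (r n) * z))
         = circ_avg (\<lambda>s. cmod x powr p * Q (z * s))"
        unfolding phase_mean_def
      proof (rule circ_avg_cong)
        fix s
        have "a0 * F 0 (of_real (r n) * z) + a1 * s * F 1 (of_real (r n) * z) + a2 * s\<^sup>2 * F 2 (of_real (r n) * z)
          = x * (a0 * 1 + a1 * (z * s) * of_real (r n) + a2 * (z * s)\<^sup>2 * of_real ((r n)\<^sup>2))"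
          by (simp add: F_def x_def power2_eq_square algebra_simps)
        then show "cmod (a0 * F 0 (of_real (r n) * z) + a1 * s * F 1 (of_real (r n) * z) + a2 * s\<^sup>2 * F 2 (of_real (r n) * z)) powr p
          = cmod x powr p * Q (z * s)"
          by (simp only: Q_def norm_mult powr_mult)
      qed
      also have "\<dots> = cmod x powr p * circ_avg Q"
        by (simp add: circ_avg_cmult circ_avg_rotate[OF Q z])
      finally show ?thesis by (simp add: Q_def phase_mean_def x_def)
    qed
    then have "circ_avg (\<lambda>z. phase_mean p a0 a1 a2 (F 0 (of_real (r n) * z)) (F 1 (of_real (r n) * z)) (F 2 (of_real (r n) * z)))
        = circ_avg (\<lambda>z. phase_mean p a0 a1 a2 1 (of_real (r n)) (of_real ((r n)\<^sup>2)) * cmod (f (of_real (r n) * z)) powr p)"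
      by (rule circ_avg_cong)
    then have "circ_avg (\<lambda>s. circle_mean p (H F s) (r n))
        = phase_mean p a0 a1 a2 1 (of_real (r n)) (of_real ((r n)\<^sup>2)) * circle_mean p f (r n)"
      unfolding H_def circle_mean_phase(2)[OF holF[of 0] holF[of 1] holF[of 2] r(1,2) p]
      by (simp add: circ_avg_cmult circle_mean_eq_circ_avg)
    moreover have "circ_avg (D n) = circ_avg (\<lambda>s. circle_mean p (H g s) (r n)) - circ_avg (\<lambda>s. circle_mean p (H F s) (r n))"
      unfolding D_def H_def by (rule circ_avg_diff[OF contG contF])
    ultimately show ?thesis
      unfolding H_def circle_mean_phase(2)[OF holG[of 0] holG[of 1] holG[of 2] r(1,2) p] by simp
  qed
  moreover have "(\<lambda>n. phase_mean p a0 a1 a2 1 (of_real (r n)) (of_real ((r n)\<^sup>2)) * circle_mean p f (r n))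
     \<longlonglongrightarrow> phase_mean p a0 a1 a2 1 (of_real 1) (of_real (1\<^sup>2)) * hardy_pow p f"
  proof (intro tendsto_mult circle_mean_tendsto_hardy_pow f p r)
    have "continuous_on UNIV (\<lambda>x::real. phase_mean p a0 a1 a2 1 (of_real x) (of_real (x\<^sup>2)))"
      by (intro phase_mean_continuous p continuous_intros)
    from continuous_on_tendsto_compose[OF this r(3)]
    show "(\<lambda>n. phase_mean p a0 a1 a2 1 (of_real (r n)) (of_real ((r n)\<^sup>2)))
       \<longlonglongrightarrow> phase_mean p a0 a1 a2 1 (of_real 1) (of_real (1\<^sup>2))" by simp
  qed
  ultimately show ?thesis
    using tendsto_add[of "\<lambda>n. circ_avg (D n)" 0 sequentially] by fastforce
qed

text \<open>In the limit \<open>r \<rightarrow> 1\<close> all terms of the coercivity estimate cancel except the one with \<open>\<epsilon>\<close>. Thus the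
  circle means of \<open>|D|\<^bsup>p/2\<^esup>\<close> become small near the boundary, where they are largest.\<close>

lemma isometry_multiplicative:
  assumes T: "T \<in> hardy_isometries p" and f: "f \<in> hardy_space p" and p: "0 < p" "p \<noteq> 2"
  shows "T f w * T (\<lambda>z. z\<^sup>2 * f z) w = (T (\<lambda>z. z * f z) w)\<^sup>2"
proof -
  note lin = hardy_isometriesD(1,3)[OF T]
  define g where "g = (\<lambda>k. T (\<lambda>z. z ^ k * f z))"
  have G: "g k \<in> hardy_space p" for k unfolding g_def by (intro lin hardy_power_mult f p)
  have powG: "hardy_pow p (g k) = hardy_pow p f" for k
    unfolding g_def lin(2)[OF hardy_power_mult[OF f p(1)]] by (rule hardy_pow_power_mult[OF f p(1)])
  have holG: "g k holomorphic_on ball 0 1" for k using G by (auto simp: hardy_space_def)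
  define D where "D = (\<lambda>z. g 0 z * g 2 z - (g 1 z)\<^sup>2)"
  have holD: "D holomorphic_on ball 0 1" unfolding D_def by (intro holomorphic_intros holG)
  obtain r :: "nat \<Rightarrow> real" where r: "\<And>n. 0 \<le> r n" "\<And>n. r n < 1" "r \<longlonglongrightarrow> 1"
    using radii_exist by blast
  have small: "circle_mean (p/2) D R \<le> 3 * \<epsilon> * hardy_pow p f" if R: "0 \<le> R" "R < 1" and \<epsilon>: "\<epsilon> > 0" for R \<epsilon>
  proof -
    define c2 where "c2 = phase_mean p 1 1 0 1 1 1"
    define c3 where "c3 = phase_mean p 1 1 1 1 1 1"
    obtain A B where AB: "\<And>v0 v1 v2. cmod (v0 * v2 - v1\<^sup>2) powr (p/2)
     \<le> \<epsilon> * (cmod v0 powr p + cmod v1 powr p + cmod v2 powr p)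
       + A * (phase_mean p 1 1 1 v0 v1 v2 - c3 * cmod v0 powr p)
       + B * (phase_mean p 1 1 0 v0 v1 v2 - c2 / 2 * (cmod v0 powr p + cmod v1 powr p))
       + B * (phase_mean p 0 1 1 v0 v1 v2 - c2 / 2 * (cmod v1 powr p + cmod v2 powr p))"
      using phase_mean_coercive[OF p \<epsilon>] unfolding c2_def c3_def by blast
    define m where "m = (\<lambda>k n. circle_mean p (g k) (r n))"
    define P where "P = (\<lambda>a0 a1 a2 n. circ_avg (\<lambda>z. phase_mean p a0 a1 a2 (g 0 (of_real (r n) * z)) (g 1 (of_real (r n) * z)) (g 2 (of_real (r n) * z))))"
    have le: "circle_mean (p/2) D (r n) \<le> \<epsilon> * (m 0 n + m 1 n + m 2 n) + A * (P 1 1 1 n - c3 * m 0 n)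
        + B * (P 1 1 0 n - c2 / 2 * (m 0 n + m 1 n)) + B * (P 0 1 1 n - c2 / 2 * (m 1 n + m 2 n))" for n
    proof -
      have ck: "continuous_on (sphere 0 1) (\<lambda>z. g k (of_real (r n) * z))" for k
        by (rule continuous_on_compose2[OF holomorphic_on_imp_continuous_on[OF holG]])
           (use r in \<open>auto intro!: continuous_intros simp: norm_mult\<close>)
      have cm: "continuous_on (sphere 0 1) (\<lambda>z. cmod (g k (of_real (r n) * z)) powr p)" for k
        by (intro continuous_on_powr' continuous_intros ck) (use p in auto)
      have cP: "continuous_on (sphere 0 1) (\<lambda>z. phase_mean p a0 a1 a2 (g 0 (of_real (r n) * z)) (g 1 (of_real (r n) * z)) (g 2 (of_real (r n) * z)))" for a0 a1 a2
        by (intro phase_mean_continuous p ck)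
      have cD: "continuous_on (sphere 0 1) (\<lambda>z. cmod (D (of_real (r n) * z)) powr (p/2))"
        unfolding D_def by (intro continuous_on_powr' continuous_intros ck) (use p in auto)
      define G where "G = (\<lambda>k z. g k (of_real (r n) * z))"
      define Q where "Q = (\<lambda>a0 a1 a2 z. phase_mean p a0 a1 a2 (G 0 z) (G 1 z) (G 2 z))"
      have cG: "continuous_on (sphere 0 1) (\<lambda>z. cmod (G k z) powr p)" for k
        unfolding G_def by (rule cm)
      have cQ: "continuous_on (sphere 0 1) (Q a0 a1 a2)" for a0 a1 a2
        unfolding Q_def G_def by (rule cP)
      have "circle_mean (p/2) D (r n) \<le> circ_avg (\<lambda>z.
          \<epsilon> * (cmod (G 0 z) powr p + cmod (G 1 z) powr p + cmod (G 2 z) powr p)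
          + A * (Q 1 1 1 z - c3 * cmod (G 0 z) powr p)
          + B * (Q 1 1 0 z - c2 / 2 * (cmod (G 0 z) powr p + cmod (G 1 z) powr p))
          + B * (Q 0 1 1 z - c2 / 2 * (cmod (G 1 z) powr p + cmod (G 2 z) powr p)))"
        unfolding circle_mean_eq_circ_avg
        by (intro circ_avg_mono cD continuous_on_add continuous_on_diff continuous_on_mult continuous_on_const
            cG cQ) (unfold D_def Q_def G_def, rule AB)
      also have "\<dots> = \<epsilon> * (m 0 n + m 1 n + m 2 n) + A * (P 1 1 1 n - c3 * m 0 n)
        + B * (P 1 1 0 n - c2 / 2 * (m 0 n + m 1 n)) + B * (P 0 1 1 n - c2 / 2 * (m 1 n + m 2 n))"
        unfolding m_def P_def circle_mean_eq_circ_avg Q_def G_def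
        by (simp only: circ_avg_add circ_avg_diff circ_avg_cmult continuous_on_add continuous_on_diff
            continuous_on_mult continuous_on_const cm cP)
      finally show ?thesis .
    qed
    define N where "N = hardy_pow p f"
    have lm: "m k \<longlonglongrightarrow> N" for k
      using circle_mean_tendsto_hardy_pow[OF G[of k] p(1) r] unfolding powG N_def m_def .
    have lP: "P a0 a1 a2 \<longlonglongrightarrow> phase_mean p a0 a1 a2 1 1 1 * N" for a0 a1 a2
      using isometry_phase_mean_tendsto[OF T f p(1) r] unfolding g_def P_def N_def .
    have P3: "P 1 1 1 \<longlonglongrightarrow> c3 * N" using lP[of 1 1 1] unfolding c3_def .
    have P2: "P 1 1 0 \<longlonglongrightarrow> c2 * N" using lP[of 1 1 0] unfolding c2_def .
    have P2': "P 0 1 1 \<longlonglongrightarrow> c2 * N" using lP[of 0 1 1] unfolding phase_mean_shift c2_def .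
    have "(\<lambda>n. \<epsilon> * (m 0 n + m 1 n + m 2 n) + A * (P 1 1 1 n - c3 * m 0 n)
        + B * (P 1 1 0 n - c2 / 2 * (m 0 n + m 1 n)) + B * (P 0 1 1 n - c2 / 2 * (m 1 n + m 2 n)))
       \<longlonglongrightarrow> \<epsilon> * (N + N + N) + A * (c3 * N - c3 * N) + B * (c2 * N - c2 / 2 * (N + N)) + B * (c2 * N - c2 / 2 * (N + N))"
      by (intro tendsto_intros lm P3 P2 P2')
    moreover have "\<epsilon> * (N + N + N) + A * (c3 * N - c3 * N) + B * (c2 * N - c2 / 2 * (N + N)) + B * (c2 * N - c2 / 2 * (N + N)) = 3 * \<epsilon> * N"
      by (simp add: algebra_simps)
    ultimately have lim: "(\<lambda>n. \<epsilon> * (m 0 n + m 1 n + m 2 n) + A * (P 1 1 1 n - c3 * m 0 n)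
        + B * (P 1 1 0 n - c2 / 2 * (m 0 n + m 1 n)) + B * (P 0 1 1 n - c2 / 2 * (m 1 n + m 2 n)))
       \<longlonglongrightarrow> 3 * \<epsilon> * N" by (simp only:)
    have "\<forall>\<^sub>F n in sequentially. R < r n" by (rule order_tendstoD(1)[OF r(3) R(2)])
    then have "\<forall>\<^sub>F n in sequentially. circle_mean (p/2) D R \<le> \<epsilon> * (m 0 n + m 1 n + m 2 n) + A * (P 1 1 1 n - c3 * m 0 n)
        + B * (P 1 1 0 n - c2 / 2 * (m 0 n + m 1 n)) + B * (P 0 1 1 n - c2 / 2 * (m 1 n + m 2 n))"
    proof eventually_elim
      case (elim n)
      have "circle_mean (p/2) D R \<le> circle_mean (p/2) D (r n)"
        by (rule circle_mean_mono_disc[OF holD]) (use R r elim p in auto)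
      then show ?case using le[of n] by linarith
    qed
    then show ?thesis using tendsto_lowerbound[OF lim] unfolding N_def by simp
  qed
  show ?thesis
  proof (cases "cmod w < 1")
    case True
    define N where "N = hardy_pow p f"
    have N: "N \<ge> 0" by (simp add: N_def)
    have "circle_mean (p/2) D (cmod w) \<le> 0 + e" if e: "e > 0" for e
    proof -
      have "e / (3 * (N + 1)) > 0" using e N by (intro divide_pos_pos mult_pos_pos) auto
      then have "circle_mean (p/2) D (cmod w) \<le> 3 * (e / (3 * (N + 1))) * N"
        using small[of "cmod w" "e / (3 * (N + 1))"] True by (simp only: N_def[symmetric] norm_ge_zero simp_thms)
      also have "\<dots> \<le> e" using e N by (simp add: field_simps)
      finally show ?thesis by simp
    qed
    then have "circle_mean (p/2) D (cmod w) \<le> 0" by (rule field_le_epsilon)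
    then have z: "circ_avg (\<lambda>z. cmod (D (of_real (cmod w) * z)) powr (p/2)) = 0"
      using circle_mean_nonneg[of "p/2" D "cmod w"] by (simp add: circle_mean_eq_circ_avg)
    have cont: "continuous_on (sphere 0 1) (\<lambda>z. cmod (D (of_real (cmod w) * z)) powr (p/2))"
      by (rule continuous_on_sphere_powr[OF holD]) (use True p in auto)
    define u where "u = (if w = 0 then 1 else w / of_real (cmod w))"
    have u: "cmod u = 1" "w = of_real (cmod w) * u" by (auto simp: u_def norm_divide)
    have "cmod (D (of_real (cmod w) * u)) powr (p/2) = 0"
      by (rule circ_avg_eq_0_imp[OF cont _ z u(1)]) simp
    then have "D w = 0" using u(2) by simp
    then show ?thesis by (simp add: D_def g_def)
  next
    case False
    then have "g k w = 0" for k using G[of k] by (simp add: hardy_space_def)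
    from this[of 0] this[of 1] this[of 2] show ?thesis by (simp add: g_def)
  qed
qed

section \<open>Isometries are weighted compositions\<close>

lemma holomorphic_eventually_nonzero:
  assumes F: "F holomorphic_on S" "open S" "connected S" and b: "b \<in> S" "F b \<noteq> 0" and z: "z \<in> S"
  obtains r where "r > 0" "ball z r \<subseteq> S" "\<And>x. x \<in> ball z r - {z} \<Longrightarrow> F x \<noteq> 0"
proof (cases "F z = 0")
  case True
  then show ?thesis using isolated_zeros[OF F z _ b] that by blast
next
  case False
  have "isCont F z"
    using F(1,2) z holomorphic_on_imp_continuous_on continuous_on_eq_continuous_at by blast
  then obtain e1 where e1: "e1 > 0" "\<And>x. x \<in> ball z e1 \<Longrightarrow> F x \<noteq> 0"
    using continuous_at_avoid[of z F 0] False by (metis mem_ball)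
  obtain e2 where e2: "e2 > 0" "ball z e2 \<subseteq> S" using F(2) z openE by blast
  have "ball z (min e1 e2) \<subseteq> S" using e2(2) subset_ball[of "min e1 e2" e2 z] by auto
  then show ?thesis using that[of "min e1 e2"] e1 e2(1) by auto
qed

lemma holomorphic_eq_off_zeros:
  assumes F: "F holomorphic_on S" "open S" "connected S" and b: "b \<in> S" "F b \<noteq> 0"
    and u: "u holomorphic_on S" and v: "v holomorphic_on S"
    and eq: "\<And>z. z \<in> S \<Longrightarrow> F z \<noteq> 0 \<Longrightarrow> u z = v z" and z: "z \<in> S"
  shows "u z = v z"
proof -
  obtain r where r: "r > 0" "ball z r \<subseteq> S" "\<And>x. x \<in> ball z r - {z} \<Longrightarrow> F x \<noteq> 0"
    using holomorphic_eventually_nonzero[OF F b z] by blast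
  have "(u \<longlongrightarrow> u z) (at z)" "(v \<longlongrightarrow> v z) (at z)"
    using u v F(2) z holomorphic_on_imp_continuous_on continuous_on_eq_continuous_at isContD by metis+
  moreover have "eventually (\<lambda>x. v x = u x) (at z)"
    unfolding eventually_at
  proof (rule exI[of _ r], safe)
    fix x assume "x \<noteq> z" "dist x z < r"
    then have "x \<in> S" "F x \<noteq> 0" using r(2,3) by (auto simp: dist_commute)
    then show "v x = u x" by (simp add: eq)
  qed (rule r(1))
  ultimately have "(u \<longlongrightarrow> v z) (at z)" "(u \<longlongrightarrow> u z) (at z)"
    using Lim_transform_eventually by blast+
  then show ?thesis using LIM_unique by metis
qed

text \<open>The singularities of the quotient at the isolated zeros of \<open>F\<close> are removable as it is bounded by 1.\<close>

lemma holomorphic_bounded_quotient: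
  assumes F: "F holomorphic_on S" "open S" "connected S" and b: "b \<in> S" "F b \<noteq> 0"
    and g: "g holomorphic_on S" and le: "\<And>z. z \<in> S \<Longrightarrow> F z \<noteq> 0 \<Longrightarrow> cmod (g z) \<le> cmod (F z)"
  obtains \<phi> where "\<phi> holomorphic_on S" "\<And>z. z \<in> S \<Longrightarrow> g z = F z * \<phi> z" "\<And>z. z \<in> S \<Longrightarrow> cmod (\<phi> z) \<le> 1"
proof -
  define q where "q = (\<lambda>z. g z / F z)"
  define \<phi> where "\<phi> = (\<lambda>z. Lim (at z) q)"
  have loc: "\<exists>r h. r > 0 \<and> ball z r \<subseteq> S \<and> h holomorphic_on ball z r \<and> (\<forall>x\<in>ball z r. \<phi> x = h x) \<and>
      (\<forall>x\<in>ball z r - {z}. F x \<noteq> 0 \<and> h x = q x)" if z: "z \<in> S" for z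
  proof -
    obtain r where r: "r > 0" "ball z r \<subseteq> S" "\<And>x. x \<in> ball z r - {z} \<Longrightarrow> F x \<noteq> 0"
      using holomorphic_eventually_nonzero[OF F b z] by blast
    have qh: "q holomorphic_on ball z r - {z}"
      unfolding q_def by (intro holomorphic_intros holomorphic_on_subset[OF g] holomorphic_on_subset[OF F(1)])
        (use r in auto)
    have "eventually (\<lambda>x. cmod (q x) \<le> 1) (at z)"
      unfolding eventually_at
    proof (rule exI[of _ r], safe)
      fix x assume "x \<noteq> z" "dist x z < r"
      then have "x \<in> ball z r - {z}" by (auto simp: dist_commute)
      then show "cmod (q x) \<le> 1" using r(2,3) le[of x] by (auto simp: q_def norm_divide)
    qed (use r in auto)
    then obtain h where h: "h holomorphic_on ball z r" "\<And>x. x \<in> ball z r - {z} \<Longrightarrow> h x = q x"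
      using holomorphic_on_extend_bounded[OF qh] r(1) by auto
    have "\<phi> x = h x" if x: "x \<in> ball z r" for x
    proof -
      have "(h \<longlongrightarrow> h x) (at x)"
        using h(1) x holomorphic_on_imp_continuous_on continuous_on_eq_continuous_at isContD open_ball by metis
      moreover have "eventually (\<lambda>y. h y = q y) (at x)"
      proof -
        have "eventually (\<lambda>y. y \<in> ball z r) (at x)" using x by (intro eventually_at_in_open') auto
        moreover have "eventually (\<lambda>y. y \<noteq> z) (at x)"
          by (cases "x = z") (auto simp: eventually_at_filter intro: eventually_mono[OF t1_space_nhds])
        ultimately show ?thesis by eventually_elim (use h(2) in auto)
      qed
      ultimately have "(q \<longlongrightarrow> h x) (at x)" by (rule Lim_transform_eventually)
      then show ?thesis unfolding \<phi>_def by (intro tendsto_Lim) auto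
    qed
    then show ?thesis using r h by blast
  qed
  have hol: "\<phi> holomorphic_on S"
  proof (rule holomorphic_onI)
    fix z assume "z \<in> S"
    then obtain r h where rh: "r > 0" "h holomorphic_on ball z r" "\<forall>x\<in>ball z r. \<phi> x = h x" using loc by blast
    then have "\<phi> holomorphic_on ball z r" using holomorphic_transform[of h "ball z r" \<phi>] by simp
    then have "\<phi> field_differentiable at z" using rh(1) by (simp add: holomorphic_on_imp_differentiable_at)
    then show "\<phi> field_differentiable at z within S" by (rule field_differentiable_at_within)
  qed
  have eq: "g z = F z * \<phi> z" if "z \<in> S" for z
  proof (rule holomorphic_eq_off_zeros[OF F b g _ _ that])
    fix z assume z: "z \<in> S" "F z \<noteq> 0"
    have "isCont q z"
      using z F(2) unfolding q_def
      by (intro continuous_intros) (use g F holomorphic_on_imp_continuous_on continuous_on_eq_continuous_at in blast)+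
    then have "\<phi> z = q z" unfolding \<phi>_def by (intro tendsto_Lim) (auto simp: isCont_def)
    then show "g z = F z * \<phi> z" using z by (simp add: q_def)
  qed (intro holomorphic_intros F hol)
  have "cmod (\<phi> z) \<le> 1" if z: "z \<in> S" for z
  proof -
    obtain r h where rh: "r > 0" "ball z r \<subseteq> S" "\<forall>x\<in>ball z r - {z}. F x \<noteq> 0 \<and> h x = q x" using loc[OF z] by blast
    have "eventually (\<lambda>x. cmod (\<phi> x) \<le> 1) (at z)"
      unfolding eventually_at
    proof (rule exI[of _ r], safe)
      fix x assume "x \<noteq> z" "dist x z < r"
      then have x: "x \<in> S" "F x \<noteq> 0" using rh by (auto simp: dist_commute)
      then show "cmod (\<phi> x) \<le> 1" using le[OF x] eq[OF x(1)] by (simp add: norm_mult)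
    qed (use rh in auto)
    moreover have "((\<lambda>x. cmod (\<phi> x)) \<longlongrightarrow> cmod (\<phi> z)) (at z)"
      using hol F(2) z holomorphic_on_imp_continuous_on continuous_on_eq_continuous_at isContD tendsto_norm by metis
    ultimately show ?thesis using tendsto_upperbound at_neq_bot by blast
  qed
  then show ?thesis using that hol eq by blast
qed

definition disc_one :: "complex \<Rightarrow> complex" where
  "disc_one z = (if z \<in> ball 0 1 then 1 else 0)"

lemma disc_one_hardy:
  assumes p: "0 < p"
  shows "disc_one \<in> hardy_space p" "hardy_pow p disc_one = 1"
proof -
  have hol: "disc_one holomorphic_on ball 0 1"
    by (rule holomorphic_transform[of "\<lambda>_. 1"]) (auto simp: disc_one_def)
  have m: "circle_mean p disc_one r = 1" if "0 \<le> r" "r < 1" for r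
  proof -
    have "circle_mean p disc_one r = circ_avg (\<lambda>_. 1)"
      unfolding circle_mean_eq_circ_avg
      by (rule circ_avg_cong) (use that in \<open>simp add: disc_one_def norm_mult\<close>)
    then show ?thesis by simp
  qed
  show one: "disc_one \<in> hardy_space p"
    by (rule hardy_spaceI_pow(1)[OF hol _ p order_refl zero_less_one, of 1]) (auto simp: disc_one_def m)
  obtain r :: "nat \<Rightarrow> real" where r: "\<And>n. 0 \<le> r n" "\<And>n. r n < 1" "r \<longlonglongrightarrow> 1"
    using radii_exist by blast
  have "(\<lambda>n. 1) \<longlonglongrightarrow> hardy_pow p disc_one"
    using circle_mean_tendsto_hardy_pow[OF one p r] by (simp add: m[OF r(1,2)])
  from LIMSEQ_unique[OF this tendsto_const] show "hardy_pow p disc_one = 1" .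
qed

text \<open>The difference quotient is bounded by a multiple of \<open>f - f b\<close> on circles that stay away from \<open>b\<close>, and
  these suffice.\<close>

lemma hardy_divided_difference:
  assumes f: "f \<in> hardy_space p" and p: "0 < p" and b: "cmod b < 1"
  obtains k where "k \<in> hardy_space p" "f = (\<lambda>z. f b * disc_one z + (z * k z + (- b) * k z))"
proof -
  have holf: "f holomorphic_on ball 0 1" and f0: "\<And>z. z \<notin> ball 0 1 \<Longrightarrow> f z = 0"
    using f by (auto simp: hardy_space_def)
  define k where "k = (\<lambda>z. if z \<in> ball 0 1 then (if z = b then deriv f b else (f z - f b) / (z - b)) else 0)"
  have holk: "k holomorphic_on ball 0 1"
    by (rule holomorphic_transform[OF pole_lemma_open[OF holf open_ball, of b]]) (simp add: k_def)
  define h where "h = (\<lambda>z. f z + (- f b) * disc_one z)"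
  have h: "h \<in> hardy_space p" unfolding h_def by (intro hardy_add hardy_cmult f disc_one_hardy p)
  define d where "d = (1 - cmod b) / 2"
  have d: "d > 0" using b by (simp add: d_def)
  have "circle_mean p k r \<le> (1 / d) powr p * hardy_pow p h" if r: "(1 + cmod b) / 2 \<le> r" "r < 1" for r
  proof -
    have "0 \<le> (1 + cmod b) / 2" by simp
    then have r0: "0 \<le> r" using r(1) by (rule order_trans)
    note cont = continuous_on_sphere_powr[OF _ r0 r(2) p]
    have "circle_mean p k r \<le> circ_avg (\<lambda>z. (1 / d) powr p * cmod (h (of_real r * z)) powr p)"
      unfolding circle_mean_eq_circ_avg
    proof (intro circ_avg_mono cont holk continuous_intros)
      show "h holomorphic_on ball 0 1" using h by (simp add: hardy_space_def)
      fix z :: complex assume z: "cmod z = 1"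
      define x where "x = of_real r * z"
      have x: "cmod x = r" using z r0 by (simp add: x_def norm_mult)
      have xb: "cmod (x - b) \<ge> d" using norm_triangle_ineq2[of x b] x r by (simp add: d_def)
      have kx: "k x = h x / (x - b)" using x xb r d by (auto simp: k_def h_def disc_one_def)
      have "cmod (k x) \<le> 1 / d * cmod (h x)"
        using xb d by (simp add: kx norm_divide frac_le)
      then have "cmod (k x) powr p \<le> (1 / d * cmod (h x)) powr p" using p by (intro powr_mono2) auto
      then show "cmod (k (of_real r * z)) powr p \<le> (1 / d) powr p * cmod (h (of_real r * z)) powr p"
        using d by (simp only: x_def powr_mult)
    qed
    also have "\<dots> = (1 / d) powr p * circle_mean p h r" by (simp add: circ_avg_cmult circle_mean_eq_circ_avg)
    also have "\<dots> \<le> (1 / d) powr p * hardy_pow p h"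
      by (intro mult_left_mono circle_mean_le_hardy_norm h p r0 r) auto
    finally show ?thesis .
  qed
  then have "k \<in> hardy_space p"
    by (intro hardy_spaceI_pow(1)[OF holk _ p, of "(1 + cmod b) / 2"]) (use b in \<open>auto simp: k_def intro: add_nonneg_nonneg\<close>)
  moreover have "f z = f b * disc_one z + (z * k z + (- b) * k z)" for z
  proof (cases "z \<in> ball 0 1 \<and> z \<noteq> b")
    case True
    have "z * k z + (- b) * k z = (z - b) * k z" by (simp add: algebra_simps)
    also have "\<dots> = f z - f b" using True by (simp add: k_def)
    finally have "z * k z + (- b) * k z = f z - f b" .
    then show ?thesis using True by (simp add: disc_one_def)
  qed (use b f0 in \<open>auto simp: k_def disc_one_def\<close>)
  ultimately show ?thesis using that by blast
qed

text \<open>Point evaluation is bounded, so that a geometric progression of values of functions in the unit ball cannot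
  grow.\<close>

lemma hardy_geometric_values_bound:
  fixes h :: "nat \<Rightarrow> complex \<Rightarrow> complex"
  assumes p: "0 < p" and z: "cmod z < 1" and a: "a \<noteq> 0"
    and h: "\<And>k. h k \<in> hardy_space p" "\<And>k. hardy_pow p (h k) \<le> 1" "\<And>k. h k z = a * y ^ k"
  shows "cmod y \<le> 1"
proof (rule ccontr)
  assume "\<not> ?thesis"
  then have gt: "1 < cmod y" by simp
  define Y where "Y = cmod y powr p"
  define c where "c = cmod a powr p * (1 - (cmod z)\<^sup>2)"
  have Y: "1 < Y" unfolding Y_def using gt p by (intro gr_one_powr) auto
  have c: "c > 0" using z a by (simp add: c_def abs_square_less_1)
  have "c * Y ^ k \<le> 1" for k
  proof -
    have "cmod (h k z) powr p * (1 - (cmod z)\<^sup>2) \<le> 1"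
      using hardy_point_bound[OF h(1) p z, of k] h(2)[of k] by linarith
    moreover have "cmod (h k z) powr p = cmod a powr p * Y ^ k"
    proof -
      have "(x ^ k) powr p = (x powr p) ^ k" if "x \<ge> 0" for x :: real
        using that by (induction k) (auto simp: powr_mult)
      then show ?thesis by (simp add: h(3) Y_def norm_mult norm_power powr_mult)
    qed
    ultimately show ?thesis by (simp add: c_def mult_ac)
  qed
  moreover obtain k where "1 / c < Y ^ k" using real_arch_pow[OF Y] by blast
  ultimately show False using c by (metis divide_less_eq mult.commute not_le)
qed

text \<open>The three-term identity for \<open>z\<^sup>k\<close> gives \<open>T (z\<^sup>k) = T 1 \<cdot> \<phi>\<^sup>k\<close>, and boundedness of point
  evaluations then gives \<open>|\<phi>| \<le> 1\<close>. If \<open>|\<phi>|\<close> attained 1, \<open>\<phi>\<close> would be a constant \<open>c\<close> and \<open>T\<close>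
  would annihilate \<open>z - c\<close>.\<close>

theorem hardy_isometry_weighted_composition:
  assumes T: "T \<in> hardy_isometries p" and p: "0 < p" "p \<noteq> 2"
  obtains \<phi> where "\<phi> holomorphic_on ball 0 1" "\<And>z. cmod z < 1 \<Longrightarrow> cmod (\<phi> z) < 1"
    "\<And>f z. f \<in> hardy_space p \<Longrightarrow> cmod z < 1 \<Longrightarrow> T f z = T disc_one z * f (\<phi> z)"
proof -
  note TH = hardy_isometriesD(1)[OF T] and Tc = hardy_isometriesD(2)[OF T]
    and Tn = hardy_isometriesD(3)[OF T] and Ta = hardy_isometriesD(4)[OF T]
  have Tinj: "h = (\<lambda>_. 0)" if "h \<in> hardy_space p" "T h = (\<lambda>_. 0)" for h
    using hardy_norm_zero_iff[OF that(1) p(1)] hardy_norm_zero_iff[OF TH[OF that(1)] p(1)] Tn[OF that(1)] that(2) by simp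
  have holT: "T h holomorphic_on ball 0 1" if "h \<in> hardy_space p" for h
    using TH[OF that] by (simp add: hardy_space_def)
  note one = disc_one_hardy[OF p(1)]
  define F where "F = T disc_one"
  define g where "g = (\<lambda>k. T (\<lambda>z. z ^ k * disc_one z))"
  have hk: "(\<lambda>z. z ^ k * disc_one z) \<in> hardy_space p" for k by (rule hardy_power_mult[OF one(1) p(1)])
  have g0: "g 0 = F" by (simp add: g_def F_def)
  have F: "F holomorphic_on ball 0 1" unfolding F_def by (rule holT[OF one(1)])
  have "F \<noteq> (\<lambda>_. 0)"
  proof
    assume "F = (\<lambda>_. 0)"
    then have "disc_one = (\<lambda>_. 0)" using Tinj[OF one(1)] by (simp add: F_def)
    from fun_cong[OF this, of 0] show False by (simp add: disc_one_def)
  qed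
  then obtain b where b: "b \<in> ball 0 1" "F b \<noteq> 0"
    using TH[OF one(1)] by (auto simp: F_def hardy_space_def fun_eq_iff)
  note Fb = F open_ball connected_ball b
  have rec: "g k z * g (Suc (Suc k)) z = (g (Suc k) z)\<^sup>2" for k z
    using isometry_multiplicative[OF T hk p, of k z] by (simp add: g_def power2_eq_square mult.assoc)
  have gk: "g k z = F z * (g 1 z / F z) ^ k" if Fz: "F z \<noteq> 0" for k z
  proof (cases "g 1 z = 0")
    case True
    have "g (Suc k) z = 0" for k
    proof (induction k)
      case 0 then show ?case using True by simp
    next
      case (Suc k)
      then show ?case using rec[of "Suc k" z] by simp
    qed
    then show ?thesis using True g0 by (cases k) auto
  next
    case False
    have "g k z = F z * (g 1 z / F z) ^ k \<and> g (Suc k) z = F z * (g 1 z / F z) ^ Suc k"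
    proof (induction k)
      case (Suc k)
      define y where "y = g 1 z / F z"
      have y: "y \<noteq> 0" using False Fz by (simp add: y_def)
      have IH: "g k z = F z * y ^ k" "g (Suc k) z = F z * y ^ Suc k" using Suc unfolding y_def by blast+
      have "F z * y ^ k * g (Suc (Suc k)) z = (F z * y ^ Suc k)\<^sup>2" using rec[of k z] unfolding IH .
      also have "\<dots> = F z * y ^ k * (F z * y ^ Suc (Suc k))" by (simp add: power2_eq_square algebra_simps)
      finally have "F z * y ^ k * g (Suc (Suc k)) z = F z * y ^ k * (F z * y ^ Suc (Suc k))" .
      then have "g (Suc (Suc k)) z = F z * y ^ Suc (Suc k)"
        using Fz y by simp
      then show ?case using Suc by (simp add: y_def)
    qed (use Fz g0 in simp)
    then show ?thesis by blast
  qed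
  have le: "cmod (g 1 z) \<le> cmod (F z)" if z: "z \<in> ball 0 1" "F z \<noteq> 0" for z
  proof -
    have "cmod (g 1 z / F z) \<le> 1"
    proof (rule hardy_geometric_values_bound[OF p(1) _ z(2)])
      show "g k \<in> hardy_space p" for k unfolding g_def by (rule TH[OF hk])
      show "hardy_pow p (g k) \<le> 1" for k
        unfolding g_def Tn[OF hk] hardy_pow_power_mult[OF one(1) p(1)] by (simp add: one)
      show "g k z = F z * (g 1 z / F z) ^ k" for k by (rule gk[OF z(2)])
    qed (use z in simp)
    then show ?thesis using z by (simp add: norm_divide)
  qed
  have holg: "g k holomorphic_on ball 0 1" for k unfolding g_def by (rule holT[OF hk])
  obtain \<phi> where \<phi>: "\<phi> holomorphic_on ball 0 1" "\<And>z. z \<in> ball 0 1 \<Longrightarrow> g 1 z = F z * \<phi> z"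
      "\<And>z. z \<in> ball 0 1 \<Longrightarrow> cmod (\<phi> z) \<le> 1"
    using holomorphic_bounded_quotient[OF Fb holg[of 1] le] by blast
  have lt: "cmod (\<phi> z) < 1" if z: "cmod z < 1" for z
  proof (rule ccontr)
    assume "\<not> cmod (\<phi> z) < 1"
    then have z1: "cmod (\<phi> z) = 1" using \<phi>(3)[of z] z by auto
    have "\<phi> constant_on ball 0 1"
      by (rule maximum_modulus_principle[OF \<phi>(1), of "ball 0 1" z]) (use z z1 \<phi>(3) in auto)
    then obtain c where c: "\<And>z. z \<in> ball 0 1 \<Longrightarrow> \<phi> z = c" by (auto simp: constant_on_def)
    define h where "h = (\<lambda>z. z ^ 1 * disc_one z + (- c) * disc_one z)"
    have h: "h \<in> hardy_space p" unfolding h_def by (intro hardy_add hardy_cmult hk one p)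
    have "T h x = 0" for x
    proof (cases "x \<in> ball 0 1")
      case True
      have "T h x = g 1 x + (- c) * F x"
        unfolding h_def by (subst Ta[OF hk hardy_cmult[OF one(1) p(1)]]) (simp only: Tc[OF one(1)] g_def F_def)
      then show ?thesis using \<phi>(2)[OF True] c[OF True] by simp
    next
      case False
      then show ?thesis using TH[OF h] by (simp add: hardy_space_def)
    qed
    then have "T h = (\<lambda>_. 0)" by (rule ext)
    then have "h = (\<lambda>_. 0)" by (rule Tinj[OF h])
    then have "h 0 = 0" by simp
    then have "c = 0" by (simp add: h_def disc_one_def)
    then show False using z1 c[of z] z by simp
  qed
  \<comment> \<open>The three-term relations for \<open>1\<close>, \<open>f\<close> and \<open>1 + f\<close> force \<open>T (z f) = \<phi> T f\<close>.\<close>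
  have shift: "T (\<lambda>z. z * f z) z = \<phi> z * T f z" if f: "f \<in> hardy_space p" and z: "z \<in> ball 0 1" for f z
  proof (rule holomorphic_eq_off_zeros[OF Fb _ _ _ z])
    have f1: "(\<lambda>z. z * f z) \<in> hardy_space p" and f2: "(\<lambda>z. z\<^sup>2 * f z) \<in> hardy_space p"
      using hardy_power_mult[OF f p(1), of 1] hardy_power_mult[OF f p(1), of 2] by simp_all
    have o1: "(\<lambda>z. z * disc_one z) \<in> hardy_space p" using hk[of 1] by simp
    show "T (\<lambda>z. z * f z) holomorphic_on ball 0 1" by (rule holT[OF f1])
    show "(\<lambda>z. \<phi> z * T f z) holomorphic_on ball 0 1" by (intro holomorphic_intros \<phi> holT f)
    fix x assume x: "x \<in> ball 0 1" "F x \<noteq> 0"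
    define B where "B = T f x"
    define B1 where "B1 = T (\<lambda>z. z * f z) x"
    define B2 where "B2 = T (\<lambda>z. z\<^sup>2 * f z) x"
    have B: "B * B2 = B1\<^sup>2" unfolding B_def B1_def B2_def by (rule isometry_multiplicative[OF T f p])
    have g1: "g 1 x = F x * \<phi> x" using \<phi>(2)[OF x(1)] .
    then have g2: "g 2 x = F x * (\<phi> x)\<^sup>2" using gk[OF x(2), of 2] x(2) by simp
    define h where "h = (\<lambda>z. disc_one z + f z)"
    have h: "h \<in> hardy_space p" unfolding h_def by (intro hardy_add one f p)
    have "T h x = F x + B" unfolding h_def by (simp add: Ta[OF one(1) f] F_def B_def)
    moreover have "T (\<lambda>z. z * h z) x = F x * \<phi> x + B1"
    proof -
      have "(\<lambda>z. z * h z) = (\<lambda>z. z * disc_one z + z * f z)" by (simp add: h_def algebra_simps)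
      then have "T (\<lambda>z. z * h z) x = T (\<lambda>z. z * disc_one z) x + B1" using Ta[OF o1 f1] by (simp add: B1_def)
      then show ?thesis using g1 by (simp add: g_def)
    qed
    moreover have "T (\<lambda>z. z\<^sup>2 * h z) x = F x * (\<phi> x)\<^sup>2 + B2"
    proof -
      have "(\<lambda>z. z\<^sup>2 * h z) = (\<lambda>z. z\<^sup>2 * disc_one z + z\<^sup>2 * f z)" by (simp add: h_def algebra_simps)
      then have "T (\<lambda>z. z\<^sup>2 * h z) x = T (\<lambda>z. z\<^sup>2 * disc_one z) x + B2" using Ta[OF hk[of 2] f2] by (simp add: B2_def)
      then show ?thesis using g2 by (simp add: g_def)
    qed
    ultimately have "(F x + B) * (F x * (\<phi> x)\<^sup>2 + B2) = (F x * \<phi> x + B1)\<^sup>2"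
      using isometry_multiplicative[OF T h p, of x] by simp
    moreover have "(F x + B) * (F x * (\<phi> x)\<^sup>2 + B2) - (F x * \<phi> x + B1)\<^sup>2
        = F x * (B2 + B * (\<phi> x)\<^sup>2 - 2 * \<phi> x * B1) + (B * B2 - B1\<^sup>2)"
      by (simp add: power2_eq_square algebra_simps)
    ultimately have "F x * (B2 + B * (\<phi> x)\<^sup>2 - 2 * \<phi> x * B1) = 0" using B by simp
    then have "B2 + B * (\<phi> x)\<^sup>2 - 2 * \<phi> x * B1 = 0" using x(2) by simp
    then have "B * (B2 + B * (\<phi> x)\<^sup>2 - 2 * \<phi> x * B1) = 0" by simp
    moreover have "B * (B2 + B * (\<phi> x)\<^sup>2 - 2 * \<phi> x * B1) = (B * B2 - B1\<^sup>2) + (B1 - \<phi> x * B)\<^sup>2"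
      by (simp add: power2_eq_square algebra_simps)
    ultimately have "(B1 - \<phi> x * B)\<^sup>2 = 0" using B by simp
    then show "T (\<lambda>z. z * f z) x = \<phi> x * T f x" by (simp add: B1_def B_def)
  qed
  have "T f z = F z * f (\<phi> z)" if f: "f \<in> hardy_space p" and z: "cmod z < 1" for f z
  proof -
    obtain k where k: "k \<in> hardy_space p" "f = (\<lambda>x. f (\<phi> z) * disc_one x + (x * k x + (- \<phi> z) * k x))"
      using hardy_divided_difference[OF f p(1) lt[OF z]] by blast
    have k1: "(\<lambda>x. x * k x) \<in> hardy_space p" using hardy_power_mult[OF k(1) p(1), of 1] by simp
    have "T f = T (\<lambda>x. f (\<phi> z) * disc_one x + (x * k x + (- \<phi> z) * k x))" using k(2) by (rule arg_cong)
    also have "\<dots> = (\<lambda>x. T (\<lambda>x. f (\<phi> z) * disc_one x) x + (T (\<lambda>x. x * k x) x + T (\<lambda>x. (- \<phi> z) * k x) x))"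
      by (subst Ta, (intro hardy_add hardy_cmult one k k1 p)+, subst Ta, (intro hardy_add hardy_cmult one k k1 p)+) (rule refl)
    finally have "T f z = T (\<lambda>x. f (\<phi> z) * disc_one x) z + (T (\<lambda>x. x * k x) z + T (\<lambda>x. (- \<phi> z) * k x) z)"
      by simp
    also have "\<dots> = f (\<phi> z) * F z + (\<phi> z * T k z + (- \<phi> z) * T k z)"
      using shift[OF k(1), of z] z by (simp only: Tc[OF one(1)] Tc[OF k(1)] F_def mem_ball_0)
    finally show ?thesis by simp
  qed
  then show ?thesis using that[OF \<phi>(1) lt] unfolding F_def by blast
qed

section \<open>Surjective isometries and their pointwise limits\<close>

text \<open>After composition with a Moebius map that makes 0 a fixed point, the Schwarz lemma for the map and its
  inverse leaves only a rotation.\<close>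

lemma disc_automorphism_mob:
  assumes hol: "\<phi> holomorphic_on ball 0 1" "\<psi> holomorphic_on ball 0 1"
    and b: "\<And>z. cmod z < 1 \<Longrightarrow> cmod (\<phi> z) < 1" "\<And>z. cmod z < 1 \<Longrightarrow> cmod (\<psi> z) < 1"
    and inv: "\<And>z. cmod z < 1 \<Longrightarrow> \<phi> (\<psi> z) = z" "\<And>z. cmod z < 1 \<Longrightarrow> \<psi> (\<phi> z) = z"
  obtains u w where "cmod u = 1" "cmod w < 1" "\<And>z. cmod z < 1 \<Longrightarrow> \<phi> z = mob u w z"
proof -
  define w where "w = \<psi> 0"
  have w: "cmod w < 1" "\<phi> w = 0" using b(2)[of 0] inv(1)[of 0] by (auto simp: w_def)
  have w': "cmod (- w) < 1" using w by simp
  define h where "h = (\<lambda>z. \<phi> (mob 1 (- w) z))"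
  define h' where "h' = (\<lambda>z. mob 1 w (\<psi> z))"
  have m: "cmod (mob 1 (- w) z) < 1" "cmod (mob 1 w z) < 1" if "cmod z < 1" for z
    using norm_mob_less[of "- w" z 1] norm_mob_less[of w z 1] w that by auto
  have hh: "cmod (h z) < 1" "cmod (h' z) < 1" if "cmod z < 1" for z
    using that m b by (auto simp: h_def h'_def)
  have holh: "h holomorphic_on ball 0 1"
    unfolding h_def
    by (rule holomorphic_on_compose_gen[OF _ hol(1), unfolded o_def])
       (use m in \<open>auto intro: holomorphic_on_subset[OF mob_holomorphic[OF w']]\<close>)
  have holh': "h' holomorphic_on ball 0 1"
    unfolding h'_def
    by (rule holomorphic_on_compose_gen[OF hol(2) holomorphic_on_subset[OF mob_holomorphic[OF w(1)], of "ball 0 1"], unfolded o_def])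
       (use b in auto)
  have h0: "h 0 = 0" "h' 0 = 0" using w by (auto simp: h_def h'_def mob_def w_def)
  have h'h: "h' (h z) = z" if "cmod z < 1" for z
    using inv(2)[OF m(1)[OF that]] mob_inverse'[of w z 1] w that by (simp add: h_def h'_def)
  have "cmod (h z) \<le> cmod z" "cmod (h' z) \<le> cmod z" if "cmod z < 1" for z
    using Schwarz_Lemma(1)[OF holh h0(1) hh(1) that] Schwarz_Lemma(1)[OF holh' h0(2) hh(2) that] by auto
  from this(1)[of "1/2"] this(2)[of "h (1/2)"] have "cmod (h (1/2)) = cmod (1/2)"
    using h'h[of "1/2"] hh(1)[of "1/2"] by simp
  then have "\<exists>z. cmod z < 1 \<and> z \<noteq> 0 \<and> cmod (h z) = cmod z" by (intro exI[of _ "1/2"]) auto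
  then obtain \<alpha> where \<alpha>: "\<And>z. cmod z < 1 \<Longrightarrow> h z = \<alpha> * z" "cmod \<alpha> = 1"
    using Schwarz_Lemma(3)[OF holh h0(1) hh(1), of 0] by auto
  have "\<phi> z = mob \<alpha> w z" if z: "cmod z < 1" for z
  proof -
    have "\<phi> z = h (mob 1 w z)" using mob_inverse[of w z 1] w z by (simp add: h_def)
    also have "\<dots> = \<alpha> * mob 1 w z" using \<alpha>(1) m(2)[OF z] by simp
    finally show ?thesis by (simp add: mob_def)
  qed
  then show ?thesis using that \<alpha>(2) w(1) by blast
qed

lemma isometry_group_subset: "isometry_group p \<subseteq> hardy_isometries p"
  by (auto simp: isometry_group_def hardy_isometries_def)

lemma hardy_isometry_inj:
  assumes T: "T \<in> hardy_isometries p" and p: "0 < p" and fg: "f \<in> hardy_space p" "g \<in> hardy_space p" "T f = T g"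
  shows "f = g"
proof -
  have h: "(\<lambda>z. f z - g z) \<in> hardy_space p" by (rule hardy_diff[OF fg(1,2) p])
  have "T (\<lambda>z. f z - g z) = (\<lambda>_. 0)"
    using hardy_isometry_diff[OF T p fg(1,2)] fg(3) by simp
  then have "hardy_norm p (\<lambda>z. f z - g z) = 0"
    using hardy_isometriesD(1,3)[OF T h] hardy_norm_zero_iff[of "T (\<lambda>z. f z - g z)" p] p by simp
  then have "(\<lambda>z. f z - g z) = (\<lambda>_. 0)" using hardy_norm_zero_iff[OF h p] by blast
  then show ?thesis by (simp add: fun_eq_iff)
qed

lemma isometry_group_inverse:
  assumes L: "L \<in> isometry_group p" and p: "0 < p"
  obtains S where "S \<in> hardy_isometries p"
    "\<And>f. f \<in> hardy_space p \<Longrightarrow> L (S f) = f" "\<And>f. f \<in> hardy_space p \<Longrightarrow> S (L f) = f"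
proof -
  have Liso: "L \<in> hardy_isometries p" using L isometry_group_subset by blast
  note LH = hardy_isometriesD(1-3)[OF Liso] and La = hardy_isometriesD(4)[OF Liso]
  have surj: "L ` hardy_space p = hardy_space p" using L by (simp add: isometry_group_def)
  define S where "S = restrict (inv_into (hardy_space p) L) (hardy_space p)"
  have LS: "L (S f) = f" and SH: "S f \<in> hardy_space p" if "f \<in> hardy_space p" for f
  proof -
    have f: "f \<in> L ` hardy_space p" using that surj by simp
    show "L (S f) = f" "S f \<in> hardy_space p"
      using f_inv_into_f[OF f] inv_into_into[OF f] that by (simp_all add: S_def)
  qed
  have SL: "S f = g" if "g \<in> hardy_space p" "f = L g" for f g
  proof -
    have f: "f \<in> hardy_space p" using LH(1)[OF that(1)] that(2) by simp
    show ?thesis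
      by (rule hardy_isometry_inj[OF Liso p SH[OF f] that(1)]) (use LS[OF f] that(2) in simp)
  qed
  have "S \<in> hardy_isometries p"
    unfolding hardy_isometries_def linear_operators_def mem_Collect_eq
  proof (intro conjI ballI allI)
    show "S \<in> hardy_space p \<rightarrow>\<^sub>E hardy_space p" using SH by (auto simp: S_def)
    fix f assume f: "f \<in> hardy_space p"
    show "S (\<lambda>z. f z + g z) = (\<lambda>z. S f z + S g z)" if g: "g \<in> hardy_space p" for g
      by (rule SL) (use hardy_add[OF SH[OF f] SH[OF g] p] La[OF SH[OF f] SH[OF g]] LS f g in auto)
    show "S (\<lambda>z. c * f z) = (\<lambda>z. c * S f z)" for c
      by (rule SL) (use hardy_cmult[OF SH[OF f] p] LH(2)[OF SH[OF f]] LS f in auto)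
    show "hardy_norm p (S f) = hardy_norm p f" using LH(3)[OF SH[OF f]] LS[OF f] by simp
  qed
  then show ?thesis using that LS SL by blast
qed

text \<open>The powers of the multiplier, applied to the function 1, stay in the unit sphere.\<close>

lemma isometric_multiplier_le_1:
  assumes p: "0 < p" and z: "cmod z < 1"
    and m: "\<And>h. h \<in> hardy_space p \<Longrightarrow>
      \<exists>k\<in>hardy_space p. hardy_norm p k = hardy_norm p h \<and> (\<forall>z\<in>ball 0 1. k z = m z * h z)"
  shows "cmod (m z) \<le> 1"
proof -
  have "\<exists>k\<in>hardy_space p. hardy_norm p k = hardy_norm p disc_one \<and> (\<forall>z\<in>ball 0 1. k z = 1 * m z ^ n)" for n
  proof (induction n)
    case 0
    then show ?case using disc_one_hardy(1)[OF p] by (auto simp: disc_one_def intro!: bexI[of _ disc_one])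
  next
    case (Suc n)
    then obtain k where k: "k \<in> hardy_space p" "hardy_norm p k = hardy_norm p disc_one" "\<forall>z\<in>ball 0 1. k z = 1 * m z ^ n" by blast
    from m[OF k(1)] show ?case using k(2,3) by auto
  qed
  then obtain h where h: "\<And>n. h n \<in> hardy_space p" "\<And>n. hardy_norm p (h n) = hardy_norm p disc_one"
      "\<And>n z. z \<in> ball 0 1 \<Longrightarrow> h n z = 1 * m z ^ n"
    by metis
  show ?thesis
    by (rule hardy_geometric_values_bound[OF p z, of 1 h])
       (use h(1,3) z disc_one_hardy(2)[OF p] in \<open>auto simp: h(2)\<close>)
qed

text \<open>The representations of \<open>L\<close> and of its inverse show that \<open>\<phi>\<close> is bijective. What remains after dividing the
  weight by that of the explicit isometry for \<open>\<phi>\<close> is a multiplier, isometric together with its inverse, and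
  hence a unimodular constant.\<close>

theorem isometry_group_wcomp:
  assumes L: "L \<in> isometry_group p" and p: "0 < p" "p \<noteq> 2"
  obtains c u w where "cmod c = 1" "cmod u = 1" "cmod w < 1" "\<And>f. f \<in> hardy_space p \<Longrightarrow> L f = wcomp p c u w f"
proof -
  have Liso: "L \<in> hardy_isometries p" using L isometry_group_subset by blast
  have LH: "L f \<in> hardy_space p" "hardy_norm p (L f) = hardy_norm p f" if "f \<in> hardy_space p" for f
    using Liso that by (auto simp: hardy_isometries_def linear_operators_def)
  obtain S where S: "S \<in> hardy_isometries p" "\<And>f. f \<in> hardy_space p \<Longrightarrow> L (S f) = f" "\<And>f. f \<in> hardy_space p \<Longrightarrow> S (L f) = f"
    using isometry_group_inverse[OF L p(1)] by blast
  have SH: "S f \<in> hardy_space p" "hardy_norm p (S f) = hardy_norm p f" if "f \<in> hardy_space p" for f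
    using S(1) that by (auto simp: hardy_isometries_def linear_operators_def)
  note one = disc_one_hardy(1)[OF p(1)]
  have id: "(\<lambda>z. z * disc_one z) \<in> hardy_space p" using hardy_power_mult[OF one p(1), of 1] by simp
  obtain \<phi> where \<phi>: "\<phi> holomorphic_on ball 0 1" "\<And>z. cmod z < 1 \<Longrightarrow> cmod (\<phi> z) < 1"
    "\<And>f z. f \<in> hardy_space p \<Longrightarrow> cmod z < 1 \<Longrightarrow> L f z = L disc_one z * f (\<phi> z)"
    using hardy_isometry_weighted_composition[OF Liso p] by blast
  obtain \<psi> where \<psi>: "\<psi> holomorphic_on ball 0 1" "\<And>z. cmod z < 1 \<Longrightarrow> cmod (\<psi> z) < 1"
    "\<And>f z. f \<in> hardy_space p \<Longrightarrow> cmod z < 1 \<Longrightarrow> S f z = S disc_one z * f (\<psi> z)"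
    using hardy_isometry_weighted_composition[OF S(1) p] by blast
  have LS: "f z = L disc_one z * (S disc_one (\<phi> z) * f (\<psi> (\<phi> z)))" if "f \<in> hardy_space p" "cmod z < 1" for f z
    using \<phi>(3)[OF SH(1)[OF that(1)] that(2)] \<psi>(3)[OF that(1) \<phi>(2)[OF that(2)]] S(2)[OF that(1)] by simp
  have SL: "f z = S disc_one z * (L disc_one (\<psi> z) * f (\<phi> (\<psi> z)))" if "f \<in> hardy_space p" "cmod z < 1" for f z
    using \<psi>(3)[OF LH(1)[OF that(1)] that(2)] \<phi>(3)[OF that(1) \<psi>(2)[OF that(2)]] S(3)[OF that(1)] by simp
  have inv1: "\<psi> (\<phi> z) = z" and nz: "L disc_one z \<noteq> 0" if z: "cmod z < 1" for z
  proof -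
    have a: "1 = L disc_one z * S disc_one (\<phi> z)"
      using LS[OF one z] \<psi>(2)[OF \<phi>(2)[OF z]] z by (simp add: disc_one_def)
    have "z = L disc_one z * S disc_one (\<phi> z) * \<psi> (\<phi> z)"
      using LS[OF id z] \<psi>(2)[OF \<phi>(2)[OF z]] z by (simp add: disc_one_def mult.assoc)
    then show "\<psi> (\<phi> z) = z" using a by simp
    show "L disc_one z \<noteq> 0" using a by auto
  qed
  have inv2: "\<phi> (\<psi> z) = z" if z: "cmod z < 1" for z
  proof -
    have a: "1 = S disc_one z * L disc_one (\<psi> z)"
      using SL[OF one z] \<phi>(2)[OF \<psi>(2)[OF z]] z by (simp add: disc_one_def)
    have "z = S disc_one z * L disc_one (\<psi> z) * \<phi> (\<psi> z)"
      using SL[OF id z] \<phi>(2)[OF \<psi>(2)[OF z]] z by (simp add: disc_one_def mult.assoc)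
    then show ?thesis using a by simp
  qed
  obtain u w where uw: "cmod u = 1" "cmod w < 1" "\<And>z. cmod z < 1 \<Longrightarrow> \<phi> z = mob u w z"
    using disc_automorphism_mob[OF \<phi>(1) \<psi>(1) \<phi>(2) \<psi>(2) inv2 inv1] by blast
  have n1: "cmod 1 = 1" by simp
  define G where "G = (\<lambda>z. L disc_one z / kern p w z)"
  have knz: "kern p w z \<noteq> 0" if "cmod z < 1" for z using kern_nz[of w z p] uw that by simp
  have Gnz: "G z \<noteq> 0" if "cmod z < 1" for z using knz[OF that] nz[OF that] by (simp add: G_def)
  have Lf: "L f z = G z * wcomp p 1 u w f z" if "f \<in> hardy_space p" "cmod z < 1" for f z
    using \<phi>(3)[OF that] uw(3)[OF that(2)] knz[OF that(2)] that(2) by (simp add: G_def wcomp_def)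
  \<comment> \<open>After division by an explicit isometry only a multiplier is left; it and its inverse are isometric.\<close>
  have G1: "cmod (G z) \<le> 1" if z: "cmod z < 1" for z
  proof (rule isometric_multiplier_le_1[OF p(1) z])
    fix h assume h: "h \<in> hardy_space p"
    obtain c' where c': "cmod c' = 1" "wcomp p 1 u w (wcomp p c' (cnj u) (- (u * w)) h) = h"
      using wcomp_right_inverse[OF p(1) n1 uw(1,2)] h by metis
    define f where "f = wcomp p c' (cnj u) (- (u * w)) h"
    have f: "f \<in> hardy_space p"
      unfolding f_def by (rule wcomp_bounded[OF h p(1) c'(1)]) (use uw in \<open>auto simp: norm_mult\<close>)
    have fh: "wcomp p 1 u w f = h" using c' by (simp add: f_def)
    have "hardy_norm p f = hardy_norm p h" using wcomp_isometry[OF f p(1) n1 uw(1,2)] fh by simp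
    then show "\<exists>k\<in>hardy_space p. hardy_norm p k = hardy_norm p h \<and> (\<forall>z\<in>ball 0 1. k z = G z * h z)"
      using LH[OF f] Lf[OF f] fh by (intro bexI[of _ "L f"]) auto
  qed
  have G2: "cmod (inverse (G z)) \<le> 1" if z: "cmod z < 1" for z
  proof (rule isometric_multiplier_le_1[OF p(1) z])
    fix h assume h: "h \<in> hardy_space p"
    have f: "S h \<in> hardy_space p" by (rule SH[OF h])
    have "hardy_norm p (wcomp p 1 u w (S h)) = hardy_norm p h"
      using wcomp_isometry[OF f p(1) n1 uw(1,2)] SH(2)[OF h] by simp
    moreover have "wcomp p 1 u w (S h) z = inverse (G z) * h z" if "z \<in> ball 0 1" for z
      using Lf[OF f, of z] S(2)[OF h] Gnz[of z] that by simp
    ultimately show "\<exists>k\<in>hardy_space p. hardy_norm p k = hardy_norm p h \<and> (\<forall>z\<in>ball 0 1. k z = inverse (G z) * h z)"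
      using wcomp_bounded(1)[OF f p(1) n1 uw(1,2)] by blast
  qed
  have G: "cmod (G z) = 1" if "z \<in> ball 0 1" for z
  proof -
    have "cmod (G z) > 0" "1 \<le> cmod (G z)"
      using Gnz[of z] G2[of z] that by (auto simp: norm_inverse inverse_le_1_iff)
    then show ?thesis using G1[of z] that by simp
  qed
  have "G holomorphic_on ball 0 1"
    unfolding G_def using LH(1)[OF one] knz
    by (intro holomorphic_intros holomorphic_on_subset[OF kern_holomorphic[OF uw(2)]]) (auto simp: hardy_space_def)
  then obtain c where c: "cmod c = 1" "\<And>z. z \<in> ball 0 1 \<Longrightarrow> G z = c"
    using holomorphic_unimodular_constant[of G] G by blast
  have "L f = wcomp p c u w f" if f: "f \<in> hardy_space p" for f
  proof
    fix z show "L f z = wcomp p c u w f z"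
    proof (cases "z \<in> ball 0 1")
      case True
      then show ?thesis using Lf[OF f, of z] c(2)[OF True] by (simp add: wcomp_def)
    next
      case False
      then show ?thesis using LH(1)[OF f] by (simp add: wcomp_def hardy_space_def)
    qed
  qed
  then show ?thesis using that c(1) uw by blast
qed

lemma wcomp_isometry_group:
  assumes p: "0 < p" and cuw: "cmod c = 1" "cmod u = 1" "cmod w < 1"
  shows "restrict (wcomp p c u w) (hardy_space p) \<in> isometry_group p"
proof -
  have H: "wcomp p c u w f \<in> hardy_space p" if "f \<in> hardy_space p" for f
    by (rule wcomp_bounded(1)[OF that p cuw])
  have "\<exists>f\<in>hardy_space p. wcomp p c u w f = h" if h: "h \<in> hardy_space p" for h
  proof -
    obtain c' where c': "cmod c' = 1" "wcomp p c u w (wcomp p c' (cnj u) (- (u * w)) h) = h"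
      using wcomp_right_inverse[OF p cuw] h by metis
    have "wcomp p c' (cnj u) (- (u * w)) h \<in> hardy_space p"
      by (rule wcomp_bounded[OF h p c'(1)]) (use cuw in \<open>auto simp: norm_mult\<close>)
    then show ?thesis using c' by blast
  qed
  then have surj: "hardy_space p \<subseteq> wcomp p c u w ` hardy_space p" by blast
  show ?thesis
    unfolding isometry_group_def linear_operators_def mem_Collect_eq
  proof (intro conjI ballI allI)
    show "restrict (wcomp p c u w) (hardy_space p) \<in> hardy_space p \<rightarrow>\<^sub>E hardy_space p" using H by auto
    show "restrict (wcomp p c u w) (hardy_space p) ` hardy_space p = hardy_space p"
      using H surj by auto
    fix f assume f: "f \<in> hardy_space p"
    show "hardy_norm p (restrict (wcomp p c u w) (hardy_space p) f) = hardy_norm p f"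
      using wcomp_isometry[OF f p cuw] f by simp
    show "restrict (wcomp p c u w) (hardy_space p) (\<lambda>z. f z + g z)
       = (\<lambda>z. restrict (wcomp p c u w) (hardy_space p) f z + restrict (wcomp p c u w) (hardy_space p) g z)"
      if g: "g \<in> hardy_space p" for g
      using f g hardy_add(1)[OF f g p] by (auto simp: wcomp_def fun_eq_iff algebra_simps)
    show "restrict (wcomp p c u w) (hardy_space p) (\<lambda>z. a * f z)
       = (\<lambda>z. a * restrict (wcomp p c u w) (hardy_space p) f z)" for a
      using f hardy_cmult[OF f p] by (auto simp: wcomp_def fun_eq_iff algebra_simps)
  qed
qed

lemma hardy_dist_isometry:
  assumes T: "T \<in> hardy_isometries p" and p: "0 < p" and fg: "f \<in> hardy_space p" "g \<in> hardy_space p"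
  shows "hardy_dist p (T f) (T g) = hardy_dist p f g"
  using hardy_isometry_diff[OF T p fg] hardy_isometriesD(3)[OF T hardy_diff[OF fg p]]
  by (simp add: hardy_dist_def)

lemma isometry_group_subset_ref_to:
  assumes p: "0 < p"
  shows "isometry_group p \<subseteq> ref_to p (isometry_group p)"
proof
  fix T assume T: "T \<in> isometry_group p"
  then have Ti: "T \<in> hardy_isometries p" and TL: "T \<in> linear_operators p"
    using isometry_group_subset by (auto simp: isometry_group_def)
  interpret Metric_space "hardy_space p" "hardy_dist p" by (rule Metric_space_hardy[OF p])
  have TH: "T f \<in> hardy_space p" if "f \<in> hardy_space p" for f
    using TL that by (auto simp: linear_operators_def)
  have "continuous_map (hardy_topology p) (hardy_topology p) T"
    unfolding hardy_topology_def metric_continuous_map[OF Metric_space_hardy[OF p]]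
    using TH hardy_dist_isometry[OF Ti p] by auto
  moreover have "T f \<in> hardy_topology p closure_of {L f |L. L \<in> isometry_group p}" if f: "f \<in> hardy_space p" for f
    unfolding hardy_topology_def metric_closure_of using TH[OF f] T by (auto simp: in_mball)
  ultimately show "T \<in> ref_to p (isometry_group p)"
    using TL by (auto simp: ref_to_def continuous_operators_def)
qed

lemma ref_to_approximation:
  assumes T: "T \<in> ref_to p (isometry_group p)" and p: "0 < p" and f: "f \<in> hardy_space p"
  obtains L where "\<And>n. L n \<in> isometry_group p" "(\<lambda>n. hardy_dist p (T f) (L n f)) \<longlonglongrightarrow> 0"
proof -
  interpret Metric_space "hardy_space p" "hardy_dist p" by (rule Metric_space_hardy[OF p])
  have "T f \<in> hardy_topology p closure_of {L f |L. L \<in> isometry_group p}"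
    using T f by (simp add: ref_to_def)
  then have "\<exists>L \<in> isometry_group p. hardy_dist p (T f) (L f) < inverse (real (Suc n))" for n
    unfolding hardy_topology_def metric_closure_of in_mball
    by (smt (verit, best) inverse_positive_iff_positive mem_Collect_eq of_nat_0_less_iff zero_less_Suc)
  then obtain L where L: "\<And>n. L n \<in> isometry_group p" "\<And>n. hardy_dist p (T f) (L n f) < inverse (real (Suc n))"
    by metis
  have "(\<lambda>n. hardy_dist p (T f) (L n f)) \<longlonglongrightarrow> 0"
    by (rule tendsto_sandwich[OF _ _ tendsto_const LIMSEQ_inverse_real_of_nat])
       (use L(2) in \<open>auto simp: less_imp_le\<close>)
  then show ?thesis using that L(1) by blast
qed

text \<open>All elements of the closure of an orbit have the same norm.\<close>

lemma ref_to_isometry: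
  assumes T: "T \<in> ref_to p (isometry_group p)" and p: "0 < p"
  shows "T \<in> hardy_isometries p"
proof -
  have TL: "T \<in> linear_operators p" using T by (simp add: ref_to_def continuous_operators_def)
  have "hardy_norm p (T f) = hardy_norm p f" if f: "f \<in> hardy_space p" for f
  proof -
    obtain L where L: "\<And>n. L n \<in> isometry_group p" "(\<lambda>n. hardy_dist p (T f) (L n f)) \<longlonglongrightarrow> 0"
      using ref_to_approximation[OF T p f] by blast
    interpret Metric_space "hardy_space p" "hardy_dist p" by (rule Metric_space_hardy[OF p])
    have TH: "T f \<in> hardy_space p" using TL f by (auto simp: linear_operators_def)
    have LH: "L n f \<in> hardy_space p" and Ln: "hardy_norm p (L n f) = hardy_norm p f" for n
      using L(1)[of n] f by (auto simp: isometry_group_def linear_operators_def)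
    have z: "(\<lambda>_. 0) \<in> hardy_space p" using hardy_cmult[OF f p, of 0] by simp
    define a where "a = hardy_norm p (T f) powr min 1 p"
    define b where "b = hardy_norm p f powr min 1 p"
    have ab: "hardy_dist p (T f) (\<lambda>_. 0) = a" "hardy_dist p (L n f) (\<lambda>_. 0) = b" for n
      by (simp_all add: hardy_dist_def a_def b_def Ln)
    have "\<bar>a - b\<bar> \<le> hardy_dist p (T f) (L n f)" for n
      using triangle[OF TH LH z, of n] triangle[OF LH TH z, of n] ab(1) ab(2)[of n] commute[of "L n f" "T f"] by linarith
    then have "\<bar>a - b\<bar> \<le> 0" by (intro LIMSEQ_le_const[OF L(2)]) auto
    then have "a = b" by simp
    then show ?thesis
      unfolding a_def b_def
      by (rule powr_base_inj) (use p hardy_norm_nonneg[OF TH] hardy_norm_nonneg[OF f] in auto)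
  qed
  then show ?thesis using TL by (simp add: hardy_isometries_def)
qed

lemma hardy_dist_tendsto_pointwise:
  assumes g: "g \<in> hardy_space p" and h: "\<And>n. h n \<in> hardy_space p" and p: "0 < p"
    and lim: "(\<lambda>n. hardy_dist p g (h n)) \<longlonglongrightarrow> 0" and z: "cmod z < 1"
  shows "(\<lambda>n. h n z) \<longlonglongrightarrow> g z"
proof -
  define c where "c = 1 - (cmod z)\<^sup>2"
  have c: "c > 0" using z by (simp add: c_def abs_square_less_1)
  define q where "q = min 1 p"
  have q: "q > 0" using p by (simp add: q_def)
  have le: "cmod (g z - h n z) \<le> ((hardy_dist p g (h n)) powr (p / q) / c) powr (1 / p)" for n
  proof -
    have d: "(\<lambda>z. g z - h n z) \<in> hardy_space p" by (rule hardy_diff[OF g h p])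
    have "hardy_dist p g (h n) powr (p / q) = hardy_pow p (\<lambda>z. g z - h n z)"
      using q by (simp add: hardy_dist_def q_def[symmetric] powr_powr)
    then have "cmod (g z - h n z) powr p \<le> hardy_dist p g (h n) powr (p / q) / c"
      using hardy_point_bound[OF d p z] c by (simp add: c_def field_simps)
    then have "(cmod (g z - h n z) powr p) powr (1 / p) \<le> (hardy_dist p g (h n) powr (p / q) / c) powr (1 / p)"
      using p by (intro powr_mono2) auto
    then show ?thesis using p by (simp add: powr_powr)
  qed
  have "(\<lambda>n. (hardy_dist p g (h n) powr (p / q) / c) powr (1 / p)) \<longlonglongrightarrow> (0 powr (p / q) / c) powr (1 / p)"
    using c p q by (intro tendsto_intros tendsto_powr' lim) (auto simp: hardy_dist_def)
  then have "(\<lambda>n. (hardy_dist p g (h n) powr (p / q) / c) powr (1 / p)) \<longlonglongrightarrow> 0" by simp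
  then have "(\<lambda>n. cmod (g z - h n z)) \<longlonglongrightarrow> 0"
    by (rule tendsto_sandwich[OF _ _ tendsto_const, rotated 2]) (use le in auto)
  then have "(\<lambda>n. g z - h n z) \<longlonglongrightarrow> 0" by (simp add: tendsto_norm_zero_iff)
  then have "(\<lambda>n. g z - (g z - h n z)) \<longlonglongrightarrow> g z - 0" by (intro tendsto_diff tendsto_const)
  then show ?thesis by simp
qed

lemma kern_continuous_parameter:
  assumes p: "0 < p" and z: "cmod z < 1"
  shows "continuous_on (cball 0 1) (\<lambda>w. kern p w z)" "continuous_on (sphere 0 1 \<times> cball 0 1) (\<lambda>y. mob (fst y) (snd y) z)"
proof -
  have re: "Re (1 - cnj w * z) > 0" if "cmod w \<le> 1" for w
  proof -
    have "cmod (cnj w * z) < 1" using that z mult_right_mono[OF that, of "cmod z"] by (simp add: norm_mult)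
    then show ?thesis using complex_Re_le_cmod[of "cnj w * z"] by simp
  qed
  have nz: "1 - cnj w * z \<noteq> 0" if "cmod w \<le> 1" for w
    using re[OF that] by (metis less_irrefl zero_complex.simps(1))
  show "continuous_on (cball 0 1) (\<lambda>w. kern p w z)"
  proof -
    have powr: "(\<lambda>x. x powr of_real (- 2 / p)) holomorphic_on {x :: complex. Re x > 0}"
      by (intro holomorphic_intros) (auto simp: complex_nonpos_Reals_iff)
    have "continuous_on (cball 0 1) (\<lambda>w. (1 - cnj w * z) powr of_real (- 2 / p))"
      by (rule continuous_on_compose2[OF holomorphic_on_imp_continuous_on[OF powr]])
         (use re in \<open>auto intro!: continuous_intros\<close>)
    moreover have "continuous_on (cball 0 1) (\<lambda>w::complex. (1 - (cmod w)\<^sup>2) powr (1 / p))"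
      by (intro continuous_on_powr' continuous_intros) (use p in \<open>auto simp: power_le_one\<close>)
    ultimately show ?thesis unfolding kern_def by (intro continuous_on_mult continuous_on_of_real)
  qed
  show "continuous_on (sphere 0 1 \<times> cball 0 1) (\<lambda>y. mob (fst y) (snd y) z)"
    unfolding mob_def by (intro continuous_intros) (use nz in auto)
qed

text \<open>
  The parameters of the approximating isometries accumulate in a compact set, and the limit is of the same
  form for a parameter in that set. A parameter \<open>w\<close> on the unit circle makes the weight vanish, whereas
  the limit has norm 1.
\<close>

lemma orbit_closed:
  assumes T: "T \<in> ref_to p (isometry_group p)" and p: "0 < p" "p \<noteq> 2"
  obtains c u w where "cmod c = 1" "cmod u = 1" "cmod w < 1"
    "\<And>z. cmod z < 1 \<Longrightarrow> T (\<lambda>z. z ^ k * disc_one z) z = c * kern p w z * mob u w z ^ k"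
proof -
  note one = disc_one_hardy[OF p(1)]
  define f where "f = (\<lambda>z. z ^ k * disc_one z)"
  have f: "f \<in> hardy_space p" unfolding f_def by (rule hardy_power_mult[OF one(1) p(1)])
  obtain L where L: "\<And>n. L n \<in> isometry_group p" "(\<lambda>n. hardy_dist p (T f) (L n f)) \<longlonglongrightarrow> 0"
    using ref_to_approximation[OF T p(1) f] by blast
  have Ti: "T \<in> hardy_isometries p" by (rule ref_to_isometry[OF T p(1)])
  have TH: "T f \<in> hardy_space p" and Tn: "hardy_norm p (T f) = hardy_norm p f"
    using Ti f by (auto simp: hardy_isometries_def linear_operators_def)
  have LH: "L n f \<in> hardy_space p" for n
    using L(1)[of n] f by (auto simp: isometry_group_def linear_operators_def)
  have "\<exists>y. cmod (fst y) = 1 \<and> cmod (fst (snd y)) = 1 \<and> cmod (snd (snd y)) < 1 \<and> L n f = wcomp p (fst y) (fst (snd y)) (snd (snd y)) f" for n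
    using isometry_group_wcomp[OF L(1)[of n] p] f by (metis fst_conv snd_conv)
  then obtain y where y: "\<And>n. cmod (fst (y n)) = 1" "\<And>n. cmod (fst (snd (y n))) = 1" "\<And>n. cmod (snd (snd (y n))) < 1"
      "\<And>n. L n f = wcomp p (fst (y n)) (fst (snd (y n))) (snd (snd (y n))) f"
    by metis
  define K :: "(complex \<times> complex \<times> complex) set" where "K = sphere 0 1 \<times> sphere 0 1 \<times> cball 0 1"
  have "compact K" unfolding K_def by (intro compact_Times) auto
  moreover have yK: "y n \<in> K" for n using y(1-3)[of n] by (cases "y n") (auto simp: K_def)
  ultimately obtain x r where x: "x \<in> K" "strict_mono r" "(y \<circ> r) \<longlonglongrightarrow> x"
    unfolding compact_def by metis
  define Q where "Q = (\<lambda>y z. fst y * kern p (snd (snd y)) z * mob (fst (snd y)) (snd (snd y)) z ^ k)"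
  have Tz: "T f z = Q x z" if z: "cmod z < 1" for z
  proof -
    have "continuous_on K (\<lambda>y. Q y z)"
      unfolding Q_def
    proof (intro continuous_intros)
      show "continuous_on K (\<lambda>y. kern p (snd (snd y)) z)"
        by (rule continuous_on_compose2[OF kern_continuous_parameter(1)[OF p(1) z]]) (auto simp: K_def intro!: continuous_intros)
      show "continuous_on K (\<lambda>y. mob (fst (snd y)) (snd (snd y)) z)"
        by (rule continuous_on_compose2[OF kern_continuous_parameter(2)[OF p(1) z], of K snd]) (auto simp: K_def intro!: continuous_intros)
    qed
    from continuous_on_tendsto_compose[OF this x(3,1)]
    have "(\<lambda>n. Q (y (r n)) z) \<longlonglongrightarrow> Q x z" using yK by simp
    moreover have "L n f z = Q (y n) z" for n
    proof -
      have "cmod (mob (fst (snd (y n))) (snd (snd (y n))) z) < 1" by (rule norm_mob_less[OF y(3) z y(2)])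
      then show ?thesis unfolding y(4)[of n] using z by (simp add: wcomp_def Q_def f_def disc_one_def)
    qed
    moreover have "(\<lambda>n. L n f z) \<longlonglongrightarrow> T f z"
      by (rule hardy_dist_tendsto_pointwise[OF TH LH p(1) L(2) z])
    then have "(\<lambda>n. L (r n) f z) \<longlonglongrightarrow> T f z"
      using LIMSEQ_subseq_LIMSEQ[OF _ x(2)] by (fastforce simp: o_def)
    ultimately show ?thesis using LIMSEQ_unique by simp
  qed
  have xc: "cmod (fst x) = 1" "cmod (fst (snd x)) = 1" "cmod (snd (snd x)) \<le> 1"
    using x(1) by (auto simp: K_def)
  have "cmod (snd (snd x)) \<noteq> 1"
  proof
    assume "cmod (snd (snd x)) = 1"
    then have "T f z = 0" for z
      using Tz[of z] TH p by (cases "cmod z < 1") (auto simp: Q_def kern_def hardy_space_def)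
    then have "T f = (\<lambda>_. 0)" by auto
    then have "hardy_pow p f = 0" using Tn hardy_norm_zero_iff[OF TH p(1)] p by simp
    then show False using hardy_pow_power_mult[OF one(1) p(1), of k] one(2) by (simp add: f_def)
  qed
  then have "cmod (snd (snd x)) < 1" using xc by simp
  then show ?thesis using that[OF xc(1,2)] Tz unfolding Q_def f_def by blast
qed

text \<open>On the circle the Moebius map has modulus 1, so that the quotient of the weights is at most 1 there and, being
  holomorphic, in the disc. The \<open>p\<close>-th power of its modulus at \<open>w'\<close> is
  \<open>1 + |w' - w|\<^sup>2 / ((1 - |w|\<^sup>2) (1 - |w'|\<^sup>2))\<close> by the Schwarz-Pick identity.\<close>

lemma kern_domination_imp_eq:
  assumes p: "0 < p" and w: "cmod w < 1" "cmod w' < 1" and u: "cmod u = 1"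
    and le: "\<And>z. cmod z < 1 \<Longrightarrow> cmod (kern p w' z * mob u w' z) \<le> cmod (kern p w z)"
  shows "w' = w"
proof -
  define h where "h = (\<lambda>z. kern p w' z / kern p w z)"
  have holh: "h holomorphic_on cball 0 1"
    unfolding h_def using kern_nz[OF w(1)] by (intro holomorphic_intros kern_holomorphic w) auto
  have conth: "continuous_on (cball 0 1) h" by (rule holomorphic_on_imp_continuous_on[OF holh])
  have contm: "continuous_on (cball 0 1) (mob u w')" by (rule holomorphic_on_imp_continuous_on[OF mob_holomorphic[OF w(2)]])
  have hm: "cmod (h z * mob u w' z) \<le> 1" if "cmod z \<le> 1" for z
  proof (rule continuous_on_closure_norm_le[of "ball 0 1" "\<lambda>z. h z * mob u w' z"])
    show "continuous_on (closure (ball 0 1)) (\<lambda>z. h z * mob u w' z)"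
      using conth contm by (simp add: continuous_on_mult)
    show "\<forall>y\<in>ball 0 1. cmod (h y * mob u w' y) \<le> 1"
    proof
      fix y :: complex assume y: "y \<in> ball 0 1"
      have "kern p w y \<noteq> 0" using y by (intro kern_nz w) auto
      then show "cmod (h y * mob u w' y) \<le> 1" using le[of y] y by (simp add: h_def norm_mult norm_divide)
    qed
  qed (use that in auto)
  have "cmod (h w') \<le> 1"
  proof (rule maximum_modulus_frontier[of h "ball 0 1"])
    show "h holomorphic_on interior (ball 0 1)" using holomorphic_on_subset[OF holh] by (simp add: ball_subset_cball)
    show "continuous_on (closure (ball 0 1)) h" using conth by simp
    show "cmod (h z) \<le> 1" if "z \<in> frontier (ball 0 1)" for z
      using hm[of z] norm_mob_eq_1[OF w(2) _ u, of z] that by (simp add: norm_mult frontier_ball)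
  qed (use w in auto)
  then have "cmod (kern p w' w') \<le> cmod (kern p w w')"
    using kern_nz[OF w(1), of w' p] w by (simp add: h_def norm_divide divide_le_eq)
  then have le': "cmod (kern p w' w') powr p \<le> cmod (kern p w w') powr p"
    using p by (intro powr_mono2) auto
  define a where "a = 1 - (cmod w)\<^sup>2"
  define b where "b = 1 - (cmod w')\<^sup>2"
  define e where "e = (cmod (1 - cnj w * w'))\<^sup>2"
  have pos: "a > 0" "b > 0" "e > 0"
    using w one_minus_cnj_mult_nz[of w w'] by (auto simp: a_def b_def e_def abs_square_less_1)
  have "cmod (1 - cnj w' * w') = b"
  proof -
    have "1 - cnj w' * w' = of_real b" using complex_norm_square[of w'] by (simp add: b_def mult.commute)
    then show ?thesis using pos by simp
  qed
  then have "b / b\<^sup>2 \<le> a / e"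
    using le' w p by (simp add: norm_kern a_def b_def[symmetric] e_def)
  then have "e \<le> a * b" using pos by (simp add: field_simps power2_eq_square)
  moreover have "e = a * b + (cmod (w' - w))\<^sup>2"
    unfolding e_def a_def b_def by (rule moebius_norm_identity)
  ultimately have "(cmod (w' - w))\<^sup>2 \<le> 0" by simp
  then show ?thesis by simp
qed

lemma ref_to_subset_isometry_group:
  assumes p: "0 < p" "p \<noteq> 2"
  shows "ref_to p (isometry_group p) \<subseteq> isometry_group p"
proof
  fix T assume T: "T \<in> ref_to p (isometry_group p)"
  have Ti: "T \<in> hardy_isometries p" by (rule ref_to_isometry[OF T p(1)])
  have TE: "T \<in> hardy_space p \<rightarrow>\<^sub>E hardy_space p"
    using Ti by (simp add: hardy_isometries_def linear_operators_def)
  note one = disc_one_hardy(1)[OF p(1)]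
  have id: "(\<lambda>z. z ^ 1 * disc_one z) \<in> hardy_space p" by (rule hardy_power_mult[OF one p(1)])
  obtain \<phi> where \<phi>: "\<phi> holomorphic_on ball 0 1" "\<And>z. cmod z < 1 \<Longrightarrow> cmod (\<phi> z) < 1"
    "\<And>f z. f \<in> hardy_space p \<Longrightarrow> cmod z < 1 \<Longrightarrow> T f z = T disc_one z * f (\<phi> z)"
    using hardy_isometry_weighted_composition[OF Ti p] by blast
  obtain c u w where cuw: "cmod c = 1" "cmod u = 1" "cmod w < 1"
    "\<And>z. cmod z < 1 \<Longrightarrow> T (\<lambda>z. z ^ 0 * disc_one z) z = c * kern p w z * mob u w z ^ 0"
    using orbit_closed[OF T p] by blast
  have T1: "T disc_one z = c * kern p w z" if "cmod z < 1" for z using cuw(4)[OF that] by simp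
  obtain c' u' w' where cuw': "cmod c' = 1" "cmod u' = 1" "cmod w' < 1"
    "\<And>z. cmod z < 1 \<Longrightarrow> T (\<lambda>z. z ^ 1 * disc_one z) z = c' * kern p w' z * mob u' w' z ^ 1"
    using orbit_closed[OF T p] by blast
  have T\<phi>: "c * kern p w z * \<phi> z = c' * kern p w' z * mob u' w' z" if z: "cmod z < 1" for z
    using \<phi>(3)[OF id z] cuw'(4)[OF z] T1[OF z] \<phi>(2)[OF z] by (simp add: disc_one_def)
  have ww: "w' = w"
  proof (rule kern_domination_imp_eq[OF p(1) cuw(3) cuw'(3,2)])
    fix z :: complex assume z: "cmod z < 1"
    have "cmod (kern p w' z * mob u' w' z) = cmod (kern p w z) * cmod (\<phi> z)"
      using arg_cong[OF T\<phi>[OF z], of cmod] cuw(1) cuw'(1) by (simp add: norm_mult)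
    then show "cmod (kern p w' z * mob u' w' z) \<le> cmod (kern p w z)"
      using \<phi>(2)[OF z] by (simp add: mult_left_le)
  qed
  define v where "v = c' * u' / c"
  have v: "cmod v = 1" using cuw(1) cuw'(1,2) by (simp add: v_def norm_mult norm_divide)
  have \<phi>v: "\<phi> z = mob v w z" if z: "cmod z < 1" for z
  proof -
    have "kern p w z \<noteq> 0" using z by (intro kern_nz cuw) auto
    moreover have "c \<noteq> 0" using cuw(1) by auto
    ultimately have "\<phi> z = c' * mob u' w z / c" using T\<phi>[OF z] by (simp add: ww field_simps)
    then show ?thesis by (simp add: mob_def v_def mult_ac)
  qed
  have "T f = restrict (wcomp p c v w) (hardy_space p) f" for f
  proof (cases "f \<in> hardy_space p")
    case f: True
    have "T f z = wcomp p c v w f z" for z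
    proof (cases "cmod z < 1")
      case True
      then show ?thesis using \<phi>(3)[OF f True] T1[OF True] \<phi>v[OF True] by (simp add: wcomp_def)
    next
      case False
      moreover have "T f \<in> hardy_space p" using TE f by auto
      ultimately show ?thesis by (simp add: wcomp_def hardy_space_def)
    qed
    then show ?thesis using f by auto
  next
    case False
    then show ?thesis using TE by (auto simp: PiE_def extensional_def)
  qed
  then have "T = restrict (wcomp p c v w) (hardy_space p)" by (rule ext)
  then show "T \<in> isometry_group p" using wcomp_isometry_group[OF p(1) cuw(1) v cuw(3)] by simp
qed

theorem theorem4:
  fixes p :: real
  assumes "0 < p" and "p \<noteq> 2"
  shows "topologically_reflexive p (isometry_group p)"
  unfolding topologically_reflexive_def
  using isometry_group_subset_ref_to[of p] ref_to_subset_isometry_group[of p] assms by blast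

end
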